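(* Let $A:[0,\infty)\to\mathbb{R}^{d\times d}$ be continuous and bounded, let $1\le L\le d$, and assume that the system $\dot x=A(t)x$ is regular and $L$-dimensionally strongly fast invertible. Let $\Phi$ be a one-step method for this system that is consistent of order $p>0$. Then for Lebesgue-almost every tuple of initial vectors $(v_1,\dots,v_d)\in(\mathbb{R}^d)^d$ there exists $\epsilon>0$ such that for every sequence of stepsizes $(h_n)_{n\ge1}$ with $0<h_n\le h_{\max}$, $t_n=h_1+\dots+h_n\to\infty$ and $$\sum_{n=1}^\infty h_n^{p+1}<\epsilon,$$ the outputs $\mu_i(n)$ of Benettin's algorithm satisfy $$\lim_{n\to\infty}\big(\mu_1(n)+\dots+\mu_L(n)\big)=\Lambda_1+\dots+\Lambda_L .$$
   Context: Norms are Euclidean norms and associated operator norms. $X(t)$ denotes a fundamental matrix of $\dot x=A(t)x$ and $X(t,s)=X(t)X(s)^{-1}$ the Cauchy matrix. Lyapunov exponents: for a solution $x$ put $\chi[x]=\limsup_{t\to\infty}\frac1t\log\|x(t)\|$. The distinct values of $\chi$ on non-trivial solutions are $\lambda_1>\dots>\lambda_q$; with $V_i=\{x \text{ solution}:\chi[x]\le\lambda_i\}$, $V_{q+1}=\{0\}$, the multiplicity of $\lambda_i$ is $d_i=\dim V_i-\dim V_{i+1}$. Counted with multiplicity: $\Lambda_1\ge\dots\ge\Lambda_d$ (each $\lambda_i$ repeated $d_i$ times). The system is regular if $\sum_{i=1}^d\Lambda_i=\liminf_{t\to\infty}\frac1t\log|\det X(t)|$. The system is $L$-dimensionally strongly fast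 invertible if $\sup_{t\ge s\ge\tau\ge 0}\prod_{k=1}^L\frac{\sigma_k(X(t,s))\sigma_k(X(s,\tau))}{\sigma_k(X(t,\tau))}<\infty$, where $\sigma_1\ge\dots\ge\sigma_d$ denote singular values. One-step method: fix $0<h_{\max}<\infty$. A (linear) one-step method is a map $\Phi:[0,\infty)\times[0,h_{\max}]\to GL(d,\mathbb{R})$. It is consistent of order $p>0$ if there is a constant $c_\Phi>0$ with $\|\Phi(t,h)-X(t+h,t)\|\le c_\Phi h^{p+1}$ for all $t\ge0$, $0\le h\le h_{\max}$. Given stepsizes, put $t_0=0$, $t_n=h_1+\dots+h_n$, $\Phi_n=\Phi(t_{n-1},h_n)$. Benettin's algorithm: start with $V_0=[v_1,\dots,v_d]$ (invertible for almost every tuple). For $n\ge1$ compute the QR-decomposition $\Phi_nV_{n-1}=Q_nR_n$ ($Q_n$ orthogonal, $R_n$ upper triangular with positive diagonal) and set $V_n=Q_n$. The output after $n$ steps is $\mu_i(n)=\frac1{t_n}\sum_{k=1}^n\log (R_k)_{ii}$, $i=1,\dots,d$. *)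

theory Defs
  imports "HOL-Analysis.Analysis" "HOL-Library.Function_Algebras"
begin

text \<open>
  Throughout, a finite well-ordered index type \<^typ>\<open>'n\<close> plays the role of \<open>{1,\<dots>,d}\<close>,
  \<open>d = CARD('n)\<close>; the order is needed for triangularity. Numbered quantities
  (exponents, singular values, outputs of the algorithm) are counted from 1, as in
  \<open>\<Lambda>\<^sub>1 \<ge> \<dots> \<ge> \<Lambda>\<^sub>d\<close>. Functions of time matter only on \<open>[0,\<infinity>)\<close>.
\<close>

section \<open>Linear systems on the half line\<close>

text \<open>
  Solutions live on \<open>[0,\<infinity>)\<close>. Extending them by 0 to negative times makes the solution set
  a genuine subspace of the space of functions, isomorphic to the space of solutions
  on \<open>[0,\<infinity>)\<close>.
\<close>

definition solutions :: "(real \<Rightarrow> real^'n^'n) \<Rightarrow> (real \<Rightarrow> real^'n) set" where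
  "solutions A = {x. (\<forall>t\<ge>0. (x has_vector_derivative (A t *v x t)) (at t within {0..}))
                    \<and> (\<forall>t<0. x t = 0)}"

definition fundamental_matrix :: "(real \<Rightarrow> real^'n^'n) \<Rightarrow> (real \<Rightarrow> real^'n^'n) \<Rightarrow> bool" where
  "fundamental_matrix A X \<longleftrightarrow>
     (\<forall>t\<ge>0. (X has_vector_derivative (A t ** X t)) (at t within {0..}) \<and> invertible (X t))"

definition cauchy_matrix :: "(real \<Rightarrow> real^'n^'n) \<Rightarrow> real \<Rightarrow> real \<Rightarrow> real^'n^'n" where
  "cauchy_matrix X t s = X t ** matrix_inv (X s)"

abbreviation op_norm :: "real^'n^'m \<Rightarrow> real" where
  "op_norm M \<equiv> onorm (\<lambda>x. M *v x)"

section \<open>Lyapunov exponents and regularity\<close>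

text \<open>The convention \<open>log 0 = -\<infinity>\<close> is made explicit, since \<^term>\<open>ln (0::real) = 0\<close>.\<close>

definition lyapunov_exponent :: "(real \<Rightarrow> real^'n) \<Rightarrow> ereal" where
  "lyapunov_exponent x =
     Limsup at_top (\<lambda>t. if x t = 0 then -\<infinity> else ereal (1 / t * ln (norm (x t))))"

definition fun_scale :: "real \<Rightarrow> (real \<Rightarrow> real^'n) \<Rightarrow> (real \<Rightarrow> real^'n)" where
  "fun_scale c x = (\<lambda>t. c *\<^sub>R x t)"

lemma vector_space_fun_scale: "vector_space fun_scale"
  by unfold_locales (auto simp: fun_scale_def fun_eq_iff algebra_simps)

lemma subspace_solutions: "module.subspace fun_scale (solutions A)"
proof -
  interpret vector_space fun_scale by (rule vector_space_fun_scale)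
  show ?thesis
    unfolding subspace_def
  proof (intro conjI ballI allI)
    show "0 \<in> solutions A"
      by (simp add: solutions_def zero_fun_def)
    show "x + y \<in> solutions A" if "x \<in> solutions A" "y \<in> solutions A" for x y
      using that
      by (auto simp: solutions_def plus_fun_def matrix_vector_right_distrib
               intro!: has_vector_derivative_add)
    show "fun_scale c x \<in> solutions A" if "x \<in> solutions A" for c x
      using that has_vector_derivative_scaleR[OF DERIV_const, of _ _ _ _ c]
      by (fastforce simp: solutions_def fun_scale_def matrix_vector_mult_scaleR)
  qed
qed

definition solution_dim :: "(real \<Rightarrow> real^'n) set \<Rightarrow> nat" where
  "solution_dim V = vector_space.dim fun_scale V"

text \<open>The distinct values \<open>\<lambda>\<^sub>1 > \<dots> > \<lambda>\<^sub>q\<close> on non-trivial solutions.\<close>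

definition lyapunov_values :: "(real \<Rightarrow> real^'n^'n) \<Rightarrow> ereal list" where
  "lyapunov_values A = rev (sorted_list_of_set (lyapunov_exponent ` (solutions A - {0})))"

definition lyapunov_space :: "(real \<Rightarrow> real^'n^'n) \<Rightarrow> nat \<Rightarrow> (real \<Rightarrow> real^'n) set" where
  "lyapunov_space A i =
     (if i \<le> length (lyapunov_values A)
      then {x \<in> solutions A. lyapunov_exponent x \<le> lyapunov_values A ! (i - 1)}
      else {0})"

definition lyapunov_mult :: "(real \<Rightarrow> real^'n^'n) \<Rightarrow> nat \<Rightarrow> nat" where
  "lyapunov_mult A i =
     solution_dim (lyapunov_space A i) - solution_dim (lyapunov_space A (Suc i))"

text \<open>\<open>Lyap A i\<close> is \<open>\<Lambda>\<^sub>i\<close>, i.e. the values repeated according to multiplicity.\<close>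

definition Lyap :: "(real \<Rightarrow> real^'n^'n) \<Rightarrow> nat \<Rightarrow> ereal" where
  "Lyap A i =
     concat (map (\<lambda>j. replicate (lyapunov_mult A j) (lyapunov_values A ! (j - 1)))
                 [1..<Suc (length (lyapunov_values A))]) ! (i - 1)"

definition regular_system ::
    "(real \<Rightarrow> real^'n^'n) \<Rightarrow> (real \<Rightarrow> real^'n^'n) \<Rightarrow> bool" where
  "regular_system A X \<longleftrightarrow>
     (\<Sum>i=1..CARD('n). Lyap A i) = Liminf at_top (\<lambda>t. ereal (1 / t * ln \<bar>det (X t)\<bar>))"

section \<open>Singular values and strong fast invertibility\<close>

definition eigenspace :: "real^'n^'n \<Rightarrow> real \<Rightarrow> (real^'n) set" where
  "eigenspace M a = {x. M *v x = a *\<^sub>R x}"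

text \<open>
  The square roots of the eigenvalues of \<open>M\<^sup>T M\<close> in non-increasing order, repeated according
  to multiplicity.
\<close>

definition singular_value :: "nat \<Rightarrow> real^'n^'n \<Rightarrow> real" where
  "singular_value k M =
     (let G = transpose M ** M in
      concat (map (\<lambda>a. replicate (dim (eigenspace G a)) (sqrt a))
                  (rev (sorted_list_of_set {a. eigenspace G a \<noteq> {0}}))) ! (k - 1))"

definition strongly_fast_invertible :: "nat \<Rightarrow> (real \<Rightarrow> real^'n^'n) \<Rightarrow> bool" where
  "strongly_fast_invertible L X \<longleftrightarrow>
     bdd_above {(\<Prod>k=1..L. singular_value k (cauchy_matrix X t s) *
                             singular_value k (cauchy_matrix X s \<tau>) /
                             singular_value k (cauchy_matrix X t \<tau>))
                | t s \<tau>. t \<ge> s \<and> s \<ge> \<tau> \<and> \<tau> \<ge> 0}"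

section \<open>One-step methods\<close>

definition one_step_map :: "real \<Rightarrow> (real \<Rightarrow> real \<Rightarrow> real^'n^'n) \<Rightarrow> bool" where
  "one_step_map hmax \<Phi> \<longleftrightarrow> (\<forall>t\<ge>0. \<forall>h\<in>{0..hmax}. invertible (\<Phi> t h))"

definition consistent_of_order ::
    "real \<Rightarrow> (real \<Rightarrow> real^'n^'n) \<Rightarrow> real \<Rightarrow> (real \<Rightarrow> real \<Rightarrow> real^'n^'n) \<Rightarrow> bool" where
  "consistent_of_order hmax X p \<Phi> \<longleftrightarrow>
     (\<exists>c>0. \<forall>t\<ge>0. \<forall>h\<in>{0..hmax}.
        op_norm (\<Phi> t h - cauchy_matrix X (t + h) t) \<le> c * h powr (p + 1))"

text \<open>Only \<open>h 1, h 2, \<dots>\<close> are stepsizes; the value \<open>h 0\<close> is never used.\<close>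

definition grid_time :: "(nat \<Rightarrow> real) \<Rightarrow> nat \<Rightarrow> real" where
  "grid_time h n = (\<Sum>k=1..n. h k)"

definition step_matrix ::
    "(real \<Rightarrow> real \<Rightarrow> real^'n^'n) \<Rightarrow> (nat \<Rightarrow> real) \<Rightarrow> nat \<Rightarrow> real^'n^'n" where
  "step_matrix \<Phi> h n = \<Phi> (grid_time h (n - 1)) (h n)"

section \<open>Benettin's algorithm\<close>

text \<open>A synonym that, unlike the notation for vector types, leaves the sort of the index open.\<close>

type_synonym 'n square = "((real, 'n) vec, 'n) vec"

definition is_qr ::
    "'n::{finite,wellorder} square \<Rightarrow> 'n square \<Rightarrow> 'n square \<Rightarrow> bool" where
  "is_qr M Q R \<longleftrightarrow> M = Q ** R \<and> orthogonal_matrix Q \<and>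
     (\<forall>i j. j < i \<longrightarrow> R $ i $ j = 0) \<and> (\<forall>i. R $ i $ i > 0)"

text \<open>For invertible \<open>M\<close> the decomposition exists and is unique; otherwise there is none.\<close>

definition qr :: "'n::{finite,wellorder} square \<Rightarrow> ('n square) \<times> ('n square)" where
  "qr M = (SOME (Q, R). is_qr M Q R)"

text \<open>
  A tuple \<open>(v\<^sub>1,\<dots>,v\<^sub>d)\<close> of vectors is an element \<open>v\<close> of \<^typ>\<open>real^'n^'n\<close> with components
  \<open>v $ j\<close>. These are the rows of \<open>v\<close>, so the matrix with columns \<open>v\<^sub>j\<close> is \<open>transpose v\<close>.
\<close>

primrec benettin_V ::
    "(real \<Rightarrow> real \<Rightarrow> 'n::{finite,wellorder} square) \<Rightarrow> (nat \<Rightarrow> real) \<Rightarrow> 'n square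
      \<Rightarrow> nat \<Rightarrow> 'n square" where
  "benettin_V \<Phi> h v 0 = transpose v"
| "benettin_V \<Phi> h v (Suc n) = fst (qr (step_matrix \<Phi> h (Suc n) ** benettin_V \<Phi> h v n))"

definition benettin_R ::
    "(real \<Rightarrow> real \<Rightarrow> 'n::{finite,wellorder} square) \<Rightarrow> (nat \<Rightarrow> real) \<Rightarrow> 'n square
      \<Rightarrow> nat \<Rightarrow> 'n square" where
  "benettin_R \<Phi> h v n = snd (qr (step_matrix \<Phi> h n ** benettin_V \<Phi> h v (n - 1)))"

text \<open>The \<open>i\<close>-th element of the index type, for \<open>i = 1,\<dots>,d\<close>.\<close>

definition nth_index :: "nat \<Rightarrow> 'n::{finite,wellorder}" where
  "nth_index i = sorted_list_of_set UNIV ! (i - 1)"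

definition benettin_output ::
    "(real \<Rightarrow> real \<Rightarrow> 'n::{finite,wellorder} square) \<Rightarrow> (nat \<Rightarrow> real) \<Rightarrow> 'n square
      \<Rightarrow> nat \<Rightarrow> nat \<Rightarrow> real" where
  "benettin_output \<Phi> h v i n =
     1 / grid_time h n *
       (\<Sum>k=1..n. ln (benettin_R \<Phi> h v k $ nth_index i $ nth_index i))"

end

theory Submission
  imports Defs
begin

text \<open>
  Let \<open>\<Lambda>\<close> denote the \<open>L\<close>-th exterior power and \<open>w = v\<^sub>1 \<and> \<dots> \<and> v\<^sub>L\<close>. Up to bounded factors,
  \<open>t\<^sub>n(\<mu>\<^sub>1(n) + \<dots> + \<mu>\<^sub>L(n))\<close> is the logarithm of \<open>\<parallel>\<Lambda>\<Phi>\<^sub>n \<dots> \<Lambda>\<Phi>\<^sub>1 w\<parallel>\<close>, and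
  \<open>\<sigma>\<^sub>1(M) \<dots> \<sigma>\<^sub>L(M)\<close> is the norm of \<open>\<Lambda>M\<close>. Strong fast invertibility therefore says
  \<open>\<parallel>\<Lambda>X(t,s)\<parallel> \<parallel>\<Lambda>X(s,\<tau>)\<parallel> \<le> C \<parallel>\<Lambda>X(t,\<tau>)\<parallel>\<close>. This has two consequences. First, inserting the local errors
  into the product changes \<open>\<Lambda>X(t\<^sub>n,0)\<close> by at most \<open>(exp(D \<Sum> h\<^sub>k\<^bsup>p+1\<^esup>) - 1) \<parallel>\<Lambda>X(t\<^sub>n,0)\<parallel>\<close>. Second, for
  almost every initial tuple \<open>\<parallel>\<Lambda>X(t,0) w\<parallel> \<ge> \<kappa> \<parallel>\<Lambda>X(t,0)\<parallel>\<close> with some \<open>\<kappa> > 0\<close>. Hence for small \<open>\<epsilon>\<close>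
  the numerical product applied to \<open>w\<close> has the size of \<open>\<parallel>\<Lambda>X(t\<^sub>n)\<parallel>\<close>, whose exponential growth
  rate is \<open>\<Lambda>\<^sub>1 + \<dots> + \<Lambda>\<^sub>L\<close> by regularity.
\<close>

section \<open>Exterior powers of matrices\<close>

text \<open>All estimates have to be relative to \<open>\<Lambda>X(t_n,0)\<close>, because an
  absolute error bound says nothing about an exponential rate. In the expansion by local errors, the
  k-th term contains ||\<Lambda>X(t_n,t_{k+1})|| ||\<Lambda>X(t_k,0)||. In general such a product of
  norms can exceed the norm of the product exponentially; strong fast invertibility caps the excess
  by a constant, at the cost of one exact step from t_{k+1} back to t_k.

  The threshold \<epsilon> depends on \<kappa> and ||w||, hence on the initial tuple, but not on the
  stepsizes. The exceptional w form a linear space, whereas tuples enter through the polynomial map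
  from tuples to w; so exceptional tuples are caught in the zero set of a nonzero homogeneous
  polynomial.

  Growth rates of single solutions bound volumes only from above. The lower bound comes from the
  full determinant: the volume in the remaining directions cannot be too large, so the first L must
  carry the rest.

  Since \<Lambda>(1) is a projection in this encoding, unit laws are replaced by the fact that the
  vectors and error matrices concerned lie in its range.\<close>

text \<open>
  As \<open>L\<close> is not a type, \<open>L\<close>-tuples of indices are encoded as maps \<open>'n \<Rightarrow> 'n\<close> of which only the
  restriction to an \<open>L\<close>-element set \<open>S\<close> matters: the factors outside \<open>S\<close> are acted on by the
  identity. \<open>ext_pow S M\<close> is the \<open>|S|\<close>-th tensor power of \<open>M\<close> composed with the projection onto the
  antisymmetric tensors; in particular \<open>ext_pow S (mat 1)\<close> is this projection, not the identity.
\<close>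

definition tens_pow :: "'n set \<Rightarrow> real^'n^'n \<Rightarrow> real^('n \<Rightarrow> 'n)^('n \<Rightarrow> 'n)" where
  "tens_pow S M = (\<chi> f g. \<Prod>i\<in>UNIV. (if i \<in> S then M else mat 1) $ f i $ g i)"

definition ext_pow :: "'n set \<Rightarrow> real^'n^'n \<Rightarrow> real^('n \<Rightarrow> 'n)^('n \<Rightarrow> 'n)" where
  "ext_pow S M = (\<chi> f g. (\<Sum>\<pi> | \<pi> permutes S. of_int (sign \<pi>) * tens_pow S M $ f $ (g \<circ> \<pi>)) / fact (card S))"

text \<open>Distributing the product over the inner sums gives one summand for each map
  \<open>h\<close>, and these maps are exactly the summation indices of the matrix product.\<close>

lemma tens_pow_mul: "tens_pow S (M ** N) = tens_pow S M ** tens_pow S (N :: real^'n^'n)"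
proof -
  have "tens_pow S (M ** N) $ f $ g = (tens_pow S M ** tens_pow S N) $ f $ g" for f g
  proof -
    have "tens_pow S (M ** N) $ f $ g =
        (\<Prod>i\<in>UNIV. \<Sum>k\<in>UNIV. (if i \<in> S then M else mat 1) $ f i $ k * (if i \<in> S then N else mat 1) $ k $ g i)"
      unfolding tens_pow_def vec_lambda_beta
    proof (rule prod.cong)
      fix i
      have "(if i \<in> S then M ** N else mat 1) = (if i \<in> S then M else mat 1) ** (if i \<in> S then N else mat 1)"
        by simp
      then show "(if i \<in> S then M ** N else mat 1) $ f i $ g i =
        (\<Sum>k\<in>UNIV. (if i \<in> S then M else mat 1) $ f i $ k * (if i \<in> S then N else mat 1) $ k $ g i)"
        by (simp only: matrix_matrix_mult_def vec_lambda_beta)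
    qed simp
    also have "\<dots> = (\<Sum>h\<in>UNIV. \<Prod>i\<in>UNIV. (if i \<in> S then M else mat 1) $ f i $ h i * (if i \<in> S then N else mat 1) $ h i $ g i)"
      by (subst prod_sum_PiE) (auto simp: PiE_UNIV_domain)
    also have "\<dots> = (tens_pow S M ** tens_pow S N) $ f $ g"
      by (simp add: matrix_matrix_mult_def tens_pow_def prod.distrib)
    finally show ?thesis .
  qed
  then show ?thesis by (simp add: vec_eq_iff)
qed

lemma tens_pow_comp_permutes:
  assumes "\<pi> permutes S"
  shows "tens_pow S M $ (f \<circ> \<pi>) $ (g \<circ> \<pi>) = tens_pow S M $ f $ g"
proof -
  have "bij \<pi>" using assms by (rule permutes_bij)
  moreover have "\<pi> i \<in> S \<longleftrightarrow> i \<in> S" for i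
    using assms by (simp add: permutes_in_image)
  ultimately show ?thesis
    unfolding tens_pow_def vec_lambda_beta comp_def
    using prod.reindex_bij_betw[of \<pi> UNIV UNIV "\<lambda>i. (if i \<in> S then M else mat 1) $ f i $ g i"]
    by simp
qed

text \<open>Antisymmetrisation is an idempotent that commutes with tensor powers. In coordinates,
  the product carries two permutation sums, and one of them is redundant.\<close>

lemma ext_pow_mul: "ext_pow S (M ** N) = ext_pow S M ** ext_pow S (N :: real^'n^'n)"
proof -
  let ?P = "{\<pi>. \<pi> permutes S}" and ?c = "fact (card S) :: real"
  let ?T = "\<lambda>M f g. tens_pow S M $ f $ g"
  have "ext_pow S (M ** N) $ f $ g = (ext_pow S M ** ext_pow S N) $ f $ g" for f g
  proof -
    \<comment> \<open>The substitutions of \<open>k \<circ> \<pi>\<close> for \<open>k\<close> and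
      of \<open>\<rho> \<circ> \<pi>\<close> for \<open>\<rho>\<close> absorb \<pi>. Thus all card S
      factorial choices of \<pi> contribute equally, which cancels one of the two
      factorials.\<close>
    have eq: "(\<Sum>k\<in>UNIV. \<Sum>\<rho>\<in>?P. of_int (sign \<pi>) * ?T M f (k \<circ> \<pi>) * (of_int (sign \<rho>) * ?T N k (g \<circ> \<rho>))) =
       (\<Sum>\<rho>\<in>?P. of_int (sign \<rho>) * ?T (M ** N) f (g \<circ> \<rho>))" if \<pi>: "\<pi> permutes S" for \<pi>
    proof -
      have perm: "permutation \<pi>"
        using permutes_imp_permutation[OF _ \<pi>] by simp
      have "(\<Sum>k\<in>UNIV. \<Sum>\<rho>\<in>?P. of_int (sign \<pi>) * ?T M f (k \<circ> \<pi>) * (of_int (sign \<rho>) * ?T N k (g \<circ> \<rho>)))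
        = (\<Sum>\<rho>\<in>?P. \<Sum>k\<in>UNIV. of_int (sign \<pi>) * ?T M f (k \<circ> \<pi>) * (of_int (sign \<rho>) * ?T N k (g \<circ> \<rho>)))"
        by (rule sum.swap)
      also have "\<dots> = (\<Sum>\<rho>\<in>?P. of_int (sign (\<rho> \<circ> \<pi>)) * ?T (M ** N) f (g \<circ> (\<rho> \<circ> \<pi>)))"
      proof (rule sum.cong)
        fix \<rho> assume "\<rho> \<in> ?P"
        then have \<rho>: "permutation \<rho>" using permutes_imp_permutation[of S \<rho>] by simp
        have "bij (\<lambda>k :: 'n \<Rightarrow> 'n. k \<circ> \<pi>)"
          by (rule o_bij[of "\<lambda>k. k \<circ> inv \<pi>"])
            (use permutes_inv_o[OF \<pi>] in \<open>auto simp: fun_eq_iff comp_assoc\<close>)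
        then have "(\<Sum>k\<in>UNIV. ?T M f (k \<circ> \<pi>) * ?T N (k \<circ> \<pi>) (g \<circ> \<rho> \<circ> \<pi>)) =
            (\<Sum>k\<in>UNIV. ?T M f k * ?T N k (g \<circ> \<rho> \<circ> \<pi>))"
          by (intro sum.reindex_bij_betw[of "\<lambda>k. k \<circ> \<pi>" UNIV UNIV "\<lambda>k. ?T M f k * ?T N k (g \<circ> \<rho> \<circ> \<pi>)"]) auto
        then have "(\<Sum>k\<in>UNIV. ?T M f (k \<circ> \<pi>) * ?T N k (g \<circ> \<rho>)) = ?T (M ** N) f (g \<circ> \<rho> \<circ> \<pi>)"
          by (simp add: tens_pow_comp_permutes[OF \<pi>])
            (subst tens_pow_mul, simp add: matrix_matrix_mult_def)
        then show "(\<Sum>k\<in>UNIV. of_int (sign \<pi>) * ?T M f (k \<circ> \<pi>) * (of_int (sign \<rho>) * ?T N k (g \<circ> \<rho>))) =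
            of_int (sign (\<rho> \<circ> \<pi>)) * ?T (M ** N) f (g \<circ> (\<rho> \<circ> \<pi>))"
          by (simp add: sign_compose[OF \<rho> perm] comp_assoc sum_distrib_left[symmetric] algebra_simps)
      qed simp
      also have "\<dots> = (\<Sum>\<rho>\<in>?P. of_int (sign \<rho>) * ?T (M ** N) f (g \<circ> \<rho>))"
        by (rule sum_permutations_compose_right[OF \<pi>, symmetric])
      finally show ?thesis .
    qed
    have "(ext_pow S M ** ext_pow S N) $ f $ g =
        (\<Sum>k\<in>UNIV. \<Sum>\<pi>\<in>?P. \<Sum>\<rho>\<in>?P. of_int (sign \<pi>) * ?T M f (k \<circ> \<pi>) * (of_int (sign \<rho>) * ?T N k (g \<circ> \<rho>))) / (?c * ?c)"
      by (simp add: matrix_matrix_mult_def ext_pow_def sum_product sum_divide_distrib)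
    also have "\<dots> = (\<Sum>\<pi>\<in>?P. \<Sum>k\<in>UNIV. \<Sum>\<rho>\<in>?P. of_int (sign \<pi>) * ?T M f (k \<circ> \<pi>) * (of_int (sign \<rho>) * ?T N k (g \<circ> \<rho>))) / (?c * ?c)"
      by (subst sum.swap) simp
    also have "\<dots> = (\<Sum>\<pi>\<in>?P. \<Sum>\<rho>\<in>?P. of_int (sign \<rho>) * ?T (M ** N) f (g \<circ> \<rho>)) / (?c * ?c)"
      using eq by simp
    also have "\<dots> = ext_pow S (M ** N) $ f $ g"
      by (simp add: ext_pow_def card_permutations)
    finally show ?thesis by simp
  qed
  then show ?thesis by (simp add: vec_eq_iff)
qed

text \<open>The entries are normalised minors. Padding with the identity turns a minor indexed by
  \<open>S\<close> into a determinant over the full index type, so that the determinant library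
  applies.\<close>

lemma ext_pow_eq_det:
  fixes M :: "real^'n^'n"
  shows "ext_pow S M $ f $ g = (if \<forall>i. i \<notin> S \<longrightarrow> f i = g i
     then det (\<chi> i j. if i \<in> S \<and> j \<in> S then M $ f i $ g j else mat 1 $ i $ j) / fact (card S) else 0)"
proof (cases "\<forall>i. i \<notin> S \<longrightarrow> f i = g i")
  case True
  let ?D = "(\<chi> i j. if i \<in> S \<and> j \<in> S then M $ f i $ g j else mat 1 $ i $ j) :: real^'n^'n"
  have "det ?D = (\<Sum>\<pi> | \<pi> permutes UNIV. of_int (sign \<pi>) * (\<Prod>i\<in>UNIV. ?D $ i $ \<pi> i))"
    by (simp add: det_def)
  \<comment> \<open>A permutation that moves an index outside \<open>S\<close> meets an off-diagonal
    zero of the padding.\<close>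
  also have "\<dots> = (\<Sum>\<pi> | \<pi> permutes S. of_int (sign \<pi>) * (\<Prod>i\<in>UNIV. ?D $ i $ \<pi> i))"
  proof (rule sum.mono_neutral_right)
    show "\<forall>\<pi>\<in>{\<pi>. \<pi> permutes UNIV} - {\<pi>. \<pi> permutes S}. of_int (sign \<pi>) * (\<Prod>i\<in>UNIV. ?D $ i $ \<pi> i) = 0"
    proof
      fix \<pi> :: "'n \<Rightarrow> 'n" assume "\<pi> \<in> {\<pi>. \<pi> permutes UNIV} - {\<pi>. \<pi> permutes S}"
      then obtain i where i: "i \<notin> S" "\<pi> i \<noteq> i"
        unfolding permutes_def by blast
      then have "?D $ i $ \<pi> i = 0"
        by (simp add: mat_def)
      then have "(\<Prod>i\<in>UNIV. ?D $ i $ \<pi> i) = 0"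
        by (meson finite iso_tuple_UNIV_I prod_zero)
      then show "of_int (sign \<pi>) * (\<Prod>i\<in>UNIV. ?D $ i $ \<pi> i) = 0" by simp
    qed
  qed (use permutes_subset in auto)
  also have "\<dots> = (\<Sum>\<pi> | \<pi> permutes S. of_int (sign \<pi>) * tens_pow S M $ f $ (g \<circ> \<pi>))"
  proof (rule sum.cong)
    fix \<pi> assume "\<pi> \<in> {\<pi>. \<pi> permutes S}"
    then have \<pi>: "\<pi> permutes S" by simp
    have "(\<Prod>i\<in>UNIV. ?D $ i $ \<pi> i) = tens_pow S M $ f $ (g \<circ> \<pi>)"
      unfolding tens_pow_def
      using \<pi> True by (auto simp: permutes_in_image permutes_not_in mat_def intro!: prod.cong)
    then show "of_int (sign \<pi>) * (\<Prod>i\<in>UNIV. ?D $ i $ \<pi> i) = of_int (sign \<pi>) * tens_pow S M $ f $ (g \<circ> \<pi>)"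
      by simp
  qed simp
  finally show ?thesis using True by (simp add: ext_pow_def)
next
  case False
  then obtain i where i: "i \<notin> S" "f i \<noteq> g i" by blast
  have "tens_pow S M $ f $ (g \<circ> \<pi>) = 0" if "\<pi> permutes S" for \<pi>
  proof -
    have "(if i \<in> S then M else mat 1) $ f i $ (g \<circ> \<pi>) i = 0"
      using i permutes_not_in[OF that] by (simp add: mat_def)
    then show ?thesis
      unfolding tens_pow_def vec_lambda_beta by (meson finite iso_tuple_UNIV_I prod_zero)
  qed
  then show ?thesis by (subst if_not_P[OF False]) (simp add: ext_pow_def)
qed

text \<open>\<open>wedge S V\<close> is the exterior product of the columns of \<open>V\<close> with index in \<open>S\<close>.\<close>

definition wedge :: "'n set \<Rightarrow> real^'n^'n \<Rightarrow> real^('n \<Rightarrow> 'n)" where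
  "wedge S V = ext_pow S V *v axis id 1"

lemma wedge_nth: "wedge S V $ f = ext_pow S V $ f $ id"
  by (simp add: wedge_def matrix_vector_mul_component inner_axis)

lemma ext_pow_wedge: "ext_pow S M *v wedge S V = wedge S (M ** V)"
  by (simp add: wedge_def matrix_vector_mul_assoc ext_pow_mul)

lemma wedge_mat_1_nonzero: "wedge S (mat 1 :: real^'n^'n) \<noteq> 0"
proof -
  have "wedge S (mat 1 :: real^'n^'n) $ id = det (mat 1 :: real^'n^'n) / fact (card S)"
  proof -
    have "(\<chi> i j. if i \<in> S \<and> j \<in> S then mat 1 $ id i $ id j else mat 1 $ i $ j) = (mat 1 :: real^'n^'n)"
      by (simp add: vec_eq_iff)
    then show ?thesis
      unfolding wedge_nth ext_pow_eq_det by simp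
  qed
  then show ?thesis by auto
qed

text \<open>Since \<open>S\<close> is an initial segment, the columns of \<open>Q ** R\<close> in
  \<open>S\<close> combine only columns of \<open>Q\<close> in \<open>S\<close>. The Cauchy-Binet
  sum therefore has a single term, a minor of \<open>Q\<close> times a triangular
  determinant.\<close>

lemma wedge_mult_upper_triangular:
  fixes Q R :: "'n::{finite,wellorder} square"
  assumes down: "\<And>i j. i \<in> S \<Longrightarrow> j < i \<Longrightarrow> j \<in> S"
    and R: "\<And>i j. j < i \<Longrightarrow> R $ i $ j = 0"
  shows "wedge S (Q ** R) = (\<Prod>i\<in>S. R $ i $ i) *\<^sub>R wedge S Q"
proof -
  have "wedge S (Q ** R) $ f = (\<Prod>i\<in>S. R $ i $ i) * wedge S Q $ f" for f
  proof -
    \<comment> \<open>The padded minors; the row selection \<open>id\<close> yields the diagonal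
      block of \<open>R\<close> on \<open>S\<close>.\<close>
    define B where "B M g = (\<chi> i j. if i \<in> S \<and> j \<in> S then M $ g i $ j else mat 1 $ i $ j)"
      for M :: "'n square" and g :: "'n \<Rightarrow> 'n"
    have "B (Q ** R) f $ i $ j = (B Q f ** B R id) $ i $ j" for i j
    proof (cases "i \<in> S \<and> j \<in> S")
      case True
      have "(B Q f ** B R id) $ i $ j = (\<Sum>k\<in>S. Q $ f i $ k * R $ k $ j)"
        unfolding matrix_matrix_mult_def vec_lambda_beta
        by (rule sum.mono_neutral_cong_right) (use True in \<open>auto simp: B_def mat_def\<close>)
      also have "\<dots> = (Q ** R) $ f i $ j"
        unfolding matrix_matrix_mult_def vec_lambda_beta
      proof (rule sum.mono_neutral_left, safe)
        \<comment> \<open>An index outside the initial segment lies above all of it, so the entry of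
          \<open>R\<close> is below the diagonal.\<close>
        fix k assume "k \<notin> S"
        then have "j < k" using down[of j k] True by (metis linorder_less_linear)
        then show "Q $ f i $ k * R $ k $ j = 0" by (simp add: R)
      qed auto
      finally show ?thesis using True by (simp add: B_def)
    next
      case False
      have "(B Q f ** B R id) $ i $ j = mat 1 $ i $ j"
      proof (cases "i \<in> S")
        case True
        then have "B R id $ k $ j = (if k = j then 1 else 0)" for k
          using False by (simp add: B_def mat_def)
        then have "(B Q f ** B R id) $ i $ j = (\<Sum>k\<in>UNIV. if k = j then B Q f $ i $ k else 0)"
          by (simp add: matrix_matrix_mult_def if_distrib[of "\<lambda>x. _ * x"] cong: if_cong)
        then have "(B Q f ** B R id) $ i $ j = B Q f $ i $ j"
          by simp
        then show ?thesis using False True by (simp add: B_def)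
      next
        case False
        then have "B Q f $ i $ k = (if i = k then 1 else 0)" for k
          by (simp add: B_def mat_def)
        then have "(B Q f ** B R id) $ i $ j = (\<Sum>k\<in>UNIV. if i = k then B R id $ k $ j else 0)"
          by (simp add: matrix_matrix_mult_def if_distrib[of "\<lambda>x. x * _"] cong: if_cong)
        then show ?thesis using False by (simp add: B_def)
      qed
      moreover have "B (Q ** R) f $ i $ j = mat 1 $ i $ j"
        using False by (auto simp: B_def)
      ultimately show ?thesis by simp
    qed
    then have "B (Q ** R) f = B Q f ** B R id"
      by (simp add: vec_eq_iff)
    moreover have "det (B R id) = (\<Prod>i\<in>S. R $ i $ i)"
    proof -
      have "det (B R id) = (\<Prod>i\<in>UNIV. B R id $ i $ i)"
        by (rule det_upperdiagonal) (auto simp: B_def mat_def R)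
      also have "\<dots> = (\<Prod>i\<in>S. R $ i $ i)"
        by (rule prod.mono_neutral_cong_right) (auto simp: B_def mat_def)
      finally show ?thesis .
    qed
    ultimately have "det (B (Q ** R) f) = (\<Prod>i\<in>S. R $ i $ i) * det (B Q f)"
      by (simp add: det_mul)
    moreover have "wedge S M $ f = (if \<forall>i. i \<notin> S \<longrightarrow> f i = i then det (B M f) / fact (card S) else 0)" for M
      unfolding wedge_nth ext_pow_eq_det B_def id_apply ..
    ultimately show ?thesis by auto
  qed
  then show ?thesis by (simp add: vec_eq_iff)
qed

section \<open>Norm bounds by products of column lengths\<close>

lemma tens_pow_permute_bound:
  assumes \<pi>: "\<pi> permutes S"
  shows "\<bar>tens_pow S M $ f $ (g \<circ> \<pi>)\<bar> \<le> (\<Prod>i\<in>S. norm (column (g i) M))"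
proof -
  have "\<bar>tens_pow S M $ f $ (g \<circ> \<pi>)\<bar> = (\<Prod>i\<in>UNIV. \<bar>(if i \<in> S then M else mat 1) $ f i $ g (\<pi> i)\<bar>)"
    by (simp add: tens_pow_def abs_prod)
  also have "\<dots> \<le> (\<Prod>i\<in>UNIV. if i \<in> S then norm (column (g (\<pi> i)) M) else 1)"
  proof (rule prod_mono)
    fix i
    have "\<bar>M $ f i $ g (\<pi> i)\<bar> \<le> norm (column (g (\<pi> i)) M)"
      using component_le_norm_cart[of "column (g (\<pi> i)) M" "f i"] by (simp add: column_def)
    then show "0 \<le> \<bar>(if i \<in> S then M else mat 1) $ f i $ g (\<pi> i)\<bar> \<and>
        \<bar>(if i \<in> S then M else mat 1) $ f i $ g (\<pi> i)\<bar> \<le> (if i \<in> S then norm (column (g (\<pi> i)) M) else 1)"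
      by (auto simp: mat_def)
  qed
  also have "\<dots> = (\<Prod>i\<in>S. norm (column (g (\<pi> i)) M))"
    by (rule prod.mono_neutral_cong_right) auto
  also have "\<dots> = (\<Prod>i\<in>S. norm (column (g i) M))"
    using prod.permute[OF \<pi>, of "\<lambda>i. norm (column (g i) M)"] by (simp add: comp_def)
  finally show ?thesis .
qed

text \<open>A Hadamard inequality without orthogonalisation: permuting the factors does not change
  the product of column lengths, and the normalisation cancels the number of permutations.\<close>

lemma ext_pow_entry_bound: "\<bar>ext_pow S M $ f $ g\<bar> \<le> (\<Prod>i\<in>S. norm (column (g i) M))"
proof -
  have "\<bar>ext_pow S M $ f $ g\<bar> \<le> (\<Sum>\<pi> | \<pi> permutes S. \<bar>of_int (sign \<pi>) * tens_pow S M $ f $ (g \<circ> \<pi>)\<bar>) / fact (card S)"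
    by (simp add: ext_pow_def abs_divide divide_right_mono)
  also have "\<dots> \<le> (\<Sum>\<pi> | \<pi> permutes S. (\<Prod>i\<in>S. norm (column (g i) M))) / fact (card S)"
    by (intro divide_right_mono sum_mono) (auto simp: abs_mult sign_def tens_pow_permute_bound)
  also have "\<dots> = (\<Prod>i\<in>S. norm (column (g i) M))"
    by (simp add: card_permutations)
  finally show ?thesis .
qed

lemma ext_pow_entry_zero:
  assumes "\<not> inj_on g S"
  shows "ext_pow S M $ f $ g = 0"
proof -
  obtain i j where ij: "i \<in> S" "j \<in> S" "g i = g j" "i \<noteq> j"
    using assms by (auto simp: inj_on_def)
  have "det (\<chi> k l. if k \<in> S \<and> l \<in> S then M $ f k $ g l else mat 1 $ k $ l) = 0"
    by (rule det_identical_columns[OF ij(4)]) (use ij in \<open>auto simp: column_def vec_eq_iff mat_def\<close>)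
  then show ?thesis by (simp add: ext_pow_eq_det)
qed

text \<open>Restricting the bound to injective selections is essential: products over distinct
  columns can later be compared with the product of the largest ones.\<close>

lemma onorm_ext_pow_le:
  fixes M :: "real^'n^'n"
  assumes "\<And>g. inj_on g S \<Longrightarrow> (\<Prod>i\<in>S. norm (column (g i) M)) \<le> B" and "0 \<le> B"
  shows "op_norm (ext_pow S M) \<le> real CARD('n \<Rightarrow> 'n) * real CARD('n \<Rightarrow> 'n) * B"
proof (rule onorm_le_matrix_component)
  fix f g
  show "\<bar>ext_pow S M $ f $ g\<bar> \<le> B"
    using assms ext_pow_entry_bound[of S M f g] ext_pow_entry_zero[of g S M f]
    by (cases "inj_on g S") force+
qed

section \<open>Perturbed products and zero sets of polynomials\<close>

lemma op_norm_nonneg [simp]: "0 \<le> op_norm (M :: real^'n^'m)"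
  by (rule onorm_pos_le[OF matrix_vector_mul_bounded_linear])

lemma norm_matrix_vector_le: "norm (M *v x) \<le> op_norm M * norm (x :: real^'n)" for M :: "real^'n^'m"
  by (rule onorm[OF matrix_vector_mul_bounded_linear])

lemma op_norm_mul_le: "op_norm (M ** N) \<le> op_norm M * op_norm (N :: real^'n^'k)" for M :: "real^'k^'m"
  using onorm_compose[OF matrix_vector_mul_bounded_linear[of M] matrix_vector_mul_bounded_linear[of N]]
  by (simp add: comp_def matrix_vector_mul_assoc)

lemma op_norm_triangle: "op_norm (M + N) \<le> op_norm M + op_norm (N :: real^'n^'m)"
  using onorm_triangle[OF matrix_vector_mul_bounded_linear[of M] matrix_vector_mul_bounded_linear[of N]]
  by (simp add: matrix_vector_mult_add_rdistrib)

lemma norm_column_le_op_norm: "norm (column j M) \<le> op_norm (M :: real^'n^'m)"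
  by (metis column_def norm_column_le_onorm)

text \<open>Duhamel formula combined with a discrete Gronwall argument.\<close>

lemma perturbed_cocycle_bound:
  fixes Z :: "nat \<Rightarrow> nat \<Rightarrow> real^'m^'m" and E :: "nat \<Rightarrow> real^'m^'m" and u :: "nat \<Rightarrow> real^'m"
  assumes cocycle: "\<And>n m. m \<le> n \<Longrightarrow> Z (Suc n) m = Z (Suc n) n ** Z n m"
    and E_diag: "\<And>n. Z (Suc n) (Suc n) ** E n = E n"
    and u_Suc: "\<And>n. u (Suc n) = (Z (Suc n) n + E n) *v u n"
    and u_0: "u 0 = Z 0 0 *v u 0"
    and fast: "\<And>n k. k < n \<Longrightarrow> op_norm (Z n (Suc k)) * op_norm (E k) * op_norm (Z k 0) \<le> a k * op_norm (Z n 0)"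
    and a_nonneg: "\<And>k. 0 \<le> a k"
  shows "norm (u n - Z n 0 *v u 0) \<le> op_norm (Z n 0) * norm (u 0) * ((\<Prod>k<n. 1 + a k) - 1)"
proof (induction n rule: less_induct)
  case (less n)
  let ?z = "\<lambda>n. op_norm (Z n 0)"
  \<comment> \<open>In the induction step the new error term has to be written with the factor
    \<open>Z (Suc n) (Suc n)\<close>, which need not be the identity; \<open>E_diag\<close> inserts
    it.\<close>
  have duhamel: "u n = Z n 0 *v u 0 + (\<Sum>k<n. Z n (Suc k) *v (E k *v u k))" for n
  proof (induction n)
    case 0
    then show ?case using u_0 by simp
  next
    case (Suc n)
    have "u (Suc n) = Z (Suc n) n *v (Z n 0 *v u 0 + (\<Sum>k<n. Z n (Suc k) *v (E k *v u k))) + E n *v u n"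
      by (subst u_Suc) (simp add: matrix_vector_mult_add_rdistrib Suc[symmetric])
    also have "\<dots> = Z (Suc n) 0 *v u 0 + (\<Sum>k<n. Z (Suc n) (Suc k) *v (E k *v u k)) + Z (Suc n) (Suc n) *v (E n *v u n)"
      by (simp add: matrix_vector_right_distrib linear_sum[OF matrix_vector_mul_linear] cocycle[of 0 n]
          cocycle[of "Suc _" n] matrix_vector_mul_assoc matrix_mul_assoc E_diag)
    finally show ?case by simp
  qed
  have prod_ge: "1 \<le> (\<Prod>j<k. 1 + a j)" for k
    by (rule prod_ge_1) (simp add: a_nonneg)
  \<comment> \<open>The induction hypothesis controls the distance from the exact trajectory; adding
    the size of that trajectory removes the subtracted 1.\<close>
  have u_bound: "norm (u k) \<le> ?z k * norm (u 0) * (\<Prod>j<k. 1 + a j)" if "k < n" for k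
  proof -
    have "norm (u k) \<le> norm (u k - Z k 0 *v u 0) + norm (Z k 0 *v u 0)"
      by (metis diff_add_cancel norm_triangle_ineq)
    also have "\<dots> \<le> ?z k * norm (u 0) * ((\<Prod>j<k. 1 + a j) - 1) + ?z k * norm (u 0)"
      by (intro add_mono less that norm_matrix_vector_le)
    finally show ?thesis by (simp add: algebra_simps)
  qed
  have "norm (u n - Z n 0 *v u 0) \<le> (\<Sum>k<n. norm (Z n (Suc k) *v (E k *v u k)))"
    using duhamel[of n] norm_sum[of "\<lambda>k. Z n (Suc k) *v (E k *v u k)" "{..<n}"] by simp
  also have "\<dots> \<le> (\<Sum>k<n. a k * ?z n * (norm (u 0) * (\<Prod>j<k. 1 + a j)))"
  proof (rule sum_mono)
    fix k assume "k \<in> {..<n}"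
    then have k: "k < n" by simp
    have "norm (Z n (Suc k) *v (E k *v u k)) \<le> op_norm (Z n (Suc k)) * (op_norm (E k) * norm (u k))"
      by (meson norm_matrix_vector_le mult_left_mono op_norm_nonneg order_trans)
    also have "\<dots> \<le> op_norm (Z n (Suc k)) * (op_norm (E k) * (?z k * norm (u 0) * (\<Prod>j<k. 1 + a j)))"
      by (intro mult_left_mono u_bound k) simp_all
    also have "\<dots> = op_norm (Z n (Suc k)) * op_norm (E k) * ?z k * (norm (u 0) * (\<Prod>j<k. 1 + a j))"
      by (simp add: algebra_simps)
    also have "\<dots> \<le> a k * ?z n * (norm (u 0) * (\<Prod>j<k. 1 + a j))"
      using prod_ge[of k] by (intro mult_right_mono fast k) auto
    finally show "norm (Z n (Suc k) *v (E k *v u k)) \<le> \<dots>" .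
  qed
  also have "\<dots> = ?z n * norm (u 0) * (\<Sum>k<n. a k * (\<Prod>j<k. 1 + a j))"
    by (simp add: sum_distrib_left algebra_simps)
  \<comment> \<open>Each summand is a difference of consecutive partial products, so the sum
    telescopes.\<close>
  also have "(\<Sum>k<n. a k * (\<Prod>j<k. 1 + a j)) = (\<Prod>k<n. 1 + a k) - 1"
    by (induction n) (simp_all add: algebra_simps)
  finally show ?case .
qed

text \<open>Dividing all factors by \<open>K\<close> reduces to the case of factors in the unit
  ball, where differences of products are subadditive. Differences only shrink under this scaling
  because \<open>K\<close> is at least 1.\<close>

lemma prod_diff_le:
  fixes a b :: "'i \<Rightarrow> real"
  assumes "1 \<le> K" "\<And>i. i \<in> I \<Longrightarrow> \<bar>a i\<bar> \<le> K" "\<And>i. i \<in> I \<Longrightarrow> \<bar>b i\<bar> \<le> K"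
  shows "\<bar>prod a I - prod b I\<bar> \<le> K ^ card I * (\<Sum>i\<in>I. \<bar>a i - b i\<bar>)"
proof -
  have K: "K > 0" using assms by simp
  have "\<bar>prod (\<lambda>i. a i / K) I - prod (\<lambda>i. b i / K) I\<bar> \<le> (\<Sum>i\<in>I. \<bar>a i / K - b i / K\<bar>)"
    using norm_prod_diff[of I "\<lambda>i. a i / K" "\<lambda>i. b i / K"] assms K by (simp add: abs_div)
  also have "\<dots> \<le> (\<Sum>i\<in>I. \<bar>a i - b i\<bar>)"
  proof (rule sum_mono)
    fix i
    have "\<bar>a i / K - b i / K\<bar> = \<bar>a i - b i\<bar> / K"
      using K by (simp add: diff_divide_distrib[symmetric] abs_div)
    also have "\<dots> \<le> \<bar>a i - b i\<bar>"
      using assms(1) K mult_right_mono[of 1 K "\<bar>a i - b i\<bar>"] by (simp add: field_simps)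
    finally show "\<bar>a i / K - b i / K\<bar> \<le> \<bar>a i - b i\<bar>" .
  qed
  finally have "\<bar>prod a I - prod b I\<bar> / K ^ card I \<le> (\<Sum>i\<in>I. \<bar>a i - b i\<bar>)"
    using K by (simp add: prod_dividef diff_divide_distrib[symmetric] abs_div)
  then show ?thesis using K by (simp add: field_simps)
qed

section \<open>Zero sets of homogeneous polynomials\<close>

text \<open>
  Every line parallel to \<open>v0\<close> meets the zero set in finitely many points (the polynomial
  \<open>s \<mapsto> P (s v + v0)\<close> does not vanish at 0), so Fubini and translation invariance apply.
\<close>

lemma null_sets_homogeneous_polynomial_zeros:
  fixes P :: "'a::euclidean_space \<Rightarrow> real"
  assumes poly: "real_polynomial_function P" and nz: "P v0 \<noteq> 0"
    and hom: "\<And>c v. P (c *\<^sub>R v) = c ^ m * P v"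
  shows "{v. P v = 0} \<in> null_sets lborel"
proof -
  define N where "N = {v. P v = 0}"
  have "closed N"
    unfolding N_def using continuous_on_polymonial_function[of P] poly
    by (intro closed_Collect_eq) (auto simp: real_polynomial_function_eq)
  then have N: "N \<in> sets borel" by simp
  have fin: "finite {t. v + t *\<^sub>R v0 \<in> N}" for v
  proof -
    have "polynomial_function (\<lambda>s. s *\<^sub>R v + v0)"
      by (rule polynomial_function_add[OF polynomial_function_bounded_linear[OF bounded_linear_scaleR_left]
            polynomial_function_const])
    then have "real_polynomial_function (P \<circ> (\<lambda>s. s *\<^sub>R v + v0))"
      by (rule real_polynomial_function_compose[OF _ poly])
    then obtain a and n :: nat where a: "\<And>s. P (s *\<^sub>R v + v0) = (\<Sum>i\<le>n. a i * s ^ i)"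
      unfolding real_polynomial_function_iff_sum by (auto simp: fun_eq_iff)
    have "\<exists>i\<le>n. a i \<noteq> 0"
    proof (rule ccontr)
      assume "\<not> ?thesis"
      then have "P (0 *\<^sub>R v + v0) = 0" unfolding a by simp
      then show False using nz by simp
    qed
    then have "finite {s. P (s *\<^sub>R v + v0) = 0}"
      unfolding a by (simp add: polyfun_finite_roots)
    \<comment> \<open>For t different from 0, homogeneity lets t be factored out, which turns a hit
      at t into a root at 1/t; the value t = 0 is added by hand.\<close>
    moreover have "{t. v + t *\<^sub>R v0 \<in> N} \<subseteq> insert 0 (inverse ` {s. P (s *\<^sub>R v + v0) = 0})"
    proof
      fix t assume "t \<in> {t. v + t *\<^sub>R v0 \<in> N}"
      then have t: "P (v + t *\<^sub>R v0) = 0" by (simp add: N_def)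
      show "t \<in> insert 0 (inverse ` {s. P (s *\<^sub>R v + v0) = 0})"
      proof (cases "t = 0")
        case False
        then have "v + t *\<^sub>R v0 = t *\<^sub>R (inverse t *\<^sub>R v + v0)"
          by (simp add: scaleR_right_distrib)
        then have "P (inverse t *\<^sub>R v + v0) = 0"
          using t False by (simp add: hom)
        then have "inverse t \<in> {s. P (s *\<^sub>R v + v0) = 0}" by simp
        then have "inverse (inverse t) \<in> inverse ` {s. P (s *\<^sub>R v + v0) = 0}" by (rule imageI)
        then show ?thesis by simp
      qed simp
    qed
    ultimately show ?thesis by (meson finite.insertI finite_imageI finite_subset)
  qed
  \<comment> \<open>Cutting off at the unit interval makes one of the two iterated integrals equal
    to the measure of \<open>N\<close> itself.\<close>
  let ?f = "\<lambda>v t. indicator N (v + t *\<^sub>R v0) * indicator {0..1} t :: ennreal"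
  have meas: "case_prod ?f \<in> borel_measurable (lborel \<Otimes>\<^sub>M lborel)"
    using N by measurable
  have "(\<integral>\<^sup>+t. \<integral>\<^sup>+v. ?f v t \<partial>lborel \<partial>lborel) = (\<integral>\<^sup>+v. \<integral>\<^sup>+t. ?f v t \<partial>lborel \<partial>lborel)"
    using lborel_pair.Fubini'[OF meas] .
  also have "(\<lambda>v. \<integral>\<^sup>+t. ?f v t \<partial>lborel) = (\<lambda>v. 0)"
  proof
    fix v
    have "AE t in lborel. t \<notin> {t. v + t *\<^sub>R v0 \<in> N}"
      by (intro AE_not_in finite_imp_null_set_lborel fin)
    then have "AE t in lborel. ?f v t = 0"
      by eventually_elim (simp add: indicator_def)
    then show "(\<integral>\<^sup>+t. ?f v t \<partial>lborel) = 0"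
      by (simp add: nn_integral_cong_AE[of _ "\<lambda>_. 0"])
  qed
  finally have 0: "(\<integral>\<^sup>+t. \<integral>\<^sup>+v. ?f v t \<partial>lborel \<partial>lborel) = 0" by simp
  have "(\<integral>\<^sup>+v. ?f v t \<partial>lborel) = emeasure lborel N * indicator {0..1} t" for t
  proof -
    have "(\<integral>\<^sup>+v. indicator N (v + t *\<^sub>R v0) \<partial>lborel) = (\<integral>\<^sup>+v. indicator N (t *\<^sub>R v0 + v) \<partial>lborel)"
      by (simp add: add.commute)
    also have "\<dots> = (\<integral>\<^sup>+v. indicator N v \<partial>(distr lborel borel ((+) (t *\<^sub>R v0))))"
      using N by (subst nn_integral_distr) auto
    also have "\<dots> = emeasure lborel N"
      using N by (simp add: lborel_distr_plus)
    finally show ?thesis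
      using N by (simp add: nn_integral_multc)
  qed
  then have "(\<integral>\<^sup>+t. \<integral>\<^sup>+v. ?f v t \<partial>lborel \<partial>lborel) = emeasure lborel N"
    by (simp add: nn_integral_cmult_indicator)
  with 0 show ?thesis using N by (auto simp: N_def null_sets_def)
qed

section \<open>Exterior powers on bounded sets and on orthogonal matrices\<close>

lemma abs_entry_le_op_norm: "\<bar>M $ i $ j\<bar> \<le> op_norm (M :: real^'n^'m)"
  by (rule matrix_component_le_onorm)

text \<open>The entries are polynomials in the matrix entries, hence Lipschitz on bounded sets. This
  carries the consistency error of a step over to its exterior power.\<close>

lemma ext_pow_lipschitz:
  fixes S :: "'n::finite set"
  shows "\<exists>c>0. \<forall>M N :: real^'n^'n. op_norm M \<le> K \<longrightarrow> op_norm N \<le> K \<longrightarrow>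
           op_norm (ext_pow S M - ext_pow S N) \<le> c * op_norm (M - N)"
proof -
  \<comment> \<open>The factors with index outside \<open>S\<close> are entries of the identity, so
    the common bound must also dominate 1.\<close>
  define K' where "K' = max K 1"
  define B where "B = K' ^ CARD('n) * real CARD('n)"
  have B: "B > 0" by (simp add: B_def K'_def)
  have T: "\<bar>tens_pow S M $ f $ g - tens_pow S N $ f $ g\<bar> \<le> B * op_norm (M - N)"
    if MN: "op_norm M \<le> K" "op_norm N \<le> K" for M N :: "real^'n^'n" and f g
  proof -
    have "\<bar>tens_pow S M $ f $ g - tens_pow S N $ f $ g\<bar> \<le>
        K' ^ CARD('n) * (\<Sum>i\<in>UNIV. \<bar>(if i \<in> S then M else mat 1) $ f i $ g i - (if i \<in> S then N else mat 1) $ f i $ g i\<bar>)"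
      unfolding tens_pow_def vec_lambda_beta
    proof (rule prod_diff_le)
      have "\<bar>(if i \<in> S then M else mat 1) $ f i $ g i\<bar> \<le> K'" if "op_norm M \<le> K" for i and M :: "real^'n^'n"
        using abs_entry_le_op_norm[of M "f i" "g i"] that by (auto simp: K'_def mat_def)
      then show "\<bar>(if i \<in> S then M else mat 1) $ f i $ g i\<bar> \<le> K'" "\<bar>(if i \<in> S then N else mat 1) $ f i $ g i\<bar> \<le> K'" for i
        using MN by blast+
    qed (simp add: K'_def)
    also have "\<dots> \<le> K' ^ CARD('n) * (\<Sum>i\<in>(UNIV :: 'n set). op_norm (M - N))"
    proof (intro mult_left_mono sum_mono)
      fix i
      show "\<bar>(if i \<in> S then M else mat 1) $ f i $ g i - (if i \<in> S then N else mat 1) $ f i $ g i\<bar> \<le> op_norm (M - N)"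
        using abs_entry_le_op_norm[of "M - N" "f i" "g i"] by auto
    qed (simp add: K'_def)
    finally show ?thesis by (simp add: B_def)
  qed
  have "\<bar>(ext_pow S M - ext_pow S N) $ f $ g\<bar> \<le> B * op_norm (M - N)"
    if MN: "op_norm M \<le> K" "op_norm N \<le> K" for M N :: "real^'n^'n" and f g
  proof -
    have "(ext_pow S M - ext_pow S N) $ f $ g =
        (\<Sum>\<pi> | \<pi> permutes S. of_int (sign \<pi>) * (tens_pow S M $ f $ (g \<circ> \<pi>) - tens_pow S N $ f $ (g \<circ> \<pi>))) / fact (card S)"
      by (simp add: ext_pow_def right_diff_distrib sum_subtractf diff_divide_distrib)
    then have "\<bar>(ext_pow S M - ext_pow S N) $ f $ g\<bar> \<le>
        (\<Sum>\<pi> | \<pi> permutes S. \<bar>of_int (sign \<pi>) * (tens_pow S M $ f $ (g \<circ> \<pi>) - tens_pow S N $ f $ (g \<circ> \<pi>))\<bar>) / fact (card S)"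
      by (simp add: abs_divide divide_right_mono)
    also have "\<dots> \<le> (\<Sum>\<pi> | \<pi> permutes S. B * op_norm (M - N)) / fact (card S)"
      by (intro divide_right_mono sum_mono) (auto simp: abs_mult sign_def T MN)
    also have "\<dots> = B * op_norm (M - N)"
      by (simp add: card_permutations)
    finally show ?thesis .
  qed
  then have "op_norm (ext_pow S M - ext_pow S N) \<le> real CARD('n \<Rightarrow> 'n) * real CARD('n \<Rightarrow> 'n) * (B * op_norm (M - N))"
    if "op_norm M \<le> K" "op_norm N \<le> K" for M N :: "real^'n^'n"
    using that by (intro onorm_le_matrix_component) blast
  then show ?thesis
    using B by (intro exI[of _ "real CARD('n \<Rightarrow> 'n) * real CARD('n \<Rightarrow> 'n) * B"]) (auto simp: mult.assoc)
qed

lemma op_norm_ext_pow_bound: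
  fixes M :: "real^'n^'n"
  assumes "op_norm M \<le> K"
  shows "op_norm (ext_pow S M) \<le> real CARD('n \<Rightarrow> 'n) * real CARD('n \<Rightarrow> 'n) * K ^ card S"
proof (rule onorm_ext_pow_le)
  have K: "0 \<le> K" using op_norm_nonneg[of M] assms by linarith
  fix g
  have "(\<Prod>i\<in>S. norm (column (g i) M)) \<le> (\<Prod>i\<in>S. K)"
    using norm_column_le_op_norm[of _ M] assms order_trans by (intro prod_mono conjI) (blast intro: norm_ge_zero)+
  then show "(\<Prod>i\<in>S. norm (column (g i) M)) \<le> K ^ card S" by simp
  show "0 \<le> K ^ card S" using K by simp
qed

lemma op_norm_orthogonal: "orthogonal_matrix Q \<Longrightarrow> op_norm (Q :: real^'n^'n) \<le> 1"
  by (intro onorm_le) (simp add: orthogonal_transformation_matrix orthogonal_transformation_norm)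

text \<open>Exact invariance of the norm is avoided: the same crude bound for \<open>Q\<close> and
  for its inverse, the transpose, gives both inequalities, and bounded factors do not affect growth
  rates.\<close>

lemma norm_wedge_orthogonal:
  fixes S :: "'n::finite set"
  shows "\<exists>a b. 0 < a \<and> 0 < b \<and> (\<forall>Q :: real^'n^'n. orthogonal_matrix Q \<longrightarrow> a \<le> norm (wedge S Q) \<and> norm (wedge S Q) \<le> b)"
proof -
  define w where "w = norm (wedge S (mat 1 :: real^'n^'n))"
  define c where "c = real CARD('n \<Rightarrow> 'n) * real CARD('n \<Rightarrow> 'n)"
  have c: "c > 0" by (simp add: c_def)
  have w: "w > 0" using wedge_mat_1_nonzero[of S] by (simp add: w_def)
  have bound: "op_norm (ext_pow S Q) \<le> c" if "orthogonal_matrix Q" for Q :: "real^'n^'n"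
    using op_norm_ext_pow_bound[OF op_norm_orthogonal[OF that], of S] by (simp add: c_def)
  show ?thesis
  proof (rule exI[of _ "w / c"], rule exI[of _ "c * w"], intro conjI allI impI)
    fix Q :: "real^'n^'n" assume Q: "orthogonal_matrix Q"
    have "ext_pow S Q *v wedge S (mat 1) = wedge S Q" by (simp add: ext_pow_wedge)
    then have "norm (wedge S Q) \<le> op_norm (ext_pow S Q) * w"
      unfolding w_def by (metis norm_matrix_vector_le)
    also have "\<dots> \<le> c * w" using bound[OF Q] w by (intro mult_right_mono) auto
    finally show "norm (wedge S Q) \<le> c * w" .
    have "ext_pow S (transpose Q) *v wedge S Q = wedge S (mat 1)"
      using Q by (simp add: ext_pow_wedge orthogonal_matrix)
    then have "w \<le> op_norm (ext_pow S (transpose Q)) * norm (wedge S Q)"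
      unfolding w_def by (metis norm_matrix_vector_le)
    also have "\<dots> \<le> c * norm (wedge S Q)"
      using bound[of "transpose Q"] Q by (intro mult_right_mono) (auto simp: orthogonal_matrix_transpose)
    finally show "w / c \<le> norm (wedge S Q)" using c by (simp add: field_simps)
  qed (use w c in auto)
qed

section \<open>QR-decomposition\<close>

text \<open>Gram-Schmidt: \<open>z j\<close> is the part of column j orthogonal to the preceding
  columns, and \<open>q j\<close> is its normalisation. Triangularity of \<open>R\<close> is
  orthogonality to the preceding columns, and its diagonal entries are the lengths of the
  \<open>z j\<close>.\<close>

lemma is_qr_exists:
  fixes M :: "'n::{finite,wellorder} square"
  assumes "invertible M"
  shows "\<exists>Q R. is_qr M Q R"
proof -
  define c where "c j = column j M" for j
  define W where "W j = span (c ` {k. k < j})" for j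
  have "\<exists>p z. p \<in> W j \<and> (\<forall>w\<in>W j. orthogonal z w) \<and> c j = p + z" for j
    using orthogonal_subspace_decomp_exists[of "c ` {k. k < j}" "c j"] by (metis W_def)
  then obtain p z where p: "\<And>j. p j \<in> W j" and z: "\<And>j w. w \<in> W j \<Longrightarrow> orthogonal (z j) w"
    and c_eq: "\<And>j. c j = p j + z j"
    by metis
  have "det M \<noteq> 0" using assms by (simp add: invertible_det_nz)
  have z_nonzero: "z j \<noteq> 0" for j
  proof
    assume "z j = 0"
    then have "c j \<in> span (c ` {k. k < j})" using c_eq[of j] p[of j] by (simp add: W_def)
    \<comment> \<open>\<open>columns M\<close> is a set and hides repeated columns, so equal columns
      are a case of their own.\<close>
    then have mem: "column j M \<in> span (columns M - {column j M}) \<or> (\<exists>k<j. c k = c j)"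
    proof (cases "\<exists>k<j. c k = c j")
      case False
      then have "c ` {k. k < j} \<subseteq> columns M - {column j M}"
        by (auto simp: c_def columns_def)
      then have "span (c ` {k. k < j}) \<subseteq> span (columns M - {column j M})" by (rule span_mono)
      then show ?thesis using \<open>c j \<in> _\<close> by (auto simp: c_def)
    qed simp
    then show False
    proof
      assume "column j M \<in> span (columns M - {column j M})"
      then have "dependent (columns M)"
        unfolding dependent_def by (auto simp: columns_def)
      then show False using \<open>det M \<noteq> 0\<close> det_dependent_columns[of M] by (simp add: dependent_vec_eq)
    next
      assume "\<exists>k<j. c k = c j"
      then show False using \<open>det M \<noteq> 0\<close> det_identical_columns[of _ j M] by (metis c_def less_irrefl)
    qed
  qed
  have z_mem: "z k \<in> W j" if "k < j" for k j
  proof -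
    have "c k \<in> W j" using that by (auto simp: W_def intro: span_base)
    moreover have "p k \<in> W j"
      using p[of k] span_mono[of "c ` {l. l < k}" "c ` {l. l < j}"] that by (force simp: W_def)
    ultimately have "c k - p k \<in> W j" by (simp add: W_def span_diff)
    then show ?thesis by (simp add: c_eq)
  qed
  define q where "q j = z j /\<^sub>R norm (z j)" for j
  define Q where "Q = (\<chi> i j. q j $ i)"
  define R where "R = transpose Q ** M"
  have q_col: "column j Q = q j" for j by (simp add: Q_def column_def vec_eq_iff)
  have orth: "orthogonal (z i) (z j)" if "i \<noteq> j" for i j
    using that z z_mem by (metis linorder_neqE orthogonal_commute)
  have Q: "orthogonal_matrix Q"
    unfolding orthogonal_matrix_orthonormal_columns q_col
  proof (intro conjI allI impI)
    show "norm (q i) = 1" for i using z_nonzero[of i] by (simp add: q_def)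
    show "orthogonal (q i) (q j)" if "i \<noteq> j" for i j
      using orth[OF that] by (simp add: q_def orthogonal_clauses)
  qed
  have R_nth: "R $ i $ j = q i \<bullet> c j" for i j
    by (simp add: R_def matrix_matrix_mult_def transpose_def Q_def inner_vec_def c_def column_def)
  have "is_qr M Q R"
    unfolding is_qr_def
  proof (intro conjI allI impI)
    show "M = Q ** R"
      using Q by (simp add: R_def matrix_mul_assoc orthogonal_matrix_def)
    show "R $ i $ j = 0" if "j < i" for i j
    proof -
      have "c j \<in> W i" using that by (auto simp: W_def intro: span_base)
      then show ?thesis using z[of "c j" i] by (simp add: R_nth q_def orthogonal_def)
    qed
    show "R $ i $ i > 0" for i
    proof -
      have "z i \<bullet> c i = z i \<bullet> z i"
        using z[OF p[of i]] by (simp add: c_eq orthogonal_def inner_add_right)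
      then show ?thesis using z_nonzero[of i] by (simp add: R_nth q_def)
    qed
  qed (rule Q)
  then show ?thesis by blast
qed

lemma is_qr_qr:
  assumes "invertible M"
  shows "is_qr M (fst (qr M)) (snd (qr M))"
proof -
  obtain Q R where "is_qr M Q R" using is_qr_exists[OF assms] by blast
  then have "\<exists>x. case x of (Q, R) \<Rightarrow> is_qr M Q R" by auto
  then have "case qr M of (Q, R) \<Rightarrow> is_qr M Q R"
    unfolding qr_def by (rule someI_ex)
  then show ?thesis by (simp add: case_prod_unfold)
qed

text \<open>A diagonal entry is the inner product of a unit column of \<open>Q\<close> with the
  corresponding column of \<open>M\<close>.\<close>

lemma is_qr_diag_le_column:
  assumes "is_qr M Q R"
  shows "R $ j $ j \<le> norm (column j M)"
proof -
  have Q: "orthogonal_matrix Q" and M: "M = Q ** R" using assms by (auto simp: is_qr_def)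
  have "R = transpose Q ** M" using Q by (simp add: M matrix_mul_assoc orthogonal_matrix)
  then have "R $ j $ j = column j Q \<bullet> column j M"
    by (simp add: matrix_matrix_mult_def transpose_def inner_vec_def column_def)
  also have "\<dots> \<le> norm (column j Q) * norm (column j M)" by (rule norm_cauchy_schwarz)
  also have "norm (column j Q) = 1" using Q by (simp add: orthogonal_matrix_orthonormal_columns)
  finally show ?thesis by simp
qed

section \<open>Initial segments of the index type\<close>

text \<open>Exchange argument: \<open>T - S\<close> and \<open>S - T\<close> have the same size, and
  every element of the former lies above every element of the latter, so the minimum
  \<open>m\<close> of \<open>f\<close> on \<open>S - T\<close> separates the two sums.\<close>

lemma sum_le_initial_segment:
  fixes f :: "'n::{finite,linorder} \<Rightarrow> real"
  assumes down: "\<And>i j. i \<in> S \<Longrightarrow> j < i \<Longrightarrow> j \<in> S"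
    and f: "\<And>i j. i \<le> j \<Longrightarrow> f j \<le> f i" and card: "card T = card S"
  shows "sum f T \<le> sum f S"
proof (cases "S - T = {}")
  case True
  then have "S \<subseteq> T" by blast
  then have "S = T" using card by (simp add: card_subset_eq)
  then show ?thesis by simp
next
  case False
  define m where "m = Min (f ` (S - T))"
  have "m \<in> f ` (S - T)"
    unfolding m_def using False by (intro Min_in) auto
  then obtain i where i: "i \<in> S - T" "m = f i" by blast
  have le: "f j \<le> m" if "j \<in> T - S" for j
  proof -
    have "i \<le> j" using that i down[of i j] by (metis Diff_iff not_less)
    then show ?thesis using f i by simp
  qed
  have "card (T - S) = card (S - T)"
    using card card_Diff_subset_Int[of T S] card_Diff_subset_Int[of S T] by (simp add: Int_commute)
  then have "sum f (T - S) \<le> real (card (S - T)) * m"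
    using sum_bounded_above[of "T - S" f m] le by simp
  also have "\<dots> \<le> sum f (S - T)"
    by (rule sum_bounded_below) (simp add: m_def)
  finally show ?thesis
    using sum.Int_Diff[of T f S] sum.Int_Diff[of S f T] by (simp add: Int_commute)
qed

lemma prod_le_initial_segment:
  fixes f :: "'n::{finite,linorder} \<Rightarrow> real"
  assumes "\<And>i j. i \<in> S \<Longrightarrow> j < i \<Longrightarrow> j \<in> S"
    and "\<And>i j. i \<le> j \<Longrightarrow> f j \<le> f i" and "\<And>i. 0 < f i" and "card T = card S"
  shows "prod f T \<le> prod f S"
proof -
  have "(\<Sum>i\<in>T. ln (f i)) \<le> (\<Sum>i\<in>S. ln (f i))"
    using assms by (intro sum_le_initial_segment) auto
  then have "ln (prod f T) \<le> ln (prod f S)"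
    using less_imp_neq[OF assms(3)] by (simp add: ln_prod)
  then show ?thesis using assms(3) by (simp add: prod_pos)
qed

lemma nth_index_strict_mono:
  assumes "1 \<le> i" "i < j" "j \<le> CARD('n)"
  shows "(nth_index i :: 'n::{finite,wellorder}) < nth_index j"
  unfolding nth_index_def
  using assms strict_sorted_list_of_set[of "UNIV :: 'n set"]
  by (intro sorted_wrt_nth_less[of "(<)"]) auto

lemma bij_nth_index: "bij_betw nth_index {1..CARD('n)} (UNIV :: 'n::{finite,wellorder} set)"
proof -
  have "inj_on (nth_index :: nat \<Rightarrow> 'n) {1..CARD('n)}"
    using nth_index_strict_mono[where 'n='n] by (intro linorder_inj_onI') (auto simp: less_le)
  moreover from card_image[OF this] have "nth_index ` {1..CARD('n)} = (UNIV :: 'n set)"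
    by (intro card_subset_eq) auto
  ultimately show ?thesis by (simp add: bij_betw_def)
qed

text \<open>The concrete choice of the set carrying the exterior power: being an initial segment, it
  is compatible with triangular factors.\<close>

definition first_indices :: "nat \<Rightarrow> 'n::{finite,wellorder} set" where
  "first_indices L = nth_index ` {1..L}"

definition index_rank :: "'n::{finite,wellorder} \<Rightarrow> nat" where
  "index_rank = the_inv_into {1..CARD('n)} nth_index"

lemma index_rank_nth_index: "1 \<le> k \<Longrightarrow> k \<le> CARD('n) \<Longrightarrow> index_rank (nth_index k :: 'n::{finite,wellorder}) = k"
  unfolding index_rank_def using bij_nth_index[where 'n='n]
  by (intro the_inv_into_f_f) (auto simp: bij_betw_def)

lemma nth_index_index_rank: "nth_index (index_rank i) = (i :: 'n::{finite,wellorder})"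
  unfolding index_rank_def using bij_nth_index[where 'n='n] by (intro f_the_inv_into_f_bij_betw) auto

lemma index_rank_bounds: "1 \<le> index_rank i" "index_rank (i :: 'n::{finite,wellorder}) \<le> CARD('n)"
proof -
  have "index_rank i \<in> {1..CARD('n)}"
    unfolding index_rank_def using bij_nth_index[where 'n='n]
    by (intro the_inv_into_into) (auto simp: bij_betw_def)
  then show "1 \<le> index_rank i" "index_rank i \<le> CARD('n)" by auto
qed

lemma index_rank_mono: "i < j \<Longrightarrow> index_rank i < index_rank (j :: 'n::{finite,wellorder})"
proof (rule ccontr)
  assume "i < j" "\<not> index_rank i < index_rank j"
  then have "j \<le> i"
    using nth_index_strict_mono[of "index_rank j" "index_rank i", where 'n='n] index_rank_bounds[of i] index_rank_bounds[of j]
    by (metis linorder_cases nth_index_index_rank order.strict_implies_order order_refl)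
  then show False using \<open>i < j\<close> by simp
qed

lemma first_indices_down:
  assumes "L \<le> CARD('n)" "i \<in> first_indices L" "j < i"
  shows "j \<in> (first_indices L :: 'n::{finite,wellorder} set)"
proof -
  obtain k where k: "i = nth_index k" "1 \<le> k" "k \<le> L" using assms(2) by (auto simp: first_indices_def)
  then have "index_rank i = k" using assms(1) by (simp add: index_rank_nth_index)
  then have "index_rank j \<in> {1..L}" using index_rank_mono[OF assms(3)] index_rank_bounds[of j] k by simp
  then show ?thesis unfolding first_indices_def by (metis image_eqI nth_index_index_rank)
qed

lemma inj_on_nth_index: "L \<le> CARD('n) \<Longrightarrow> inj_on (nth_index :: nat \<Rightarrow> 'n::{finite,wellorder}) {1..L}"
  using bij_nth_index[where 'n='n] by (auto simp: bij_betw_def intro: inj_on_subset)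

lemma prod_first_indices:
  "L \<le> CARD('n) \<Longrightarrow> (\<Prod>i\<in>first_indices L. f i) = (\<Prod>k=1..L. f (nth_index k :: 'n::{finite,wellorder}))"
  unfolding first_indices_def using inj_on_nth_index[where 'n='n] by (simp add: prod.reindex)

lemma sum_first_indices:
  "L \<le> CARD('n) \<Longrightarrow> (\<Sum>i\<in>first_indices L. f i) = (\<Sum>k=1..L. f (nth_index k :: 'n::{finite,wellorder}))"
  unfolding first_indices_def using inj_on_nth_index[where 'n='n] by (simp add: sum.reindex)

lemma first_indices_full: "first_indices CARD('n) = (UNIV :: 'n::{finite,wellorder} set)"
  unfolding first_indices_def using bij_nth_index[where 'n='n] by (simp add: bij_betw_def)

section \<open>Singular values\<close>

text \<open>The eigenvector is a maximum of the Rayleigh quotient on the unit sphere of \<open>V\<close>.\<close>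

lemma selfadjoint_orthonormal_eigenbasis:
  fixes f :: "'a::euclidean_space \<Rightarrow> 'a"
  assumes "linear f" and self: "\<And>x y. f x \<bullet> y = x \<bullet> f y"
    and "subspace V" and "f ` V \<subseteq> V"
  shows "\<exists>B. pairwise orthogonal B \<and> (\<forall>b\<in>B. norm b = 1 \<and> (\<exists>\<mu>. f b = \<mu> *\<^sub>R b)) \<and> span B = V"
  using assms(3,4)
proof (induction "dim V" arbitrary: V rule: less_induct)
  case less
  interpret linear f by fact
  show ?case
  proof (cases "V = {0}")
    case True
    then show ?thesis by (intro exI[of _ "{}"]) auto
  next
    case False
    then obtain v where v: "v \<in> V" "v \<noteq> 0" using subspace_0[OF less.prems(1)] by blast
    let ?S = "V \<inter> sphere 0 1"
    have "compact ?S" using closed_subspace[OF less.prems(1)] by (intro closed_Int_compact) auto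
    moreover have "v /\<^sub>R norm v \<in> ?S" using v less.prems(1) by (auto intro: subspace_scale)
    moreover have "continuous_on ?S (\<lambda>x. x \<bullet> f x)"
      using \<open>linear f\<close> by (intro continuous_intros linear_continuous_on linear_linear[THEN iffD2])
    ultimately obtain x where x: "x \<in> ?S" and max: "\<And>y. y \<in> ?S \<Longrightarrow> y \<bullet> f y \<le> x \<bullet> f x"
      using continuous_attains_sup[of ?S "\<lambda>x. x \<bullet> f x"] by blast
    define \<mu> where "\<mu> = x \<bullet> f x"
    have xV: "x \<in> V" and nx: "norm x = 1" using x by auto
    have xx: "x \<bullet> x = 1" using nx by (simp add: dot_square_norm)
    have quad: "y \<bullet> f y \<le> \<mu> * (y \<bullet> y)" if "y \<in> V" for y
    proof (cases "y = 0")
      case False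
      have "y /\<^sub>R norm y \<in> ?S" using that False less.prems(1) by (auto intro: subspace_scale)
      from max[OF this] have "(y \<bullet> f y) / (norm y)\<^sup>2 \<le> \<mu>"
        by (simp add: scale \<mu>_def field_simps power2_eq_square)
      then show ?thesis using False by (simp add: field_simps dot_square_norm)
    qed (simp add: \<open>linear f\<close> linear_0)
    have ortho: "(\<mu> *\<^sub>R x - f x) \<bullet> y = 0" if y: "y \<in> V" for y
    proof (rule ccontr)
      define b where "b = (\<mu> *\<^sub>R x - f x) \<bullet> y"
      define c where "c = \<mu> * (y \<bullet> y) - y \<bullet> f y"
      assume "(\<mu> *\<^sub>R x - f x) \<bullet> y \<noteq> 0"
      then have b: "b \<noteq> 0" by (simp add: b_def)
      have c: "c \<ge> 0" using quad[OF y] by (simp add: c_def)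
      have pos: "0 \<le> 2 * t * b + t * t * c" for t
      proof -
        have "x + t *\<^sub>R y \<in> V" using xV y less.prems(1) by (simp add: subspace_add subspace_scale)
        from quad[OF this] show ?thesis
          by (simp add: add scale inner_add_left inner_add_right inner_diff_left \<mu>_def[symmetric] b_def c_def xx
              self inner_commute[of y x] inner_commute[of y "f x"] algebra_simps)
      qed
      have "0 \<le> 2 * (- b / (c + 1)) * b + (- b / (c + 1)) * (- b / (c + 1)) * c" by (rule pos)
      also have "\<dots> = - (b * b) * (c + 2) / ((c + 1) * (c + 1))"
        using c by (simp add: divide_simps) (simp add: algebra_simps)
      also have "\<dots> < 0"
        using b c by (intro divide_neg_pos mult_neg_pos) (auto simp: zero_less_mult_iff)
      finally show False by simp
    qed
    have "\<mu> *\<^sub>R x - f x \<in> V" using xV less.prems by (auto intro: subspace_diff subspace_scale)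
    from ortho[OF this] have fx: "f x = \<mu> *\<^sub>R x" by simp
    \<comment> \<open>The complement of \<open>x\<close> in \<open>V\<close> is again invariant,
      since \<open>f\<close> is selfadjoint and \<open>x\<close> is an eigenvector; it supplies the
      remaining basis vectors.\<close>
    define V' where "V' = {v \<in> V. x \<bullet> v = 0}"
    have sub: "subspace V'"
      using less.prems(1) by (auto simp: V'_def subspace_def inner_add_right)
    have "x \<notin> V'" using xx by (simp add: V'_def)
    then have "V' \<subset> V" using xV unfolding V'_def by blast
    then have "dim V' < dim V"
      using sub less.prems(1) by (metis dim_psubset span_eq_iff)
    moreover have "f ` V' \<subseteq> V'"
      using less.prems(2) by (auto simp: V'_def self[symmetric] fx)
    ultimately obtain B where B: "pairwise orthogonal B" "\<And>b. b \<in> B \<Longrightarrow> norm b = 1 \<and> (\<exists>\<mu>. f b = \<mu> *\<^sub>R b)"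
      "span B = V'"
      using less.hyps[OF _ sub] by blast
    have "B \<subseteq> V'" using B(3) span_superset by blast
    have "pairwise orthogonal (insert x B)"
      using B(1) \<open>B \<subseteq> V'\<close> by (auto simp: pairwise_insert V'_def orthogonal_def inner_commute)
    moreover have "span (insert x B) = V"
    proof
      show "span (insert x B) \<subseteq> V"
        using xV \<open>B \<subseteq> V'\<close> less.prems(1) by (intro span_minimal) (auto simp: V'_def)
      show "V \<subseteq> span (insert x B)"
      proof
        fix v assume v: "v \<in> V"
        have "v - (x \<bullet> v) *\<^sub>R x \<in> V'"
          using v xV less.prems(1) by (auto simp: V'_def inner_diff_right xx intro: subspace_diff subspace_scale)
        then show "v \<in> span (insert x B)"
          unfolding span_insert using B(3) by blast
      qed
    qed
    ultimately show ?thesis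
      using B(2) nx fx by (intro exI[of _ "insert x B"]) auto
  qed
qed

text \<open>Lists built from values with multiplicities become lists of images of distinct elements.
  This links the definition of singular values by eigenspace dimensions to an actual
  eigenbasis.\<close>

lemma enumerate_fibres:
  assumes "distinct vals" "finite B"
  shows "\<exists>bs. distinct bs \<and> set bs = {b \<in> B. \<phi> b \<in> set vals} \<and>
           map \<phi> bs = concat (map (\<lambda>a. replicate (card {b \<in> B. \<phi> b = a}) a) vals)"
  using assms(1)
proof (induction vals)
  case (Cons a vals)
  then obtain bs where bs: "distinct bs" "set bs = {b \<in> B. \<phi> b \<in> set vals}"
    "map \<phi> bs = concat (map (\<lambda>a. replicate (card {b \<in> B. \<phi> b = a}) a) vals)" by auto
  obtain cs where cs: "set cs = {b \<in> B. \<phi> b = a}" "distinct cs"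
    using finite_distinct_list[of "{b \<in> B. \<phi> b = a}"] assms(2) by auto
  have "map \<phi> cs = replicate (card {b \<in> B. \<phi> b = a}) a"
    using cs distinct_card[OF cs(2)] by (intro replicate_eqI) auto
  then show ?case
    using bs cs Cons.prems by (intro exI[of _ "cs @ bs"]) auto
qed auto

lemma sorted_wrt_concat_replicate:
  fixes c :: "'a \<Rightarrow> 'b::preorder"
  assumes "sorted_wrt (\<ge>) (map c js)"
  shows "sorted_wrt (\<ge>) (concat (map (\<lambda>j. replicate (m j) (c j)) js))"
  using assms
proof (induction js)
  case (Cons j js)
  have "sorted_wrt (\<ge>) (replicate k (c j))" for k by (induction k) auto
  then show ?case using Cons by (auto simp: sorted_wrt_append)
qed simp

text \<open>For an orthonormal eigenbasis of \<open>transpose M ** M\<close>, the eigenvalue of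
  \<open>b\<close> is the square of the length of \<open>M *v b\<close>, and the images of different
  basis vectors stay orthogonal.\<close>

lemma singular_values_eigenbasis:
  fixes M :: "real^'n^'n"
  shows "\<exists>bs. distinct bs \<and> length bs = CARD('n) \<and> pairwise orthogonal (set bs) \<and>
    (\<forall>b\<in>set bs. norm b = 1) \<and> (\<forall>b\<in>set bs. \<forall>b'\<in>set bs. b \<noteq> b' \<longrightarrow> orthogonal (M *v b) (M *v b')) \<and>
    (\<forall>k<CARD('n). singular_value (Suc k) M = norm (M *v (bs ! k))) \<and>
    sorted_wrt (\<ge>) (map (\<lambda>b. norm (M *v b)) bs)"
proof -
  define G where "G = transpose M ** M"
  have G_inner: "(G *v x) \<bullet> y = (M *v x) \<bullet> (M *v y)" for x y
    by (simp add: G_def matrix_vector_mul_assoc[symmetric] dot_lmul_matrix[symmetric] vector_transpose_matrix inner_commute)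
  have self: "(G *v x) \<bullet> y = x \<bullet> (G *v y)" for x y
    by (metis G_inner inner_commute)
  obtain B where B: "pairwise orthogonal B" "\<And>b. b \<in> B \<Longrightarrow> norm b = 1" "\<And>b. b \<in> B \<Longrightarrow> \<exists>\<mu>. G *v b = \<mu> *\<^sub>R b"
    "span B = (UNIV :: (real^'n) set)"
    using selfadjoint_orthonormal_eigenbasis[OF matrix_vector_mul_linear self subspace_UNIV] by auto
  define \<phi> where "\<phi> b = (norm (M *v b))\<^sup>2" for b
  have G_eigen: "G *v b = \<phi> b *\<^sub>R b" if b: "b \<in> B" for b
  proof -
    obtain \<mu> where \<mu>: "G *v b = \<mu> *\<^sub>R b" using B(3)[OF b] by blast
    have "\<mu> = (G *v b) \<bullet> b" using B(2)[OF b] \<mu> by (simp add: dot_square_norm)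
    also have "\<dots> = \<phi> b" by (simp add: G_inner \<phi>_def dot_square_norm)
    finally show ?thesis using \<mu> by simp
  qed
  have indep: "independent B"
    using B(1) B(2)[of 0] by (intro pairwise_orthogonal_independent) auto
  then have fin: "finite B" by (rule independent_imp_finite)
  have card_B: "card B = CARD('n)"
    using dim_span_eq_card_independent[OF indep] B(4) by simp
  \<comment> \<open>Eigenvectors for different eigenvalues are orthogonal, so each eigenspace is
    spanned by the basis vectors that it contains and its dimension counts them.\<close>
  have coef: "x \<bullet> b = 0" if x: "G *v x = a *\<^sub>R x" and b: "b \<in> B" "\<phi> b \<noteq> a" for x a b
  proof -
    have "a * (x \<bullet> b) = \<phi> b * (x \<bullet> b)"
      using self[of x b] x G_eigen[OF b(1)] by simp
    then show ?thesis using b(2) by simp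
  qed
  have eig: "eigenspace G a = span {b \<in> B. \<phi> b = a}" for a
  proof
    show "span {b \<in> B. \<phi> b = a} \<subseteq> eigenspace G a"
    proof (rule span_minimal)
      show "{b \<in> B. \<phi> b = a} \<subseteq> eigenspace G a" by (auto simp: eigenspace_def G_eigen)
      show "subspace (eigenspace G a)"
        by (auto simp: eigenspace_def subspace_def matrix_vector_right_distrib scaleR_right_distrib
            matrix_vector_mult_scaleR)
    qed
    show "eigenspace G a \<subseteq> span {b \<in> B. \<phi> b = a}"
    proof
      fix x assume "x \<in> eigenspace G a"
      then have x: "G *v x = a *\<^sub>R x" by (simp add: eigenspace_def)
      have "x \<in> span B" using B(4) by simp
      then obtain u where u: "x = (\<Sum>b\<in>B. u b *\<^sub>R b)" using span_finite[OF fin] by auto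
      have "u b = 0" if b: "b \<in> B" "\<phi> b \<noteq> a" for b
      proof -
        have "x \<bullet> b = (\<Sum>b'\<in>B. u b' * (b' \<bullet> b))" by (simp add: u inner_sum_left)
        also have "\<dots> = (\<Sum>b'\<in>{b}. u b' * (b' \<bullet> b))"
          using fin b(1) B(1) by (intro sum.mono_neutral_right) (auto simp: pairwise_def orthogonal_def)
        also have "\<dots> = u b" using B(2)[OF b(1)] by (simp add: dot_square_norm)
        finally show ?thesis using coef[OF x b] by simp
      qed
      then have "x = (\<Sum>b\<in>{b \<in> B. \<phi> b = a}. u b *\<^sub>R b)"
        unfolding u using fin by (intro sum.mono_neutral_right) auto
      moreover have "(\<Sum>b\<in>{b \<in> B. \<phi> b = a}. u b *\<^sub>R b) \<in> span {b \<in> B. \<phi> b = a}"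
        by (intro span_sum span_scale span_base)
      ultimately show "x \<in> span {b \<in> B. \<phi> b = a}" by simp
    qed
  qed
  have dim_eig: "dim (eigenspace G a) = card {b \<in> B. \<phi> b = a}" for a
    unfolding eig by (rule dim_span_eq_card_independent) (rule independent_mono[OF indep], auto)
  have "eigenspace G a \<noteq> {0} \<longleftrightarrow> a \<in> \<phi> ` B" for a
  proof -
    have "eigenspace G a \<noteq> {0}" if "b \<in> B" "\<phi> b = a" for b
    proof -
      have "b \<in> eigenspace G a" unfolding eig using that by (intro span_base) simp
      moreover have "b \<noteq> 0" using B(2)[OF that(1)] by auto
      ultimately show ?thesis by blast
    qed
    moreover have "eigenspace G a = {0}" if "a \<notin> \<phi> ` B"
    proof -
      have "{b \<in> B. \<phi> b = a} = {}" using that by blast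
      then show ?thesis unfolding eig by (simp only: span_empty)
    qed
    ultimately show ?thesis by blast
  qed
  then have eig_values: "{a. eigenspace G a \<noteq> {0}} = \<phi> ` B" by blast
  define vals where "vals = rev (sorted_list_of_set (\<phi> ` B))"
  have vals: "distinct vals" "set vals = \<phi> ` B" using fin by (auto simp: vals_def)
  obtain bs where bs: "distinct bs" "set bs = {b \<in> B. \<phi> b \<in> set vals}"
    "map \<phi> bs = concat (map (\<lambda>a. replicate (card {b \<in> B. \<phi> b = a}) a) vals)"
    using enumerate_fibres[OF vals(1) fin] by blast
  have set_bs: "set bs = B" using bs(2) vals(2) by auto
  have len: "length bs = CARD('n)" using distinct_card[OF bs(1)] set_bs card_B by simp
  have map_eq: "map (\<lambda>b. norm (M *v b)) bs = concat (map (\<lambda>a. replicate (card {b \<in> B. \<phi> b = a}) (sqrt a)) vals)"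
  proof -
    have "map (\<lambda>b. norm (M *v b)) bs = map sqrt (map \<phi> bs)" by (simp add: \<phi>_def)
    then show ?thesis unfolding bs(3) by (simp add: map_concat comp_def)
  qed
  have sv: "singular_value (Suc k) M = norm (M *v (bs ! k))" if "k < CARD('n)" for k
  proof -
    have "singular_value (Suc k) M = map (\<lambda>b. norm (M *v b)) bs ! k"
      unfolding map_eq singular_value_def Let_def G_def[symmetric] eig_values dim_eig vals_def by simp
    then show ?thesis using that len by simp
  qed
  have "sorted_wrt (\<ge>) (map sqrt vals)"
    unfolding vals_def by (simp add: sorted_wrt_map sorted_wrt_rev)
  then have "sorted_wrt (\<ge>) (map (\<lambda>b. norm (M *v b)) bs)"
    unfolding map_eq by (rule sorted_wrt_concat_replicate)
  moreover have "orthogonal (M *v b) (M *v b')" if "b \<in> B" "b' \<in> B" "b \<noteq> b'" for b b'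
    using that B(1) G_inner[of b b'] G_eigen[OF that(1)] by (auto simp: orthogonal_def pairwise_def)
  ultimately show ?thesis
    using bs(1) len sv B(1,2) set_bs by (intro exI[of _ bs]) auto
qed

lemma
  assumes "invertible (A :: real^'n^'n)"
  shows matrix_mul_inv: "A ** matrix_inv A = mat 1" and matrix_inv_mul: "matrix_inv A ** A = mat 1"
proof -
  have "A ** matrix_inv A = mat 1 \<and> matrix_inv A ** A = mat 1"
    unfolding matrix_inv_def using assms unfolding invertible_def by (rule someI_ex)
  then show "A ** matrix_inv A = mat 1" "matrix_inv A ** A = mat 1" by auto
qed

text \<open>The columns of \<open>U\<close> are the normalised images of the eigenvectors.
  Invertibility makes all these images nonzero, so no completion to a basis is required.\<close>

lemma invertible_svd:
  fixes M :: "'n::{finite,wellorder} square"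
  assumes M: "invertible M"
  shows "\<exists>U V s. orthogonal_matrix U \<and> orthogonal_matrix V \<and>
     M ** V = U ** (\<chi> i j. if i = j then s i else 0) \<and> (\<forall>i. 0 < s i) \<and> (\<forall>i j. i \<le> j \<longrightarrow> s j \<le> s i) \<and>
     (\<forall>k. 1 \<le> k \<longrightarrow> k \<le> CARD('n) \<longrightarrow> s (nth_index k) = singular_value k M)"
proof -
  obtain bs where bs: "distinct bs" "length bs = CARD('n)" "pairwise orthogonal (set bs)"
    "\<And>b. b \<in> set bs \<Longrightarrow> norm b = 1"
    "\<And>b b'. b \<in> set bs \<Longrightarrow> b' \<in> set bs \<Longrightarrow> b \<noteq> b' \<Longrightarrow> orthogonal (M *v b) (M *v b')"
    "\<And>k. k < CARD('n) \<Longrightarrow> singular_value (Suc k) M = norm (M *v (bs ! k))"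
    "sorted_wrt (\<ge>) (map (\<lambda>b. norm (M *v b)) bs)"
    using singular_values_eigenbasis[of M] by blast
  \<comment> \<open>The list positions start at 0, the ranks at 1.\<close>
  define r where "r i = index_rank i - 1" for i :: 'n
  have r: "r i < CARD('n)" for i
    unfolding r_def using index_rank_bounds[of i] by linarith
  have r_mono: "r i < r j" if "i < j" for i j
    unfolding r_def using index_rank_mono[OF that] index_rank_bounds[of i] by linarith
  define v where "v i = bs ! r i" for i
  have v_mem: "v i \<in> set bs" for i using r[of i] bs(2) by (simp add: v_def)
  have v_neq: "v i \<noteq> v j" if "i \<noteq> j" for i j
  proof -
    have "r i \<noteq> r j" using r_mono that by (metis less_irrefl neqE)
    then show ?thesis using r bs(1,2) by (simp add: v_def nth_eq_iff_index_eq)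
  qed
  define s where "s i = norm (M *v v i)" for i
  have s_pos: "0 < s i" for i
  proof -
    have "M *v v i \<noteq> 0"
    proof
      assume "M *v v i = 0"
      then have "matrix_inv M *v (M *v v i) = 0" by simp
      then have "v i = 0" using matrix_inv_mul[OF M] by (simp add: matrix_vector_mul_assoc)
      then show False using bs(4)[OF v_mem[of i]] by simp
    qed
    then show ?thesis by (simp add: s_def)
  qed
  define V where "V = (\<chi> i j. v j $ i)"
  define U where "U = (\<chi> i j. (M *v v j) $ i / s j)"
  have col_V: "column j V = v j" and col_U: "column j U = (M *v v j) /\<^sub>R s j" for j
    by (simp_all add: V_def U_def column_def vec_eq_iff divide_inverse mult.commute)
  have "orthogonal_matrix V"
    unfolding orthogonal_matrix_orthonormal_columns col_V
    using bs(3,4) v_mem v_neq by (auto simp: pairwise_def)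
  moreover have "orthogonal_matrix U"
    unfolding orthogonal_matrix_orthonormal_columns col_U
  proof (intro conjI allI impI)
    fix i show "norm ((M *v v i) /\<^sub>R s i) = 1"
      using s_pos[of i] by (simp add: s_def)
  next
    fix i j :: 'n assume "i \<noteq> j"
    then show "orthogonal ((M *v v i) /\<^sub>R s i) ((M *v v j) /\<^sub>R s j)"
      using bs(5)[OF v_mem v_mem v_neq] by (simp add: orthogonal_clauses)
  qed
  moreover have "M ** V = U ** (\<chi> i j. if i = j then s i else 0)"
  proof -
    have "(M ** V) $ i $ j = (M *v v j) $ i" for i j
      by (simp add: matrix_matrix_mult_def matrix_vector_mult_def V_def)
    moreover have "(U ** (\<chi> i j. if i = j then s i else 0)) $ i $ j = (M *v v j) $ i" for i j
      using s_pos[of j] by (simp add: matrix_matrix_mult_def U_def if_distrib[of "\<lambda>x. _ * x"] cong: if_cong)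
    ultimately show ?thesis by (simp add: vec_eq_iff)
  qed
  moreover have "s j \<le> s i" if "i \<le> j" for i j
  proof (cases "i = j")
    case False
    then have "r i < r j" using that r_mono by simp
    then show ?thesis
      using sorted_wrt_nth_less[OF bs(7), of "r i" "r j"] r bs(2) by (simp add: s_def v_def)
  qed simp
  moreover have "s (nth_index k) = singular_value k M" if "1 \<le> k" "k \<le> CARD('n)" for k
    using bs(6)[of "k - 1"] that by (simp add: s_def v_def r_def index_rank_nth_index)
  ultimately show ?thesis using s_pos by blast
qed

text \<open>In the singular basis \<open>M\<close> becomes an orthogonal matrix times a diagonal
  one. The lower bound tests the exterior power on the wedge of \<open>V\<close>; the upper bound
  uses that distinct columns of \<open>M ** V\<close> have distinct singular values as lengths,
  counted with multiplicity, and that the first L are the largest.\<close>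

lemma op_norm_ext_pow_singular_values:
  assumes L: "L \<le> CARD('n::{finite,wellorder})"
  shows "\<exists>a b. 0 < a \<and> 0 < b \<and> (\<forall>M :: 'n square. invertible M \<longrightarrow>
     0 < (\<Prod>k=1..L. singular_value k M) \<and>
     a * (\<Prod>k=1..L. singular_value k M) \<le> op_norm (ext_pow (first_indices L) M) \<and>
     op_norm (ext_pow (first_indices L) M) \<le> b * (\<Prod>k=1..L. singular_value k M))"
proof -
  let ?S = "first_indices L :: 'n set"
  obtain \<alpha> \<beta> where ab: "0 < \<alpha>" "0 < \<beta>"
    "\<And>Q :: 'n square. orthogonal_matrix Q \<Longrightarrow> \<alpha> \<le> norm (wedge ?S Q)"
    "\<And>Q :: 'n square. orthogonal_matrix Q \<Longrightarrow> norm (wedge ?S Q) \<le> \<beta>"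
    using norm_wedge_orthogonal[of ?S] by blast
  define c where "c = real CARD('n \<Rightarrow> 'n) * real CARD('n \<Rightarrow> 'n)"
  have c: "c > 0" by (simp add: c_def)
  show ?thesis
  proof (rule exI[of _ "\<alpha> / \<beta>"], rule exI[of _ "c * c"], intro conjI allI impI)
    fix M :: "'n square" assume M: "invertible M"
    obtain U V s where U: "orthogonal_matrix U" and V: "orthogonal_matrix V"
      and eq: "M ** V = U ** (\<chi> i j. if i = j then s i else 0)"
      and s_pos: "\<And>i. 0 < s i" and s_anti: "\<And>i j. i \<le> j \<Longrightarrow> s j \<le> s i"
      and s_nth: "\<And>k. 1 \<le> k \<Longrightarrow> k \<le> CARD('n) \<Longrightarrow> s (nth_index k) = singular_value k M"
      using invertible_svd[OF M] by blast
    have prod_eq: "(\<Prod>k=1..L. singular_value k M) = (\<Prod>i\<in>?S. s i)"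
      using L by (auto simp: prod_first_indices s_nth intro!: prod.cong)
    have pos: "0 < (\<Prod>i\<in>?S. s i)" by (intro prod_pos s_pos)
    then show "0 < (\<Prod>k=1..L. singular_value k M)" unfolding prod_eq .
    have "wedge ?S (M ** V) = (\<Prod>i\<in>?S. s i) *\<^sub>R wedge ?S U"
      unfolding eq by (subst wedge_mult_upper_triangular) (use first_indices_down[OF L] in auto)
    then have "(\<Prod>i\<in>?S. s i) * norm (wedge ?S U) = norm (ext_pow ?S M *v wedge ?S V)"
      using pos by (simp add: ext_pow_wedge)
    also have "\<dots> \<le> op_norm (ext_pow ?S M) * norm (wedge ?S V)" by (rule norm_matrix_vector_le)
    also have "\<dots> \<le> op_norm (ext_pow ?S M) * \<beta>" by (intro mult_left_mono ab V) simp
    finally have "(\<Prod>i\<in>?S. s i) * norm (wedge ?S U) \<le> op_norm (ext_pow ?S M) * \<beta>" .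
    moreover have "(\<Prod>i\<in>?S. s i) * \<alpha> \<le> (\<Prod>i\<in>?S. s i) * norm (wedge ?S U)"
      using pos by (intro mult_left_mono ab U) simp
    ultimately show "\<alpha> / \<beta> * (\<Prod>k=1..L. singular_value k M) \<le> op_norm (ext_pow ?S M)"
      using ab(2) unfolding prod_eq by (simp add: field_simps)
    have "norm (column j (M ** V)) = s j" for j
    proof -
      have "column j (M ** V) = s j *\<^sub>R column j U"
        unfolding eq by (simp add: column_def matrix_matrix_mult_def vec_eq_iff if_distrib[of "\<lambda>x. _ * x"] cong: if_cong)
      then show ?thesis using U s_pos[of j] by (simp add: orthogonal_matrix_orthonormal_columns)
    qed
    moreover have "(\<Prod>i\<in>?S. s (g i)) \<le> (\<Prod>i\<in>?S. s i)" if "inj_on g ?S" for g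
    proof -
      have "(\<Prod>i\<in>?S. s (g i)) = prod s (g ` ?S)" using that by (simp add: prod.reindex)
      also have "\<dots> \<le> prod s ?S"
        using first_indices_down[OF L] that
        by (intro prod_le_initial_segment s_anti s_pos) (auto simp: card_image)
      finally show ?thesis .
    qed
    ultimately have "op_norm (ext_pow ?S (M ** V)) \<le> c * (\<Prod>i\<in>?S. s i)"
      unfolding c_def using pos by (intro onorm_ext_pow_le) auto
    moreover have "op_norm (ext_pow ?S (transpose V)) \<le> c"
      using op_norm_ext_pow_bound[OF op_norm_orthogonal, of "transpose V" ?S] V
      by (simp add: orthogonal_matrix_transpose c_def)
    moreover have "ext_pow ?S M = ext_pow ?S (M ** V) ** ext_pow ?S (transpose V)"
      using V by (simp add: ext_pow_mul[symmetric] matrix_mul_assoc[symmetric] orthogonal_matrix_def)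
    then have "op_norm (ext_pow ?S M) \<le> op_norm (ext_pow ?S (M ** V)) * op_norm (ext_pow ?S (transpose V))"
      by (simp only: op_norm_mul_le)
    ultimately have "op_norm (ext_pow ?S M) \<le> c * (\<Prod>i\<in>?S. s i) * c"
      using c pos by (meson mult_mono op_norm_nonneg order_trans less_imp_le mult_nonneg_nonneg)
    then show "op_norm (ext_pow ?S M) \<le> c * c * (\<Prod>k=1..L. singular_value k M)"
      unfolding prod_eq by (simp add: algebra_simps)
  qed (use ab c in auto)
qed

section \<open>Growth of solutions\<close>

lemma bounded_op_norm:
  fixes A :: "'a \<Rightarrow> real^'n^'n"
  assumes "bounded (A ` T)"
  shows "\<exists>K>0. \<forall>t\<in>T. op_norm (A t) \<le> K"
proof -
  obtain C where C: "0 < C" "\<And>t. t \<in> T \<Longrightarrow> norm (A t) \<le> C"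
    using assms by (auto simp: bounded_pos)
  have "op_norm (A t) \<le> real CARD('n) * real CARD('n) * C" if "t \<in> T" for t
  proof (rule onorm_le_matrix_component)
    fix i j
    have "\<bar>A t $ i $ j\<bar> \<le> norm (A t)"
      using component_le_norm_cart[of "A t $ i" j] Finite_Cartesian_Product.norm_nth_le[of "A t" i] by simp
    then show "\<bar>A t $ i $ j\<bar> \<le> C" using C(2)[OF that] by simp
  qed
  then show ?thesis using C(1) by (intro exI[of _ "real CARD('n) * real CARD('n) * C"]) auto
qed

text \<open>For \<open>c = 1\<close> the upper and for \<open>c = -1\<close> the lower Gronwall estimate.\<close>

lemma linear_ode_growth_aux:
  fixes x :: "real \<Rightarrow> 'a::real_inner"
  assumes x: "\<And>t. 0 \<le> t \<Longrightarrow> (x has_vector_derivative y t) (at t within {0..})"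
    and y: "\<And>t. 0 \<le> t \<Longrightarrow> c * (x t \<bullet> y t) \<le> K * (x t \<bullet> x t)" and c: "c * c = 1"
    and st: "0 \<le> s" "s \<le> t"
  shows "exp (- 2 * c * K * t) * c * (x t \<bullet> x t) \<le> exp (- 2 * c * K * s) * c * (x s \<bullet> x s)"
proof (cases "s = t")
  case False
  let ?\<phi> = "\<lambda>\<tau>. exp (- 2 * c * K * \<tau>) * c * (x \<tau> \<bullet> x \<tau>)"
  have xd: "(x has_derivative (\<lambda>u. u *\<^sub>R y \<tau>)) (at \<tau> within {0..})" if "0 \<le> \<tau>" for \<tau>
    using x[OF that] by (simp add: has_vector_derivative_def)
  have \<phi>: "(?\<phi> has_real_derivative exp (- 2 * c * K * \<tau>) * 2 * (c * (x \<tau> \<bullet> y \<tau>) - K * (x \<tau> \<bullet> x \<tau>))) (at \<tau> within {0..})"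
    if "0 \<le> \<tau>" for \<tau>
  proof -
    have "((\<lambda>\<tau>. x \<tau> \<bullet> x \<tau>) has_real_derivative 2 * (x \<tau> \<bullet> y \<tau>)) (at \<tau> within {0..})"
      unfolding has_field_derivative_def
      using has_derivative_inner[OF xd[OF that] xd[OF that]]
      by (rule has_derivative_eq_rhs) (auto simp: fun_eq_iff inner_commute)
    moreover have "((\<lambda>\<tau>. exp (- 2 * c * K * \<tau>) * c) has_real_derivative exp (- 2 * c * K * \<tau>) * (- 2 * c * K) * c) (at \<tau> within {0..})"
      by (auto intro!: derivative_eq_intros)
    ultimately have "(?\<phi> has_real_derivative exp (- 2 * c * K * \<tau>) * (- 2 * c * K) * c * (x \<tau> \<bullet> x \<tau>) +
        2 * (x \<tau> \<bullet> y \<tau>) * (exp (- 2 * c * K * \<tau>) * c)) (at \<tau> within {0..})"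
      by (rule DERIV_mult[rotated])
    moreover have "c * (c * z) = z" for z using c by (simp flip: mult.assoc)
    ultimately show ?thesis by (simp add: algebra_simps)
  qed
  have "?\<phi> t \<le> ?\<phi> s"
  proof (rule DERIV_nonpos_imp_decreasing_open[of s t ?\<phi>])
    show "s \<le> t" by fact
    show "\<exists>y. (?\<phi> has_real_derivative y) (at \<tau>) \<and> y \<le> 0" if "s < \<tau>" "\<tau> < t" for \<tau>
    proof (intro exI conjI)
      have "at \<tau> within {0..} = at \<tau>" using that st by (intro at_within_interior) (auto simp: interior_Ici)
      then show "(?\<phi> has_real_derivative exp (- 2 * c * K * \<tau>) * 2 * (c * (x \<tau> \<bullet> y \<tau>) - K * (x \<tau> \<bullet> x \<tau>))) (at \<tau>)"
        using \<phi>[of \<tau>] that st by simp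
      show "exp (- 2 * c * K * \<tau>) * 2 * (c * (x \<tau> \<bullet> y \<tau>) - K * (x \<tau> \<bullet> x \<tau>)) \<le> 0"
        using y[of \<tau>] that st by (intro mult_nonneg_nonpos) auto
    qed
    have "continuous_on {0..} ?\<phi>"
      using \<phi> by (intro DERIV_continuous_on) auto
    then show "continuous_on {s..t} ?\<phi>" by (rule continuous_on_subset) (use st in auto)
  qed
  then show ?thesis .
qed simp

text \<open>Both directions of time are covered. Running backwards gives uniqueness of solutions,
  lower bounds on exponents and bounded inverses of single steps.\<close>

lemma linear_ode_growth:
  fixes A :: "real \<Rightarrow> real^'n^'n"
  assumes x: "\<And>t. 0 \<le> t \<Longrightarrow> (x has_vector_derivative A t *v x t) (at t within {0..})"
    and K: "\<And>t. 0 \<le> t \<Longrightarrow> op_norm (A t) \<le> K" and st: "0 \<le> s" "0 \<le> t"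
  shows "norm (x t) \<le> exp (K * \<bar>t - s\<bar>) * norm (x s)"
proof -
  have "\<bar>x t \<bullet> (A t *v x t)\<bar> \<le> K * (x t \<bullet> x t)" if "0 \<le> t" for t
  proof -
    have "\<bar>x t \<bullet> (A t *v x t)\<bar> \<le> norm (x t) * norm (A t *v x t)" by (rule Cauchy_Schwarz_ineq2)
    also have "\<dots> \<le> norm (x t) * (K * norm (x t))"
      using norm_matrix_vector_le[of "A t" "x t"] K[OF that]
      by (intro mult_left_mono) (auto intro: order_trans[OF _ mult_right_mono])
    finally show ?thesis by (simp add: dot_square_norm power2_eq_square algebra_simps)
  qed
  note bound = abs_le_D1[OF this] abs_le_D2[OF this]
  have sq: "norm a \<le> exp r * norm b" if "a \<bullet> a \<le> exp (2 * r) * (b \<bullet> b)" for a b :: "real^'n" and r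
  proof -
    have "(norm a)\<^sup>2 \<le> (exp r * norm b)\<^sup>2"
      using that by (simp add: power_mult_distrib dot_square_norm exp_double)
    then show ?thesis by (rule power2_le_imp_le) simp
  qed
  have exp_move: "u \<le> exp (b - a) * v" if "exp a * u \<le> exp b * v" for a b u v :: real
    using that by (simp add: exp_diff field_simps)
  show ?thesis
  proof (cases "s \<le> t")
    case True
    have "exp (- 2 * 1 * K * t) * 1 * (x t \<bullet> x t) \<le> exp (- 2 * 1 * K * s) * 1 * (x s \<bullet> x s)"
      by (rule linear_ode_growth_aux[OF x _ _ st(1) True]) (simp_all add: bound)
    then have "x t \<bullet> x t \<le> exp (- 2 * K * s - - 2 * K * t) * (x s \<bullet> x s)"
      by (intro exp_move) simp
    also have "- 2 * K * s - - 2 * K * t = 2 * (K * \<bar>t - s\<bar>)"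
      using True by (simp add: algebra_simps)
    finally have "x t \<bullet> x t \<le> exp (2 * (K * \<bar>t - s\<bar>)) * (x s \<bullet> x s)" .
    then show ?thesis by (rule sq)
  next
    case False
    then have ts: "t \<le> s" by simp
    have "exp (- 2 * (- 1) * K * s) * (- 1) * (x s \<bullet> x s) \<le> exp (- 2 * (- 1) * K * t) * (- 1) * (x t \<bullet> x t)"
      by (rule linear_ode_growth_aux[OF x _ _ st(2) ts]) (simp_all add: bound)
    then have "exp (2 * K * t) * (x t \<bullet> x t) \<le> exp (2 * K * s) * (x s \<bullet> x s)" by simp
    then have "x t \<bullet> x t \<le> exp (2 * K * s - 2 * K * t) * (x s \<bullet> x s)"
      by (rule exp_move)
    also have "2 * K * s - 2 * K * t = 2 * (K * \<bar>t - s\<bar>)"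
      using False by (simp add: algebra_simps)
    finally have "x t \<bullet> x t \<le> exp (2 * (K * \<bar>t - s\<bar>)) * (x s \<bullet> x s)" .
    then show ?thesis by (rule sq)
  qed
qed

lemma fundamental_matrix_solution:
  fixes A X :: "real \<Rightarrow> real^'n^'n"
  assumes "fundamental_matrix A X" "0 \<le> t"
  shows "((\<lambda>t. X t *v c) has_vector_derivative A t *v (X t *v c)) (at t within {0..})"
proof -
  have "bounded_linear (\<lambda>M :: real^'n^'n. M *v c)"
    by (simp add: linear_conv_bounded_linear[symmetric] linear_iff matrix_vector_mult_add_rdistrib scaleR_matrix_vector_assoc)
  from bounded_linear.has_vector_derivative[OF this, of X "A t ** X t"]
  show ?thesis using assms by (simp add: fundamental_matrix_def matrix_vector_mul_assoc)
qed

lemma op_norm_cauchy_matrix: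
  assumes X: "fundamental_matrix A X" and K: "\<And>t. 0 \<le> t \<Longrightarrow> op_norm (A t) \<le> K" and st: "0 \<le> s" "0 \<le> t"
  shows "op_norm (cauchy_matrix X t s) \<le> exp (K * \<bar>t - s\<bar>)"
proof (rule onorm_le)
  fix v
  have "norm (X t *v (matrix_inv (X s) *v v)) \<le> exp (K * \<bar>t - s\<bar>) * norm (X s *v (matrix_inv (X s) *v v))"
    by (rule linear_ode_growth[OF fundamental_matrix_solution[OF X] K st])
  moreover have "X s ** matrix_inv (X s) = mat 1"
    using X st by (intro matrix_mul_inv) (simp add: fundamental_matrix_def)
  ultimately show "norm (cauchy_matrix X t s *v v) \<le> exp (K * \<bar>t - s\<bar>) * norm v"
    by (simp add: cauchy_matrix_def matrix_vector_mul_assoc)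
qed

lemma cauchy_matrix_cocycle:
  assumes "invertible (X s)"
  shows "cauchy_matrix X t s ** cauchy_matrix X s r = cauchy_matrix X t r"
proof -
  have "cauchy_matrix X t s ** cauchy_matrix X s r = X t ** (matrix_inv (X s) ** X s) ** matrix_inv (X r)"
    by (simp add: cauchy_matrix_def matrix_mul_assoc)
  then show ?thesis by (simp add: matrix_inv_mul[OF assms] cauchy_matrix_def)
qed

lemma cauchy_matrix_self: "invertible (X t) \<Longrightarrow> cauchy_matrix X t t = mat 1"
  by (simp add: cauchy_matrix_def matrix_mul_inv)

lemma invertible_cauchy_matrix:
  assumes "invertible (X t)" "invertible (X s)"
  shows "invertible (cauchy_matrix X t s)"
  unfolding cauchy_matrix_def
  using assms matrix_mul_inv[OF assms(2)] matrix_inv_mul[OF assms(2)]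
  by (intro invertible_mult) (auto simp: invertible_def)

section \<open>Coordinates on the solution space\<close>

text \<open>The vector \<open>c\<close> is the coordinate with respect to the fundamental matrix; it
  is the initial value only if \<open>X 0\<close> is the identity. The zero extension matches
  \<open>solutions\<close>.\<close>

definition solution_of :: "(real \<Rightarrow> real^'n^'n) \<Rightarrow> real^'n \<Rightarrow> real \<Rightarrow> real^'n" where
  "solution_of X c = (\<lambda>t. if 0 \<le> t then X t *v c else 0)"

lemma solution_of_in_solutions:
  assumes "fundamental_matrix A X"
  shows "solution_of X c \<in> solutions A"
  unfolding solutions_def
proof (intro CollectI conjI allI impI)
  fix t :: real assume t: "0 \<le> t"
  show "(solution_of X c has_vector_derivative A t *v solution_of X c t) (at t within {0..})"
    using fundamental_matrix_solution[OF assms t, of c] t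
    by (rule_tac has_vector_derivative_transform) (auto simp: solution_of_def)
qed (simp add: solution_of_def)

text \<open>Uniqueness follows from the growth estimate, applied to the difference of two solutions
  that agree at time 0.\<close>

lemma solutions_eq:
  assumes X: "fundamental_matrix A X" and K: "\<And>t. 0 \<le> t \<Longrightarrow> op_norm (A t) \<le> K"
  shows "solutions A = range (solution_of X)"
proof
  show "range (solution_of X) \<subseteq> solutions A" using solution_of_in_solutions[OF X] by blast
  show "solutions A \<subseteq> range (solution_of X)"
  proof
    fix x assume x: "x \<in> solutions A"
    define c where "c = matrix_inv (X 0) *v x 0"
    define y where "y t = x t - X t *v c" for t
    have y_eq: "y = (\<lambda>t. x t - X t *v c)" by (simp add: y_def fun_eq_iff)
    have y: "(y has_vector_derivative A t *v y t) (at t within {0..})" if "0 \<le> t" for t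
      using x that fundamental_matrix_solution[OF X that, of c]
      unfolding y_eq matrix_vector_mult_diff_distrib
      by (intro has_vector_derivative_diff) (auto simp: solutions_def)
    have "y 0 = 0"
      using X matrix_mul_inv[of "X 0"]
      by (simp add: y_def c_def matrix_vector_mul_assoc fundamental_matrix_def)
    then have "y t = 0" if "0 \<le> t" for t
      using linear_ode_growth[OF y K, of 0 t] that by simp
    then have "x = solution_of X c"
      using x by (auto simp: solution_of_def y_def solutions_def fun_eq_iff)
    then show "x \<in> range (solution_of X)" by blast
  qed
qed

lemma solution_of_inj:
  assumes "fundamental_matrix A X"
  shows "inj (solution_of X)"
proof (rule injI)
  fix c d assume "solution_of X c = solution_of X d"
  then have "solution_of X c 0 = solution_of X d 0" by simp
  then have "matrix_inv (X 0) *v (X 0 *v c) = matrix_inv (X 0) *v (X 0 *v d)"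
    by (simp add: solution_of_def)
  then show "c = d"
    using matrix_inv_mul[of "X 0"] assms by (simp add: matrix_vector_mul_assoc fundamental_matrix_def)
qed

lemma solution_of_0: "solution_of X 0 = 0"
  by (simp add: solution_of_def fun_eq_iff)

lemma solution_dim_image:
  fixes U :: "(real^'n) set"
  assumes "fundamental_matrix A X"
  shows "solution_dim (solution_of X ` U) = dim U"
proof -
  \<comment> \<open>The space of functions is infinite-dimensional, so finiteness of dimension is
    claimed only for the source.\<close>
  have pair: "finite_dimensional_vector_space_pair_1 (scaleR :: real \<Rightarrow> real^'n \<Rightarrow> _) Basis
      (fun_scale :: real \<Rightarrow> (real \<Rightarrow> real^'n) \<Rightarrow> _)"
    by (intro finite_dimensional_vector_space_pair_1.intro finite_dimensional_vector_space_euclidean vector_space_fun_scale)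
  have linear: "Vector_Spaces.linear scaleR fun_scale (solution_of X)"
    unfolding Vector_Spaces.linear_iff
    using vector_space_fun_scale
    by (auto simp: solution_of_def fun_scale_def fun_eq_iff matrix_vector_right_distrib matrix_vector_mult_scaleR
        intro: real_vector.vector_space_axioms)
  have "inj_on (solution_of X) S" for S
    using solution_of_inj[OF assms] by (rule inj_on_subset) simp
  then show ?thesis
    unfolding solution_dim_def dim_raw_def
    by (rule finite_dimensional_vector_space_pair_1.dim_image_eq[OF pair linear])
qed

section \<open>Lyapunov exponents\<close>

lemma eventually_const_le_exp:
  assumes "0 < \<delta>"
  shows "\<forall>\<^sub>F t in at_top. (k::real) \<le> exp (\<delta> * t)"
proof -
  have "filterlim (\<lambda>t. \<delta> * t) at_top at_top"
    using assms by (intro filterlim_tendsto_pos_mult_at_top[OF tendsto_const]) (auto intro: filterlim_ident)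
  then have "filterlim (\<lambda>t. exp (\<delta> * t)) at_top at_top"
    by (rule filterlim_compose[OF exp_at_top])
  then show ?thesis by (simp add: filterlim_at_top)
qed

text \<open>In terms of exponential bounds the logarithm disappears, and with it the special case of
  vanishing values. The margin r > a turns the limit superior into eventual inequalities.\<close>

lemma lyapunov_exponent_le_iff:
  "lyapunov_exponent x \<le> ereal a \<longleftrightarrow> (\<forall>r>a. \<forall>\<^sub>F t in at_top. norm (x t) \<le> exp (r * t))"
proof -
  define f where "f t = (if x t = 0 then -\<infinity> else ereal (1 / t * ln (norm (x t))))" for t
  have le: "norm (x t) \<le> exp (r * t) \<longleftrightarrow> f t \<le> ereal r" if "0 < t" for t r
  proof (cases "x t = 0")
    case False
    then have "norm (x t) \<le> exp (r * t) \<longleftrightarrow> ln (norm (x t)) \<le> r * t"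
      using ln_le_cancel_iff[of "norm (x t)" "exp (r * t)"] by simp
    also have "\<dots> \<longleftrightarrow> 1 / t * ln (norm (x t)) \<le> r"
      using that by (simp add: field_simps)
    finally show ?thesis using False by (simp add: f_def)
  qed (simp add: f_def)
  have "Limsup at_top f \<le> ereal a \<longleftrightarrow> (\<forall>r>a. \<forall>\<^sub>F t in at_top. norm (x t) \<le> exp (r * t))"
  proof
    assume *: "Limsup at_top f \<le> ereal a"
    show "\<forall>r>a. \<forall>\<^sub>F t in at_top. norm (x t) \<le> exp (r * t)"
    proof (intro allI impI)
      fix r assume "a < r"
      then have "\<forall>\<^sub>F t in at_top. f t < ereal r" using * by (simp add: Limsup_le_iff)
      then show "\<forall>\<^sub>F t in at_top. norm (x t) \<le> exp (r * t)"
        using eventually_gt_at_top[of 0] by eventually_elim (simp add: le)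
    qed
  next
    assume *: "\<forall>r>a. \<forall>\<^sub>F t in at_top. norm (x t) \<le> exp (r * t)"
    show "Limsup at_top f \<le> ereal a"
      unfolding Limsup_le_iff
    proof (intro allI impI)
      fix y assume "ereal a < y"
      then obtain r where r: "ereal a < ereal r" "ereal r < y" using ereal_dense2 by blast
      then have "\<forall>\<^sub>F t in at_top. norm (x t) \<le> exp (r * t)" using * by simp
      then show "\<forall>\<^sub>F t in at_top. f t < y"
        using eventually_gt_at_top[of 0] by eventually_elim (use r in \<open>simp add: le\<close>)
    qed
  qed
  then show ?thesis by (simp add: lyapunov_exponent_def f_def[abs_def])
qed

lemma solution_of_nonneg: "0 \<le> t \<Longrightarrow> solution_of X c t = X t *v c"
  by (simp add: solution_of_def)

lemma lyapunov_exponent_solution_of_le_iff: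
  "lyapunov_exponent (solution_of X c) \<le> ereal a \<longleftrightarrow>
     (\<forall>r>a. \<forall>\<^sub>F t in at_top. norm (X t *v c) \<le> exp (r * t))"
  unfolding lyapunov_exponent_le_iff
  by (intro all_cong imp_cong refl eventually_subst)
     (use eventually_ge_at_top[of 0] in eventually_elim, simp add: solution_of_nonneg)

lemma subspace_lyapunov_exponent_le:
  "subspace {c. lyapunov_exponent (solution_of X c) \<le> ereal a}"
  unfolding subspace_def lyapunov_exponent_solution_of_le_iff
proof (intro conjI ballI allI)
  show "0 \<in> {c. \<forall>r>a. \<forall>\<^sub>F t in at_top. norm (X t *v c) \<le> exp (r * t)}" by simp
next
  fix c d assume c: "c \<in> {c. \<forall>r>a. \<forall>\<^sub>F t in at_top. norm (X t *v c) \<le> exp (r * t)}"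
    and d: "d \<in> {c. \<forall>r>a. \<forall>\<^sub>F t in at_top. norm (X t *v c) \<le> exp (r * t)}"
  show "c + d \<in> {c. \<forall>r>a. \<forall>\<^sub>F t in at_top. norm (X t *v c) \<le> exp (r * t)}"
  proof (intro CollectI allI impI)
    fix r assume "a < r"
    \<comment> \<open>Half of the gap between \<open>a\<close> and \<open>r\<close> is kept to
      absorb the factor 2 of the triangle inequality.\<close>
    then have mid: "a < (a + r) / 2" "0 < (r - a) / 2" by auto
    have "\<forall>\<^sub>F t in at_top. norm (X t *v c) \<le> exp ((a + r) / 2 * t)" "\<forall>\<^sub>F t in at_top. norm (X t *v d) \<le> exp ((a + r) / 2 * t)"
      using c d mid(1) by blast+
    then show "\<forall>\<^sub>F t in at_top. norm (X t *v (c + d)) \<le> exp (r * t)"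
      using eventually_const_le_exp[OF mid(2), of 2]
    proof eventually_elim
      case (elim t)
      have "norm (X t *v (c + d)) \<le> 2 * exp ((a + r) / 2 * t)"
        using elim norm_triangle_ineq[of "X t *v c" "X t *v d"] by (simp add: matrix_vector_right_distrib)
      also have "\<dots> \<le> exp ((r - a) / 2 * t) * exp ((a + r) / 2 * t)"
        using elim by (intro mult_right_mono) auto
      also have "\<dots> = exp (r * t)" by (simp add: exp_add[symmetric] field_simps)
      finally show ?case .
    qed
  qed
next
  fix k :: real and c assume c: "c \<in> {c. \<forall>r>a. \<forall>\<^sub>F t in at_top. norm (X t *v c) \<le> exp (r * t)}"
  show "k *\<^sub>R c \<in> {c. \<forall>r>a. \<forall>\<^sub>F t in at_top. norm (X t *v c) \<le> exp (r * t)}"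
  proof (intro CollectI allI impI)
    fix r assume "a < r"
    then have mid: "a < (a + r) / 2" "0 < (r - a) / 2" by auto
    have "\<forall>\<^sub>F t in at_top. norm (X t *v c) \<le> exp ((a + r) / 2 * t)"
      using c mid(1) by blast
    then show "\<forall>\<^sub>F t in at_top. norm (X t *v (k *\<^sub>R c)) \<le> exp (r * t)"
      using eventually_const_le_exp[OF mid(2), of "\<bar>k\<bar>"]
    proof eventually_elim
      case (elim t)
      have "norm (X t *v (k *\<^sub>R c)) = \<bar>k\<bar> * norm (X t *v c)"
        by (simp add: matrix_vector_mult_scaleR)
      also have "\<dots> \<le> exp ((r - a) / 2 * t) * exp ((a + r) / 2 * t)"
        using elim by (intro mult_mono) auto
      also have "\<dots> = exp (r * t)" by (simp add: exp_add[symmetric] field_simps)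
      finally show ?case .
    qed
  qed
qed

lemma lyapunov_exponent_finite:
  assumes X: "fundamental_matrix A X" and K: "\<And>t. 0 \<le> t \<Longrightarrow> op_norm (A t) \<le> K" and c: "c \<noteq> 0"
  shows "\<exists>a. lyapunov_exponent (solution_of X c) = ereal a"
proof -
  let ?x = "\<lambda>t. X t *v c"
  have pos: "0 < norm (?x 0)"
    using c solution_of_inj[OF X] X matrix_inv_mul[of "X 0"]
    by (metis (no_types, lifting) fundamental_matrix_def matrix_vector_mul_assoc matrix_vector_mul_lid
        matrix_vector_mult_0_right order_refl zero_less_norm_iff)
  have growth: "norm (?x t) \<le> exp (K * t) * norm (?x 0)" "norm (?x 0) \<le> exp (K * t) * norm (?x t)" if "0 \<le> t" for t
    using linear_ode_growth[OF fundamental_matrix_solution[OF X] K, of 0 t c]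
      linear_ode_growth[OF fundamental_matrix_solution[OF X] K, of t 0 c] that by auto
  have "lyapunov_exponent (solution_of X c) \<le> ereal K"
    unfolding lyapunov_exponent_solution_of_le_iff
  proof (intro allI impI)
    fix r assume "K < r"
    then have "\<forall>\<^sub>F t in at_top. norm (?x 0) \<le> exp ((r - K) * t)" by (intro eventually_const_le_exp) simp
    then show "\<forall>\<^sub>F t in at_top. norm (?x t) \<le> exp (r * t)"
      using eventually_ge_at_top[of 0]
    proof eventually_elim
      case (elim t)
      have "norm (?x t) \<le> exp (K * t) * exp ((r - K) * t)"
        using growth(1)[of t] elim by (meson exp_ge_zero mult_left_mono order_trans)
      then show ?case by (simp add: exp_add[symmetric] algebra_simps)
    qed
  qed
  \<comment> \<open>An exponent of at most -K - 2 would allow the rate -K - 1. Against a decay no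
    faster than exp(-Kt) this leaves a factor exp(-t), which tends to 0.\<close>
  moreover have "\<not> lyapunov_exponent (solution_of X c) \<le> ereal (- K - 2)"
  proof
    assume "lyapunov_exponent (solution_of X c) \<le> ereal (- K - 2)"
    then have "\<forall>\<^sub>F t in at_top. norm (?x t) \<le> exp ((- K - 1) * t)"
      unfolding lyapunov_exponent_solution_of_le_iff by simp
    moreover have "\<forall>\<^sub>F t in at_top. 2 / norm (?x 0) \<le> exp (1 * t)" by (intro eventually_const_le_exp) simp
    ultimately have "\<forall>\<^sub>F t::real in at_top. False"
      using eventually_ge_at_top[of 0]
    proof eventually_elim
      case (elim t)
      have "norm (?x 0) \<le> exp (K * t) * exp ((- K - 1) * t)"
        using growth(2)[of t] elim by (meson exp_ge_zero mult_left_mono order_trans)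
      also have "\<dots> = 1 / exp t" by (simp add: exp_add[symmetric] exp_minus[symmetric] algebra_simps divide_inverse)
      finally have "norm (?x 0) * exp t \<le> 1" by (simp add: field_simps)
      moreover have "2 \<le> norm (?x 0) * exp t" using elim(2) pos by (simp add: field_simps)
      ultimately show ?case by simp
    qed
    then show False by simp
  qed
  ultimately show ?thesis by (cases "lyapunov_exponent (solution_of X c)") auto
qed

lemma nontrivial_solutions:
  assumes X: "fundamental_matrix A X" and K: "\<And>t. 0 \<le> t \<Longrightarrow> op_norm (A t) \<le> K"
  shows "solutions A - {0} = solution_of X ` (UNIV - {0})"
  using image_set_diff[OF solution_of_inj[OF X], of UNIV "{0}"]
  by (simp add: solutions_eq[OF X K] solution_of_0)

text \<open>
  The subspaces \<open>{c. \<chi>[X c] \<le> v}\<close> have different dimensions for different exponents \<open>v\<close>. Finiteness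
  matters because \<^const>\<open>sorted_list_of_set\<close> of an infinite set is empty.
\<close>

lemma finite_lyapunov_exponents:
  fixes A X :: "real \<Rightarrow> real^'n^'n"
  assumes X: "fundamental_matrix A X" and K: "\<And>t. 0 \<le> t \<Longrightarrow> op_norm (A t) \<le> K"
  shows "finite (lyapunov_exponent ` (solutions A - {0}))"
proof -
  let ?\<chi> = "\<lambda>c. lyapunov_exponent (solution_of X c)"
  have "?\<chi> ` (UNIV - {0}) = lyapunov_exponent ` (solutions A - {0})"
    by (simp add: nontrivial_solutions[OF X K] image_image)
  moreover have "finite (?\<chi> ` (UNIV - {0}))"
  proof (rule inj_on_finite)
    let ?U = "\<lambda>v. {c. ?\<chi> c \<le> v}"
    have less: "dim (?U v) < dim (?U w)" if vw: "v \<in> ?\<chi> ` (UNIV - {0})" "w \<in> ?\<chi> ` (UNIV - {0})" "v < w" for v w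
    proof -
      obtain c d where c: "v = ?\<chi> c" "c \<noteq> 0" and d: "w = ?\<chi> d" "d \<noteq> 0" using vw by blast
      obtain a where a: "v = ereal a" using lyapunov_exponent_finite[OF X K c(2)] c(1) by auto
      obtain b where b: "w = ereal b" using lyapunov_exponent_finite[OF X K d(2)] d(1) by auto
      have "d \<in> ?U w" "d \<notin> ?U v" using vw(3) d(1) by auto
      moreover have "?U v \<subseteq> ?U w" using vw(3) by auto
      ultimately have "?U v \<subset> ?U w" by blast
      then show ?thesis
        unfolding a b using subspace_lyapunov_exponent_le[of X]
        by (intro dim_psubset) (metis span_eq_iff)
    qed
    show "inj_on (\<lambda>v. dim (?U v)) (?\<chi> ` (UNIV - {0}))"
      by (rule linorder_inj_onI') (use less in \<open>metis less_irrefl\<close>)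
    show "(\<lambda>v. dim (?U v)) ` ?\<chi> ` (UNIV - {0}) \<subseteq> {..CARD('n)}"
      using dim_subset_UNIV_cart by auto
  qed simp
  ultimately show ?thesis by simp
qed

section \<open>Bases adapted to the Lyapunov filtration\<close>

text \<open>The basis grows from the smallest space of the filtration to the largest; each extension
  adds as many vectors as the multiplicity says. Upper bounds on their exponents are all that is
  required.\<close>

lemma lyapunov_adapted_basis_list:
  fixes A X :: "real \<Rightarrow> real^'n^'n"
  assumes X: "fundamental_matrix A X" and K: "\<And>t. 0 \<le> t \<Longrightarrow> op_norm (A t) \<le> K"
  shows "\<exists>bs ls. distinct bs \<and> independent (set bs) \<and> length bs = CARD('n) \<and> sorted_wrt (\<ge>) ls \<and>
     list_all2 (\<lambda>b a. lyapunov_exponent (solution_of X b) \<le> ereal a) bs ls \<and>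
     (\<forall>k. 1 \<le> k \<longrightarrow> k \<le> CARD('n) \<longrightarrow> Lyap A k = ereal (ls ! (k - 1)))"
proof -
  let ?\<chi> = "\<lambda>c. lyapunov_exponent (solution_of X c)"
  define T where "T = lyapunov_exponent ` (solutions A - {0})"
  have T_eq: "T = ?\<chi> ` (UNIV - {0})"
    by (simp add: T_def nontrivial_solutions[OF X K] image_image)
  have fin: "finite T" unfolding T_def by (rule finite_lyapunov_exponents[OF X K])
  define vs where "vs = lyapunov_values A"
  define q where "q = length vs"
  have vs: "set vs = T" "sorted_wrt (\<ge>) vs"
    using fin by (simp_all add: vs_def lyapunov_values_def T_def sorted_wrt_rev)
  have real: "\<exists>a. v = ereal a" if "v \<in> T" for v
    using that lyapunov_exponent_finite[OF X K] unfolding T_eq by auto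
  \<comment> \<open>The filtration in coordinates, with the zero space after the last value.\<close>
  define W where "W i = (if i \<le> q then {c. ?\<chi> c \<le> vs ! (i - 1)} else {0})" for i
  have nth_T: "vs ! (i - 1) \<in> T" if "1 \<le> i" "i \<le> q" for i
    using that vs(1) nth_mem[of "i - 1" vs] by (simp add: q_def)
  have sub: "subspace (W i)" if i: "1 \<le> i" for i
  proof (cases "i \<le> q")
    case True
    obtain a where "vs ! (i - 1) = ereal a" using real nth_T[OF i True] by blast
    then show ?thesis using subspace_lyapunov_exponent_le[of X a] True by (simp add: W_def)
  qed (simp add: W_def)
  have space: "lyapunov_space A i = solution_of X ` W i" for i
    by (auto simp: lyapunov_space_def W_def vs_def[symmetric] q_def[symmetric] solutions_eq[OF X K] solution_of_0)
  have mult: "lyapunov_mult A i = dim (W i) - dim (W (Suc i))" for i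
    by (simp add: lyapunov_mult_def space solution_dim_image[OF X])
  have exp0: "?\<chi> 0 = -\<infinity>"
    by (simp add: lyapunov_exponent_def solution_of_0 Limsup_const)
  have mono: "W (Suc i) \<subseteq> W i" if "1 \<le> i" for i
  proof (cases "Suc i \<le> q")
    case True
    then have "vs ! i \<le> vs ! (i - 1)"
      using sorted_wrt_nth_less[OF vs(2), of "i - 1" i] that by (simp add: q_def)
    then show ?thesis using True by (auto simp: W_def)
  next
    case False
    then show ?thesis using exp0 by (auto simp: W_def)
  qed
  \<comment> \<open>A nonzero vector exists, so there is at least one exponent, and the first list
    entry is the largest.\<close>
  have top: "W 1 = UNIV"
  proof -
    have "(axis undefined 1 :: real^'n) \<noteq> 0" by simp
    then have "T \<noteq> {}" unfolding T_eq by blast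
    then have q: "1 \<le> q" using vs(1) by (cases vs) (auto simp: q_def)
    have "?\<chi> c \<le> vs ! 0" for c
    proof (cases "c = 0")
      case False
      then have "?\<chi> c \<in> set vs" using vs(1) T_eq by auto
      then obtain i where "i < q" "vs ! i = ?\<chi> c" by (auto simp: in_set_conv_nth q_def)
      then show ?thesis
        using sorted_wrt_nth_less[OF vs(2), of 0 i] by (cases "i = 0") (auto simp: q_def)
    qed (simp add: exp0)
    then show ?thesis using q by (auto simp: W_def)
  qed
  \<comment> \<open>The last \<open>k\<close> blocks of the list that defines \<open>Lyap\<close>;
    the induction prepends one block at a time.\<close>
  let ?blocks = "\<lambda>k. concat (map (\<lambda>j. replicate (lyapunov_mult A j) (vs ! (j - 1))) [Suc q - k..<Suc q])"
  have "\<exists>bs. distinct bs \<and> independent (set bs) \<and> set bs \<subseteq> W (Suc q - k) \<and> length bs = dim (W (Suc q - k)) \<and>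
      list_all2 (\<lambda>b v. ?\<chi> b \<le> v) bs (?blocks k)" if "k \<le> q" for k
    using that
  proof (induction k)
    case 0
    then show ?case by (intro exI[of _ "[]"]) (auto simp: W_def independent_empty)
  next
    case (Suc k)
    define i where "i = Suc q - Suc k"
    have i: "Suc q - k = Suc i" "1 \<le> i" "i \<le> q" using Suc.prems by (auto simp: i_def)
    obtain bs where bs: "distinct bs" "independent (set bs)" "set bs \<subseteq> W (Suc i)" "length bs = dim (W (Suc i))"
      "list_all2 (\<lambda>b v. ?\<chi> b \<le> v) bs (?blocks k)"
      using Suc i by auto
    have "set bs \<subseteq> W i" using bs(3) mono[OF i(2)] by blast
    from maximal_independent_subset_extend[OF this bs(2)] obtain C where
      C: "set bs \<subseteq> C" "C \<subseteq> W i" "independent C" "W i \<subseteq> span C" by blast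
    have finC: "finite C" using C(3) by (rule independent_imp_finite)
    have "span C = W i" using C(2,4) sub[OF i(2)] by (metis span_minimal subset_antisym)
    then have cardC: "card C = dim (W i)" using C(3) by (metis dim_span_eq_card_independent dim_span)
    obtain cs where cs: "set cs = C - set bs" "distinct cs"
      using finite_distinct_list[of "C - set bs"] finC by blast
    have "length cs = card C - card (set bs)"
      using cs distinct_card[OF cs(2)] C(1) by (simp add: card_Diff_subset)
    then have len: "length cs = lyapunov_mult A i"
      using cardC bs(4) distinct_card[OF bs(1)] by (simp add: mult)
    have "list_all2 (\<lambda>b v. ?\<chi> b \<le> v) cs (replicate (lyapunov_mult A i) (vs ! (i - 1)))"
      using len cs(1) C(2) i by (auto simp: list_all2_conv_all_nth W_def)
    moreover have "[Suc q - Suc k..<Suc q] = i # [Suc q - k..<Suc q]"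
      using upt_conv_Cons[of i "Suc q"] i unfolding i_def[symmetric] by simp
    then have "?blocks (Suc k) = replicate (lyapunov_mult A i) (vs ! (i - 1)) @ ?blocks k"
      by (simp only: list.map concat.simps)
    ultimately have "list_all2 (\<lambda>b v. ?\<chi> b \<le> v) (cs @ bs) (?blocks (Suc k))"
      using bs(5) by (simp only: list_all2_appendI)
    moreover have "set (cs @ bs) = C" using cs(1) C(1) by auto
    moreover have "distinct (cs @ bs)" using cs bs(1) by auto
    ultimately show ?case
      using C(2,3) cardC distinct_card[of "cs @ bs"] unfolding i_def[symmetric]
      by (intro exI[of _ "cs @ bs"]) auto
  qed
  from this[OF order_refl] obtain bs where bs: "distinct bs" "independent (set bs)" "length bs = CARD('n)"
    "list_all2 (\<lambda>b v. ?\<chi> b \<le> v) bs (?blocks q)"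
    using top by auto
  have blocks: "?blocks q = concat (map (\<lambda>j. replicate (lyapunov_mult A j) (vs ! (j - 1))) [1..<Suc q])" by simp
  have len: "length (?blocks q) = CARD('n)" using bs(3,4) list_all2_lengthD by metis
  have mem: "v \<in> T" if "v \<in> set (?blocks q)" for v
    using that nth_T by (auto split: if_splits)
  \<comment> \<open>All exponents of nontrivial solutions are finite, so the conversion to reals
    loses nothing.\<close>
  define ls where "ls = map real_of_ereal (?blocks q)"
  have ls: "ereal (ls ! k) = ?blocks q ! k" if "k < CARD('n)" for k
    using real[OF mem[OF nth_mem[of k "?blocks q"]]] len that by (auto simp: ls_def)
  have "map (\<lambda>j. vs ! (j - 1)) [1..<Suc q] = vs"
    by (rule nth_equalityI) (simp_all add: q_def del: upt_Suc)
  then have "sorted_wrt (\<ge>) (map (\<lambda>j. vs ! (j - 1)) [1..<Suc q])"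
    using vs(2) by simp
  then have "sorted_wrt (\<ge>) (?blocks q)"
    unfolding blocks by (rule sorted_wrt_concat_replicate)
  then have "sorted_wrt (\<ge>) ls"
    unfolding sorted_wrt_iff_nth_less
    using ls len by (metis (no_types, lifting) ereal_less_eq(3) length_map ls_def order.strict_trans)
  moreover have "list_all2 (\<lambda>b a. ?\<chi> b \<le> ereal a) bs ls"
    using bs(4) ls len by (auto simp: list_all2_conv_all_nth ls_def)
  moreover have "Lyap A k = ereal (ls ! (k - 1))" if "1 \<le> k" "k \<le> CARD('n)" for k
    using ls[of "k - 1"] that unfolding Lyap_def blocks vs_def q_def by simp
  ultimately show ?thesis using bs by blast
qed

lemma lyapunov_adapted_basis:
  fixes A X :: "real \<Rightarrow> 'n::{finite,wellorder} square"
  assumes X: "fundamental_matrix A X" and K: "\<And>t. 0 \<le> t \<Longrightarrow> op_norm (A t) \<le> K"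
  shows "\<exists>(B :: 'n square) (\<Lambda> :: 'n \<Rightarrow> real). invertible B \<and> (\<forall>i j. i \<le> j \<longrightarrow> \<Lambda> j \<le> \<Lambda> i) \<and>
     (\<forall>k. 1 \<le> k \<longrightarrow> k \<le> CARD('n) \<longrightarrow> Lyap A k = ereal (\<Lambda> (nth_index k))) \<and>
     (\<forall>i. \<forall>r>\<Lambda> i. \<forall>\<^sub>F t in at_top. norm (X t *v column i B) \<le> exp (r * t))"
proof -
  obtain bs ls where bs: "distinct bs" "independent (set bs)" "length bs = CARD('n)" "sorted_wrt (\<ge>) ls"
    "list_all2 (\<lambda>b a. lyapunov_exponent (solution_of X b) \<le> ereal a) bs ls"
    "\<And>k. 1 \<le> k \<Longrightarrow> k \<le> CARD('n) \<Longrightarrow> Lyap A k = ereal (ls ! (k - 1))"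
    using lyapunov_adapted_basis_list[OF X K] by blast
  define r where "r i = index_rank i - 1" for i :: 'n
  have r: "r i < CARD('n)" for i
    unfolding r_def using index_rank_bounds[of i] by linarith
  have r_mono: "r i < r j" if "i < j" for i j
    unfolding r_def using index_rank_mono[OF that] index_rank_bounds[of i] by linarith
  define B where "B = (\<chi> i j. bs ! r j $ i)"
  have col: "column j B = bs ! r j" for j by (simp add: B_def column_def)
  have len: "length ls = CARD('n)" using list_all2_lengthD[OF bs(5)] bs(3) by simp
  have "set bs \<subseteq> columns B"
  proof
    fix b assume "b \<in> set bs"
    then obtain k where k: "k < CARD('n)" "b = bs ! k" by (auto simp: in_set_conv_nth bs(3))
    then have "column (nth_index (Suc k)) B = b" by (simp add: col r_def index_rank_nth_index)
    then show "b \<in> columns B" by (auto simp: columns_def)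
  qed
  moreover have "UNIV \<subseteq> span (set bs)"
    using bs(2) distinct_card[OF bs(1)] bs(3) by (intro card_ge_dim_independent) auto
  ultimately have "span (columns B) = UNIV" using span_mono by blast
  then have "invertible B"
    using matrix_right_invertible_span_columns[of B] by (simp add: invertible_right_inverse span_vec_eq)
  moreover have "ls ! r j \<le> ls ! r i" if "i \<le> j" for i j
  proof (cases "i = j")
    case False
    then have "r i < r j" using that r_mono by simp
    then show ?thesis using sorted_wrt_nth_less[OF bs(4)] r len by simp
  qed simp
  moreover have "Lyap A k = ereal (ls ! r (nth_index k :: 'n))" if "1 \<le> k" "k \<le> CARD('n)" for k
    using bs(6) that by (simp add: r_def index_rank_nth_index)
  moreover have "\<forall>\<^sub>F t in at_top. norm (X t *v column i B) \<le> exp (s * t)" if "ls ! r i < s" for i s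
  proof -
    have "lyapunov_exponent (solution_of X (bs ! r i)) \<le> ereal (ls ! r i)"
      using list_all2_nthD[OF bs(5), of "r i"] r bs(3) by simp
    then show ?thesis using that unfolding lyapunov_exponent_solution_of_le_iff col by blast
  qed
  ultimately show ?thesis by (intro exI[of _ B] exI[of _ "\<lambda>i. ls ! r i"]) auto
qed

text \<open>
  Upper bound: Hadamard's inequality for an adapted basis. Lower bound: the diagonal entries of a
  QR-decomposition beyond the first \<open>L\<close> grow at most with rates \<open>\<Lambda>\<^sub>i\<close>, while regularity prescribes
  the growth of the full determinant.
\<close>

lemma ext_pow_growth:
  fixes A X :: "real \<Rightarrow> 'n::{finite,wellorder} square"
  assumes X: "fundamental_matrix A X" and K: "\<And>t. 0 \<le> t \<Longrightarrow> op_norm (A t) \<le> K"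
    and reg: "regular_system A X" and L: "L \<le> CARD('n)"
  shows "\<exists>\<sigma>. (\<Sum>i=1..L. Lyap A i) = ereal \<sigma> \<and> (\<forall>\<epsilon>>0. \<forall>\<^sub>F t in at_top.
     exp ((\<sigma> - \<epsilon>) * t) \<le> op_norm (ext_pow (first_indices L) (X t)) \<and>
     op_norm (ext_pow (first_indices L) (X t)) \<le> exp ((\<sigma> + \<epsilon>) * t))"
proof -
  let ?S = "first_indices L :: 'n set"
  let ?N = "\<lambda>M :: 'n square. op_norm (ext_pow ?S M)"
  obtain B \<Lambda> where basis: "invertible B" "\<forall>i j :: 'n. i \<le> j \<longrightarrow> \<Lambda> j \<le> (\<Lambda> i :: real)"
    "\<forall>k. 1 \<le> k \<longrightarrow> k \<le> CARD('n) \<longrightarrow> Lyap A k = ereal (\<Lambda> (nth_index k :: 'n))"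
    "\<forall>i. \<forall>r>\<Lambda> i. \<forall>\<^sub>F t in at_top. norm (X t *v column i B) \<le> exp (r * t)"
    by (rule exE[OF lyapunov_adapted_basis[OF X K]], assumption, elim exE conjE, rule that)
  note B = basis(1)
  have anti: "\<Lambda> j \<le> \<Lambda> i" if "i \<le> j" for i j
    using basis(2) that by blast
  have Lyap: "Lyap A k = ereal (\<Lambda> (nth_index k :: 'n))" if "1 \<le> k" "k \<le> CARD('n)" for k
    using basis(3) that by blast
  have col: "\<forall>\<^sub>F t in at_top. norm (X t *v column i B) \<le> exp (r * t)" if "\<Lambda> i < r" for i r
    using basis(4) that by blast
  define \<sigma> where "\<sigma> = (\<Sum>i\<in>?S. \<Lambda> i)"
  have Lyap_sum: "(\<Sum>k=1..M. Lyap A k) = ereal (\<Sum>i\<in>first_indices M. \<Lambda> i)" if "M \<le> CARD('n)" for M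
    using that by (simp add: sum_first_indices Lyap)
  have col_eq: "column i (X t ** B) = X t *v column i B" for i t
    by (simp add: column_def matrix_matrix_mult_def matrix_vector_mult_def)
  have card_S: "card ?S \<le> CARD('n)" by (rule card_mono) auto
  have "\<forall>\<^sub>F t in at_top. exp ((\<sigma> - \<epsilon>) * t) \<le> ?N (X t) \<and> ?N (X t) \<le> exp ((\<sigma> + \<epsilon>) * t)" if "0 < \<epsilon>" for \<epsilon>
  proof -
    \<comment> \<open>The lower bound spends \<open>\<delta>\<close> once on the determinant, once
      on a constant factor and at most d times on the columns; the upper bound spends it at most d +
      1 times.\<close>
    define \<delta> where "\<delta> = \<epsilon> / (CARD('n) + 2)"
    have \<delta>: "0 < \<delta>" using that by (simp add: \<delta>_def)
    have \<epsilon>: "\<epsilon> = (CARD('n) + 2) * \<delta>" by (simp add: \<delta>_def add_pos_nonneg)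
    have cols: "\<forall>\<^sub>F t in at_top. \<forall>i. norm (X t *v column i B) \<le> exp ((\<Lambda> i + \<delta>) * t)"
      using \<delta> by (intro eventually_all_finite col) simp
    define c where "c = real CARD('n \<Rightarrow> 'n) * real CARD('n \<Rightarrow> 'n)"
    define b where "b = c * ?N (matrix_inv B)"
    have upper: "\<forall>\<^sub>F t in at_top. ?N (X t) \<le> exp ((\<sigma> + \<epsilon>) * t)"
      using cols eventually_const_le_exp[OF \<delta>, of b] eventually_ge_at_top[of 0]
    proof eventually_elim
      case (elim t)
      define E where "E = exp ((\<sigma> + CARD('n) * \<delta>) * t)"
      have "?N (X t ** B) \<le> c * E"
        unfolding c_def
      proof (rule onorm_ext_pow_le)
        fix g :: "'n \<Rightarrow> 'n" assume g: "inj_on g ?S"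
        have "(\<Prod>i\<in>?S. norm (column (g i) (X t ** B))) \<le> (\<Prod>i\<in>?S. exp ((\<Lambda> (g i) + \<delta>) * t))"
          using elim(1) by (intro prod_mono) (simp add: col_eq)
        also have "\<dots> = exp (\<Sum>i\<in>?S. (\<Lambda> (g i) + \<delta>) * t)"
          by (simp add: exp_sum)
        also have "(\<Sum>i\<in>?S. (\<Lambda> (g i) + \<delta>) * t) = ((\<Sum>i\<in>g ` ?S. \<Lambda> i) + card ?S * \<delta>) * t"
          using g by (simp add: sum_distrib_right[symmetric] sum.distrib sum.reindex)
        also have "\<dots> \<le> (\<sigma> + CARD('n) * \<delta>) * t"
        proof (intro mult_right_mono add_mono)
          show "(\<Sum>i\<in>g ` ?S. \<Lambda> i) \<le> \<sigma>"
            unfolding \<sigma>_def using first_indices_down[OF L] g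
            by (intro sum_le_initial_segment anti) (auto simp: card_image)
        qed (use elim \<delta> card_S in auto)
        finally show "(\<Prod>i\<in>?S. norm (column (g i) (X t ** B))) \<le> E" by (simp add: E_def)
      qed (simp add: E_def)
      then have "?N (X t ** B) * ?N (matrix_inv B) \<le> c * E * ?N (matrix_inv B)"
        by (rule mult_right_mono) simp
      moreover have "?N (X t) \<le> ?N (X t ** B) * ?N (matrix_inv B)"
      proof -
        have "X t ** B ** matrix_inv B = X t" by (simp add: matrix_mul_assoc[symmetric] matrix_mul_inv[OF B])
        then have "ext_pow ?S (X t) = ext_pow ?S (X t ** B) ** ext_pow ?S (matrix_inv B)"
          by (simp add: ext_pow_mul[symmetric])
        then show ?thesis by (simp only: op_norm_mul_le)
      qed
      ultimately have "?N (X t) \<le> b * E" by (simp add: b_def algebra_simps)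
      also have "\<dots> \<le> exp (\<delta> * t) * E" using elim(2) by (intro mult_right_mono) (auto simp: E_def)
      also have "\<dots> \<le> exp ((\<sigma> + \<epsilon>) * t)"
        using elim(3) \<delta> by (simp add: E_def \<epsilon> exp_add[symmetric] algebra_simps)
      finally show ?case .
    qed
    obtain \<alpha> where \<alpha>: "0 < \<alpha>" "\<And>Q :: 'n square. orthogonal_matrix Q \<Longrightarrow> \<alpha> \<le> norm (wedge ?S Q)"
      using norm_wedge_orthogonal[of ?S] by blast
    define w where "w = norm (wedge ?S B)"
    have det_B: "0 < \<bar>det B\<bar>" using B by (simp add: invertible_det_nz)
    \<comment> \<open>Regularity enters here: it bounds the determinant from below at the rate of
      the sum of all exponents.\<close>
    have "(\<Sum>k=1..CARD('n). Lyap A k) = Liminf at_top (\<lambda>t. ereal (1 / t * ln \<bar>det (X t)\<bar>))"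
      using reg by (simp add: regular_system_def)
    then have "ereal (sum \<Lambda> UNIV) \<le> Liminf at_top (\<lambda>t. ereal (1 / t * ln \<bar>det (X t)\<bar>))"
      using Lyap_sum[of "CARD('n)"] by (simp add: first_indices_full)
    moreover have "ereal (sum \<Lambda> UNIV - \<delta>) < ereal (sum \<Lambda> UNIV)" using \<delta> by simp
    ultimately have "\<forall>\<^sub>F t in at_top. ereal (sum \<Lambda> UNIV - \<delta>) < ereal (1 / t * ln \<bar>det (X t)\<bar>)"
      unfolding le_Liminf_iff by blast
    then have lower: "\<forall>\<^sub>F t in at_top. exp ((\<sigma> - \<epsilon>) * t) \<le> ?N (X t)"
      using cols eventually_const_le_exp[OF \<delta>, of "w / (\<alpha> * \<bar>det B\<bar>)"] eventually_gt_at_top[of 0]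
    proof eventually_elim
      case (elim t)
      have Xt: "invertible (X t)" using X elim(4) by (simp add: fundamental_matrix_def)
      then have det_X: "0 < \<bar>det (X t)\<bar>" by (simp add: invertible_det_nz)
      have "(sum \<Lambda> UNIV - \<delta>) * t \<le> ln \<bar>det (X t)\<bar>" using elim(1,4) by (simp add: field_simps)
      then have D: "exp ((sum \<Lambda> UNIV - \<delta>) * t) \<le> \<bar>det (X t)\<bar>" using det_X by (simp add: ln_ge_iff)
      have "invertible (X t ** B)" using Xt B by (rule invertible_mult)
      from is_qr_exists[OF this] obtain Q R where qr: "is_qr (X t ** B) Q R" by blast
      then have Q: "orthogonal_matrix Q" and eq: "X t ** B = Q ** R" and R0: "\<And>i j. j < i \<Longrightarrow> R $ i $ j = 0"
        and Rpos: "\<And>i. 0 < R $ i $ i" by (auto simp: is_qr_def)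
      have "\<bar>det (X t)\<bar> * \<bar>det B\<bar> = \<bar>det Q\<bar> * \<bar>det R\<bar>"
        using arg_cong[OF eq, of det] by (simp add: det_mul abs_mult[symmetric])
      also have "\<bar>det Q\<bar> = 1" using det_orthogonal_matrix[OF Q] by auto
      also have "det R = (\<Prod>i\<in>UNIV. R $ i $ i)" by (rule det_upperdiagonal) (simp add: R0)
      also have "\<dots> = (\<Prod>i\<in>?S. R $ i $ i) * (\<Prod>i\<in>-?S. R $ i $ i)"
        by (subst prod.union_disjoint[symmetric]) (auto intro: prod.cong)
      finally have det_eq: "\<bar>det (X t)\<bar> * \<bar>det B\<bar> = (\<Prod>i\<in>?S. R $ i $ i) * (\<Prod>i\<in>-?S. R $ i $ i)"
        by (simp add: abs_mult abs_prod abs_of_pos[OF Rpos])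
      have "(\<Prod>i\<in>-?S. R $ i $ i) \<le> (\<Prod>i\<in>-?S. exp ((\<Lambda> i + \<delta>) * t))"
      proof (rule prod_mono)
        fix i
        have "R $ i $ i \<le> norm (X t *v column i B)" using is_qr_diag_le_column[OF qr, of i] by (simp add: col_eq)
        then show "0 \<le> R $ i $ i \<and> R $ i $ i \<le> exp ((\<Lambda> i + \<delta>) * t)"
          using elim(2) Rpos[of i] by (meson less_imp_le order_trans)
      qed
      also have "\<dots> = exp (\<Sum>i\<in>-?S. (\<Lambda> i + \<delta>) * t)" by (simp add: exp_sum)
      also have "(\<Sum>i\<in>-?S. (\<Lambda> i + \<delta>) * t) = (sum \<Lambda> (-?S) + card (-?S) * \<delta>) * t"
        by (simp add: sum_distrib_right[symmetric] sum.distrib)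
      also have "exp \<dots> \<le> exp ((sum \<Lambda> (-?S) + CARD('n) * \<delta>) * t)"
        using elim(4) \<delta> card_mono[of "UNIV :: 'n set" "-?S"] by (auto intro!: mult_right_mono)
      finally have off: "(\<Prod>i\<in>-?S. R $ i $ i) \<le> exp ((sum \<Lambda> (-?S) + CARD('n) * \<delta>) * t)" .
      \<comment> \<open>The product over the first L diagonal entries is, up to a bounded factor,
        the size of the image of the fixed wedge of \<open>B\<close>, hence controlled by the norm
        of the exterior power.\<close>
      have "(\<Prod>i\<in>?S. R $ i $ i) * \<alpha> \<le> (\<Prod>i\<in>?S. R $ i $ i) * norm (wedge ?S Q)"
        by (intro mult_left_mono \<alpha> Q prod_nonneg) (simp add: less_imp_le[OF Rpos])
      also have "\<dots> = norm (wedge ?S (X t ** B))"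
        unfolding eq
        by (subst wedge_mult_upper_triangular)
           (use first_indices_down[OF L] in \<open>auto simp: R0 abs_prod abs_of_pos[OF Rpos]\<close>)
      also have "\<dots> \<le> ?N (X t) * w"
        unfolding w_def ext_pow_wedge[symmetric] by (rule norm_matrix_vector_le)
      finally have on: "(\<Prod>i\<in>?S. R $ i $ i) \<le> ?N (X t) * w / \<alpha>" using \<alpha>(1) by (simp add: field_simps)
      have "exp ((sum \<Lambda> UNIV - \<delta>) * t) * \<bar>det B\<bar> \<le> \<bar>det (X t)\<bar> * \<bar>det B\<bar>"
        using D by (rule mult_right_mono) simp
      also have "\<dots> \<le> (?N (X t) * w / \<alpha>) * exp ((sum \<Lambda> (-?S) + CARD('n) * \<delta>) * t)"
        unfolding det_eq using less_imp_le[OF Rpos] less_imp_le[OF \<alpha>(1)]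
        by (intro mult_mono on off prod_nonneg divide_nonneg_nonneg mult_nonneg_nonneg) (auto simp: w_def)
      finally have "exp ((sum \<Lambda> UNIV - \<delta>) * t) \<le> ?N (X t) * (w / (\<alpha> * \<bar>det B\<bar>)) * exp ((sum \<Lambda> (-?S) + CARD('n) * \<delta>) * t)"
        using det_B \<alpha>(1) by (simp add: field_simps)
      also have "\<dots> \<le> ?N (X t) * exp (\<delta> * t) * exp ((sum \<Lambda> (-?S) + CARD('n) * \<delta>) * t)"
        using elim(3) by (intro mult_right_mono mult_left_mono) auto
      finally have "exp ((sum \<Lambda> UNIV - \<delta>) * t) \<le> ?N (X t) * exp ((sum \<Lambda> (-?S) + (CARD('n) + 1) * \<delta>) * t)"
        by (simp add: mult.assoc exp_add[symmetric] distrib_right add.commute)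
          (simp add: algebra_simps)
      moreover have "sum \<Lambda> UNIV = \<sigma> + sum \<Lambda> (-?S)"
        unfolding \<sigma>_def by (subst sum.union_disjoint[symmetric]) (auto intro: sum.cong)
      moreover have "u \<le> v * exp b \<Longrightarrow> u * exp (- b) \<le> v" for u v b :: real
        by (simp add: exp_minus field_simps)
      ultimately have "exp ((\<sigma> + sum \<Lambda> (-?S) - \<delta>) * t) * exp (- ((sum \<Lambda> (-?S) + (CARD('n) + 1) * \<delta>) * t)) \<le> ?N (X t)"
        by simp
      then show ?case by (simp add: exp_add[symmetric] \<epsilon> algebra_simps)
    qed
    show ?thesis using lower upper by eventually_elim simp
  qed
  then show ?thesis using Lyap_sum[OF L] by (intro exI[of _ \<sigma>]) (auto simp: \<sigma>_def)
qed

section \<open>Consequences of strong fast invertibility\<close>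

lemma op_norm_ext_pow_mul:
  "op_norm (ext_pow S (M ** N)) \<le> op_norm (ext_pow S M) * op_norm (ext_pow S (N :: real^'n^'n))"
  by (simp only: ext_pow_mul op_norm_mul_le)

lemma strongly_fast_invertible_ext_pow:
  fixes X :: "real \<Rightarrow> 'n::{finite,wellorder} square"
  assumes inv: "\<And>t. 0 \<le> t \<Longrightarrow> invertible (X t)" and sfi: "strongly_fast_invertible L X" and L: "L \<le> CARD('n)"
  shows "\<exists>C>0. \<forall>t s \<tau>. s \<le> t \<longrightarrow> \<tau> \<le> s \<longrightarrow> 0 \<le> \<tau> \<longrightarrow>
     op_norm (ext_pow (first_indices L) (cauchy_matrix X t s)) * op_norm (ext_pow (first_indices L) (cauchy_matrix X s \<tau>))
       \<le> C * op_norm (ext_pow (first_indices L) (cauchy_matrix X t \<tau>))"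
proof -
  let ?N = "\<lambda>M :: 'n square. op_norm (ext_pow (first_indices L) M)"
  let ?P = "\<lambda>M :: 'n square. \<Prod>k=1..L. singular_value k M"
  obtain a b where ab: "0 < a" "0 < b" and P_pos: "\<And>M. invertible M \<Longrightarrow> 0 < ?P M"
    and lower: "\<And>M. invertible M \<Longrightarrow> a * ?P M \<le> ?N M" and upper: "\<And>M. invertible M \<Longrightarrow> ?N M \<le> b * ?P M"
    using op_norm_ext_pow_singular_values[OF L] by blast
  obtain B where B: "\<And>t s \<tau>. s \<le> t \<Longrightarrow> \<tau> \<le> s \<Longrightarrow> 0 \<le> \<tau> \<Longrightarrow>
     (\<Prod>k=1..L. singular_value k (cauchy_matrix X t s) * singular_value k (cauchy_matrix X s \<tau>) /
        singular_value k (cauchy_matrix X t \<tau>)) \<le> B"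
    using sfi unfolding strongly_fast_invertible_def bdd_above_def by blast
  show ?thesis
  \<comment> \<open>\<open>B\<close> is an arbitrary real upper bound; the absolute value and the
    added 1 make the constant positive.\<close>
  proof (rule exI[of _ "b * b * \<bar>B\<bar> / a + 1"], intro conjI allI impI)
    show "0 < b * b * \<bar>B\<bar> / a + 1" using ab by (simp add: add_nonneg_pos)
    fix t s \<tau> :: real assume ts: "s \<le> t" "\<tau> \<le> s" "0 \<le> \<tau>"
    define M1 M2 M3 where "M1 = cauchy_matrix X t s" and "M2 = cauchy_matrix X s \<tau>" and "M3 = cauchy_matrix X t \<tau>"
    have inv: "invertible M1" "invertible M2" "invertible M3"
      using ts by (auto simp: M1_def M2_def M3_def intro!: invertible_cauchy_matrix inv)
    have "?P M1 * ?P M2 / ?P M3 \<le> \<bar>B\<bar>"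
      using B[OF ts] by (simp add: prod.distrib prod_dividef M1_def M2_def M3_def)
    then have PP: "?P M1 * ?P M2 \<le> \<bar>B\<bar> * ?P M3" using P_pos[OF inv(3)] by (simp add: pos_divide_le_eq)
    have "?N M1 * ?N M2 \<le> (b * ?P M1) * (b * ?P M2)"
      using upper[OF inv(1)] upper[OF inv(2)] ab P_pos[OF inv(1)] by (intro mult_mono) auto
    also have "\<dots> = b * b * (?P M1 * ?P M2)" by (simp only: mult_ac)
    also have "\<dots> \<le> b * b * (\<bar>B\<bar> * ?P M3)" using PP ab by (intro mult_left_mono) auto
    also have "\<dots> = b * b * \<bar>B\<bar> / a * (a * ?P M3)" using ab by (simp only: mult_ac times_divide_eq_right) simp
    also have "\<dots> \<le> b * b * \<bar>B\<bar> / a * ?N M3" using lower[OF inv(3)] ab by (intro mult_left_mono) auto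
    also have "\<dots> \<le> (b * b * \<bar>B\<bar> / a + 1) * ?N M3" by (simp add: algebra_simps)
    finally show "?N M1 * ?N M2 \<le> (b * b * \<bar>B\<bar> / a + 1) * ?N M3" .
  qed
qed

section \<open>Expansion of almost every tuple\<close>

text \<open>Wedges of standard basis vectors determine the operator norm up to a constant:
  multiplying by the matrix of \<open>g\<close> selects columns of \<open>M\<close>. Hence not all
  wedges can be contracted relative to the norm.\<close>

lemma op_norm_ext_pow_le_wedge:
  fixes M :: "real^'n^'n"
  shows "op_norm (ext_pow S M) \<le> real CARD('n \<Rightarrow> 'n) * real CARD('n \<Rightarrow> 'n) *
     (\<Sum>g\<in>UNIV. norm (ext_pow S M *v wedge S (\<chi> k j. if k = g j then 1 else 0)))"
proof (rule onorm_le_matrix_component)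
  fix f g :: "'n \<Rightarrow> 'n"
  let ?V = "\<lambda>g. (\<chi> k j. if k = g j then 1 else 0) :: real^'n^'n"
  \<comment> \<open>A wedge is read off in the column \<open>id\<close>, which forces the row to be
    the identity outside \<open>S\<close>; the minor itself depends only on the values inside
    \<open>S\<close>.\<close>
  define f' where "f' i = (if i \<in> S then f i else i)" for i
  have MV: "(M ** ?V g) $ k $ j = M $ k $ g j" for k j
    by (simp add: matrix_matrix_mult_def if_distrib[of "\<lambda>x. _ * x"] cong: if_cong)
  have "\<bar>ext_pow S M $ f $ g\<bar> \<le> \<bar>ext_pow S (M ** ?V g) $ f' $ id\<bar>"
  proof (cases "\<forall>i. i \<notin> S \<longrightarrow> f i = g i")
    case True
    have eq: "(\<chi> i j. if i \<in> S \<and> j \<in> S then M $ f i $ g j else mat 1 $ i $ j) =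
        (\<chi> i j. if i \<in> S \<and> j \<in> S then (M ** ?V g) $ f' i $ id j else mat 1 $ i $ j)"
      unfolding MV by (simp add: f'_def vec_eq_iff)
    have f': "\<forall>i. i \<notin> S \<longrightarrow> f' i = id i" by (simp add: f'_def)
    show ?thesis unfolding ext_pow_eq_det if_P[OF True] if_P[OF f'] eq by (rule order_refl)
  next
    case False
    then show ?thesis unfolding ext_pow_eq_det by (subst if_not_P) auto
  qed
  also have "\<dots> = \<bar>(ext_pow S M *v wedge S (?V g)) $ f'\<bar>"
    by (simp add: ext_pow_wedge wedge_nth)
  also have "\<dots> \<le> norm (ext_pow S M *v wedge S (?V g))" by (rule component_le_norm_cart)
  also have "\<dots> \<le> (\<Sum>g\<in>UNIV. norm (ext_pow S M *v wedge S (?V g)))"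
    by (rule member_le_sum[of g UNIV "\<lambda>g. norm (ext_pow S M *v wedge S (?V g))"]) auto
  finally show "\<bar>ext_pow S M $ f $ g\<bar> \<le> \<dots>" .
qed

lemma wedge_scaleR: "wedge S (c *\<^sub>R V) = c ^ card S *\<^sub>R wedge S V"
proof -
  have "tens_pow S (c *\<^sub>R V) $ f $ g = c ^ card S * tens_pow S V $ f $ g" for f g
  proof -
    have "tens_pow S (c *\<^sub>R V) $ f $ g = (\<Prod>i\<in>UNIV. (if i \<in> S then c else 1) * (if i \<in> S then V else mat 1) $ f i $ g i)"
      unfolding tens_pow_def vec_lambda_beta by (intro prod.cong) auto
    also have "\<dots> = (\<Prod>i\<in>UNIV. if i \<in> S then c else 1) * tens_pow S V $ f $ g"
      by (simp add: prod.distrib tens_pow_def)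
    also have "(\<Prod>i\<in>UNIV. if i \<in> S then c else 1) = c ^ card S"
      by (simp add: prod.If_cases)
    finally show ?thesis .
  qed
  then show ?thesis
    by (simp add: vec_eq_iff wedge_nth ext_pow_def sum_distrib_left[symmetric] mult.left_commute[of _ "c ^ card S"])
qed

lemma real_polynomial_function_wedge:
  fixes S :: "'n::finite set"
  shows "real_polynomial_function (\<lambda>v. l \<bullet> wedge S (transpose v))"
proof -
  have "real_polynomial_function (\<lambda>v :: real^'n^'n. (if i \<in> S then transpose v else mat 1) $ j $ k)" for i j k and S :: "'n set"
  proof (cases "i \<in> S")
    case True
    have "bounded_linear (\<lambda>v :: real^'n^'n. v $ k $ j)"
      by (intro bounded_linear_vec_nth bounded_linear_compose[OF bounded_linear_vec_nth])
    then show ?thesis using True by (simp add: transpose_def real_polynomial_function.intros(1))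
  qed (simp add: real_polynomial_function.intros(2))
  then show ?thesis
    unfolding inner_vec_def wedge_nth ext_pow_def tens_pow_def vec_lambda_beta inner_real_def
    by (intro real_polynomial_function_sum real_polynomial_function.intros(4) real_polynomial_function.intros(2)
        real_polynomial_function_divide real_polynomial_function_prod) auto
qed

lemma AE_invertible_transpose: "AE v :: real^'n^'n in lborel. invertible (transpose v)"
proof -
  have "{v :: real^'n^'n. det v = 0} \<in> null_sets lborel"
  proof (rule null_sets_homogeneous_polynomial_zeros)
    have "real_polynomial_function (\<lambda>v :: real^'n^'n. v $ i $ j)" for i j
      by (intro real_polynomial_function.intros(1) bounded_linear_vec_nth bounded_linear_compose[OF bounded_linear_vec_nth])
    then show "real_polynomial_function (det :: real^'n^'n \<Rightarrow> real)"
      unfolding det_def[abs_def]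
      by (intro real_polynomial_function_sum real_polynomial_function.intros(4) real_polynomial_function.intros(2)
          real_polynomial_function_prod) auto
    show "det (mat 1 :: real^'n^'n) \<noteq> 0" by simp
    show "det (c *\<^sub>R v) = c ^ CARD('n) * det v" for c and v :: "real^'n^'n"
      by (simp add: det_def prod.distrib sum_distrib_left mult_ac)
  qed
  from AE_not_in[OF this] show ?thesis
    by eventually_elim (simp add: invertible_det_nz)
qed

text \<open>Strong fast invertibility makes \<open>t \<mapsto> \<parallel>\<Lambda>X(t) w\<parallel> / \<parallel>\<Lambda>X(t)\<parallel>\<close> almost decreasing. Hence either it
  is bounded below by a positive constant, or it tends to 0, and the \<open>w\<close> of the second kind
  form a proper subspace.\<close>

lemma AE_wedge_expanding:
  fixes X :: "real \<Rightarrow> 'n::{finite,wellorder} square"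
  assumes inv: "\<And>t. 0 \<le> t \<Longrightarrow> invertible (X t)" and sfi: "strongly_fast_invertible L X" and L: "L \<le> CARD('n)"
  shows "AE v :: 'n square in lborel. \<exists>\<kappa>>0. \<forall>t\<ge>0.
     \<kappa> * op_norm (ext_pow (first_indices L) (cauchy_matrix X t 0)) \<le>
     norm (ext_pow (first_indices L) (cauchy_matrix X t 0) *v wedge (first_indices L) (transpose v))"
proof -
  let ?S = "first_indices L :: 'n set"
  define Z where "Z t s = ext_pow ?S (cauchy_matrix X t s)" for t s
  define f where "f w t = norm (Z t 0 *v w) / op_norm (Z t 0)" for w t
  have N_pos: "0 < op_norm (Z t 0)" if "0 \<le> t" for t
  proof -
    have "ext_pow ?S (matrix_inv (cauchy_matrix X t 0)) *v (Z t 0 *v wedge ?S (mat 1)) = wedge ?S (mat 1)"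
      unfolding Z_def using invertible_cauchy_matrix[OF inv[OF that] inv[OF order_refl]]
      by (simp add: ext_pow_wedge matrix_mul_assoc matrix_inv_mul)
    then have "Z t 0 *v wedge ?S (mat 1) \<noteq> 0"
      using wedge_mat_1_nonzero[of ?S] by (metis matrix_vector_mult_0_right)
    then have "\<not> op_norm (Z t 0) \<le> 0"
      using \<open>Z t 0 *v wedge ?S (mat 1) \<noteq> 0\<close> norm_matrix_vector_le[of "Z t 0" "wedge ?S (mat 1)"]
      by (metis mult_nonpos_nonneg norm_ge_zero norm_le_zero_iff order_trans)
    then show ?thesis by simp
  qed
  obtain C where C: "0 < C" "\<And>t s \<tau>. s \<le> t \<Longrightarrow> \<tau> \<le> s \<Longrightarrow> 0 \<le> \<tau> \<Longrightarrow> op_norm (Z t s) * op_norm (Z s \<tau>) \<le> C * op_norm (Z t \<tau>)"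
    using strongly_fast_invertible_ext_pow[OF inv sfi L] unfolding Z_def by blast
  \<comment> \<open>From s to t the numerator grows at most by the factor
    \<open>op_norm (Z t s)\<close>, and strong fast invertibility makes the denominator grow by at
    least that factor divided by \<open>C\<close>.\<close>
  have decr: "f w t \<le> C * f w s" if st: "0 \<le> s" "s \<le> t" for w s t
  proof -
    have "Z t 0 = Z t s ** Z s 0"
      unfolding Z_def ext_pow_mul[symmetric] using cauchy_matrix_cocycle[of X s t 0] inv[OF st(1)] by simp
    then have "norm (Z t 0 *v w) \<le> op_norm (Z t s) * norm (Z s 0 *v w)"
      by (simp add: matrix_vector_mul_assoc[symmetric] norm_matrix_vector_le)
    then have "norm (Z t 0 *v w) * op_norm (Z s 0) \<le> (op_norm (Z t s) * op_norm (Z s 0)) * norm (Z s 0 *v w)"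
      using mult_right_mono[of "norm (Z t 0 *v w)" "op_norm (Z t s) * norm (Z s 0 *v w)" "op_norm (Z s 0)"]
      by (simp add: mult_ac)
    also have "\<dots> \<le> C * op_norm (Z t 0) * norm (Z s 0 *v w)"
      using C(2)[OF st(2) st(1) order_refl] by (intro mult_right_mono) auto
    finally show ?thesis
      using N_pos[of s] N_pos[of t] st by (simp add: f_def field_simps)
  qed
  define W where "W = {w. (f w \<longlongrightarrow> 0) at_top}"
  have f_nonneg: "0 \<le> f w t" for w t by (simp add: f_def)
  have "subspace W"
    unfolding subspace_def
  proof (intro conjI ballI allI)
    show "0 \<in> W" by (simp add: W_def f_def[abs_def])
    fix w w' assume w: "w \<in> W" "w' \<in> W"
    have lim: "((\<lambda>t. f w t + f w' t) \<longlongrightarrow> 0) at_top" using w tendsto_add[of "f w" 0 at_top "f w'" 0] by (simp add: W_def)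
    have "norm (f (w + w') t) \<le> f w t + f w' t" for t
      using norm_triangle_ineq[of "Z t 0 *v w" "Z t 0 *v w'"]
      by (simp add: f_def matrix_vector_right_distrib add_divide_distrib[symmetric] divide_right_mono)
    then have "(f (w + w') \<longlongrightarrow> 0) at_top"
      by (intro Lim_null_comparison[OF always_eventually lim]) blast
    then show "w + w' \<in> W" by (simp add: W_def)
  next
    fix c :: real and w assume w: "w \<in> W"
    have "f (c *\<^sub>R w) = (\<lambda>t. \<bar>c\<bar> * f w t)" by (simp add: f_def fun_eq_iff matrix_vector_mult_scaleR)
    then show "c *\<^sub>R w \<in> W" using w tendsto_mult_left[of "f w" 0 at_top "\<bar>c\<bar>"] by (simp add: W_def)
  qed
  \<comment> \<open>If all wedges of basis vectors were contracted relative to the norm, so would be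
    the norm itself.\<close>
  have "\<exists>V. wedge ?S V \<notin> W"
  proof (rule ccontr)
    assume "\<not> ?thesis"
    then have all: "(f (wedge ?S V) \<longlongrightarrow> 0) at_top" for V by (simp add: W_def)
    define c where "c = real CARD('n \<Rightarrow> 'n) * real CARD('n \<Rightarrow> 'n)"
    let ?V = "\<lambda>g. (\<chi> k j. if k = g j then 1 else 0) :: 'n square"
    have "((\<lambda>t. c * (\<Sum>g\<in>UNIV. f (wedge ?S (?V g)) t)) \<longlongrightarrow> c * (\<Sum>g\<in>(UNIV :: ('n \<Rightarrow> 'n) set). 0)) at_top"
      by (intro tendsto_intros all)
    then have "\<forall>\<^sub>F t in at_top. c * (\<Sum>g\<in>UNIV. f (wedge ?S (?V g)) t) < 1"
      by (rule order_tendstoD) simp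
    then have "\<forall>\<^sub>F t :: real in at_top. False"
      using eventually_ge_at_top[of 0]
    proof eventually_elim
      case (elim t)
      have "op_norm (Z t 0) \<le> c * (\<Sum>g\<in>UNIV. norm (Z t 0 *v wedge ?S (?V g)))"
        unfolding Z_def c_def by (rule op_norm_ext_pow_le_wedge)
      also have "\<dots> = op_norm (Z t 0) * (c * (\<Sum>g\<in>UNIV. f (wedge ?S (?V g)) t))"
        using N_pos[OF elim(2)] by (simp add: f_def sum_divide_distrib[symmetric])
      finally have "1 \<le> c * (\<Sum>g\<in>UNIV. f (wedge ?S (?V g)) t)"
        using N_pos[OF elim(2)] by (simp add: mult_le_cancel_left1)
      then show ?case using elim(1) by simp
    qed
    then show False by simp
  qed
  then obtain V where V: "wedge ?S V \<notin> W" ..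
  \<comment> \<open>The vector \<open>l\<close> is a linear functional that vanishes on
    \<open>W\<close> but not on this wedge; applied to wedges of tuples it is a nonzero homogeneous
    polynomial.\<close>
  obtain y l where y: "y \<in> span W" and l: "\<And>w. w \<in> span W \<Longrightarrow> orthogonal l w" and dec: "wedge ?S V = y + l"
    using orthogonal_subspace_decomp_exists[of W "wedge ?S V"] by metis
  have span_W: "span W = W" using \<open>subspace W\<close> by (simp add: span_eq_iff)
  have "l \<noteq> 0" using V y dec span_W by auto
  then have nz: "l \<bullet> wedge ?S V \<noteq> 0"
    using l[OF y] by (simp add: dec inner_add_right orthogonal_def)
  have "{v. l \<bullet> wedge ?S (transpose v) = 0} \<in> null_sets lborel"
  proof (rule null_sets_homogeneous_polynomial_zeros)
    show "real_polynomial_function (\<lambda>v. l \<bullet> wedge ?S (transpose v))" by (rule real_polynomial_function_wedge)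
    show "l \<bullet> wedge ?S (transpose (transpose V)) \<noteq> 0" using nz by simp
    show "l \<bullet> wedge ?S (transpose (c *\<^sub>R v)) = c ^ card ?S * (l \<bullet> wedge ?S (transpose v))" for c v
      by (simp add: transpose_scalar wedge_scaleR)
  qed
  from AE_not_in[OF this] show ?thesis
  proof eventually_elim
    case (elim v)
    define w where "w = wedge ?S (transpose v)"
    have "w \<notin> W" using elim l span_W by (auto simp: w_def orthogonal_def)
    then have "\<not> (f w \<longlongrightarrow> 0) at_top" by (simp add: W_def)
    then obtain e where e: "0 < e" "\<not> (\<forall>\<^sub>F t in at_top. f w t < e)"
      using f_nonneg by (auto simp: tendsto_iff)
    \<comment> \<open>The ratio is at least \<open>e\<close> at arbitrarily late times, and
      near-monotonicity carries this bound back to every earlier time.\<close>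
    have "e / C \<le> f w s" if s: "0 \<le> s" for s
    proof -
      obtain t where t: "s \<le> t" "e \<le> f w t"
        using e(2) unfolding eventually_at_top_linorder by (meson not_less)
      then have "e \<le> C * f w s" using decr[OF s t(1), of w] by simp
      then show ?thesis using C(1) by (simp add: field_simps)
    qed
    then have "\<forall>t\<ge>0. e / C * op_norm (Z t 0) \<le> norm (Z t 0 *v w)"
      using N_pos by (simp add: f_def pos_le_divide_eq)
    then show ?case
      unfolding Z_def w_def using e(1) C(1) by (intro exI[of _ "e / C"]) auto
  qed
qed

section \<open>Benettin's algorithm\<close>

lemma grid_time_Suc: "grid_time h (Suc n) = grid_time h n + h (Suc n)"
  by (simp add: grid_time_def)

lemma grid_time_mono:
  assumes "\<And>n. 1 \<le> n \<Longrightarrow> 0 < h n" and "m \<le> n"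
  shows "grid_time h m \<le> grid_time h n"
  using assms(2) by (induction rule: dec_induct) (auto simp: grid_time_Suc less_imp_le[OF assms(1)] intro: add_increasing2)

text \<open>The factor by which the first \<open>n\<close> steps scale the exterior product of the initial vectors.\<close>

definition benettin_volume ::
    "(real \<Rightarrow> real \<Rightarrow> 'n::{finite,wellorder} square) \<Rightarrow> (nat \<Rightarrow> real) \<Rightarrow> 'n square \<Rightarrow> 'n set \<Rightarrow> nat \<Rightarrow> real" where
  "benettin_volume \<Phi> h v S n = (\<Prod>k=1..n. \<Prod>i\<in>S. benettin_R \<Phi> h v k $ i $ i)"

lemma benettin_step_qr:
  assumes \<Phi>: "one_step_map hmax \<Phi>" and h: "\<forall>n\<ge>1. 0 < h n \<and> h n \<le> hmax" and v: "invertible (transpose v)"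
  shows "invertible (benettin_V \<Phi> h v n) \<and>
    is_qr (step_matrix \<Phi> h (Suc n) ** benettin_V \<Phi> h v n) (benettin_V \<Phi> h v (Suc n)) (benettin_R \<Phi> h v (Suc n))"
proof (induction n)
  case 0
  have "0 \<le> grid_time h 0" by (simp add: grid_time_def)
  then have "invertible (step_matrix \<Phi> h (Suc 0))"
    using \<Phi> h[rule_format, of "Suc 0"] by (simp add: step_matrix_def one_step_map_def)
  then have "invertible (step_matrix \<Phi> h (Suc 0) ** transpose v)" using v by (rule invertible_mult)
  from is_qr_qr[OF this] show ?case using v by (simp add: benettin_R_def)
next
  case (Suc n)
  \<comment> \<open>Only the initial matrix depends on the assumption on \<open>v\<close>; all later
    ones are orthogonal.\<close>
  have "orthogonal_matrix (benettin_V \<Phi> h v (Suc n))" using Suc by (simp only: is_qr_def)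
  then have inv: "invertible (benettin_V \<Phi> h v (Suc n))" by (auto simp: orthogonal_matrix_def invertible_def)
  have "0 \<le> grid_time h (Suc n)"
    using grid_time_mono[of h 0 "Suc n"] h by (simp add: grid_time_def)
  then have "invertible (step_matrix \<Phi> h (Suc (Suc n)))"
    using \<Phi> h[rule_format, of "Suc (Suc n)"] by (simp add: step_matrix_def one_step_map_def)
  then have "invertible (step_matrix \<Phi> h (Suc (Suc n)) ** benettin_V \<Phi> h v (Suc n))" using inv by (rule invertible_mult)
  from is_qr_qr[OF this] show ?case using inv by (simp add: benettin_R_def del: benettin_V.simps(2)) (simp add: benettin_R_def)
qed

lemma benettin_volume_pos:
  assumes "one_step_map hmax \<Phi>" and "\<forall>n\<ge>1. 0 < h n \<and> h n \<le> hmax" and "invertible (transpose v)"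
  shows "0 < benettin_volume \<Phi> h v S n"
  unfolding benettin_volume_def
proof (intro prod_pos)
  fix k i assume k: "k \<in> {1..n}"
  obtain m where "k = Suc m" using k not0_implies_Suc[of k] by auto
  then show "0 < benettin_R \<Phi> h v k $ i $ i"
    using benettin_step_qr[OF assms, where n=m] by (simp only: is_qr_def)
qed

lemma sum_benettin_output:
  assumes "one_step_map hmax \<Phi>" and "\<forall>n\<ge>1. 0 < h n \<and> h n \<le> hmax" and "invertible (transpose v)"
    and L: "L \<le> CARD('n)"
  shows "(\<Sum>i=1..L. benettin_output \<Phi> h (v :: 'n::{finite,wellorder} square) i n) =
    1 / grid_time h n * ln (benettin_volume \<Phi> h v (first_indices L) n)"
proof -
  let ?R = "\<lambda>k i. benettin_R \<Phi> h v k $ i $ i"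
  have pos: "0 < ?R k i" if k: "k \<in> {1..n}" for k i
  proof -
    obtain m where "k = Suc m" using k not0_implies_Suc[of k] by auto
    then show ?thesis using benettin_step_qr[OF assms(1-3), where n=m] by (simp only: is_qr_def)
  qed
  have "ln (benettin_volume \<Phi> h v (first_indices L) n) = (\<Sum>k=1..n. \<Sum>i\<in>first_indices L. ln (?R k i))"
    unfolding benettin_volume_def using pos
    by (subst ln_prod) (auto simp: less_imp_neq[symmetric] intro!: sum.cong ln_prod prod_pos dest: less_imp_neq)
  also have "\<dots> = (\<Sum>i=1..L. \<Sum>k=1..n. ln (?R k (nth_index i)))"
    using L by (subst sum.swap) (simp add: sum_first_indices)
  finally show ?thesis by (simp add: benettin_output_def sum_distrib_left)
qed

text \<open>Reorthonormalisation only rescales the wedge. With the accumulated factor restored, the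
  wedges follow the linear recursion of the plain numerical product.\<close>

lemma ext_pow_benettin:
  assumes "one_step_map hmax \<Phi>" and "\<forall>n\<ge>1. 0 < h n \<and> h n \<le> hmax" and "invertible (transpose v)"
    and L: "L \<le> CARD('n)"
  shows "ext_pow (first_indices L) (step_matrix \<Phi> h (Suc n)) *v
      (benettin_volume \<Phi> h v (first_indices L) n *\<^sub>R wedge (first_indices L) (benettin_V \<Phi> h (v :: 'n::{finite,wellorder} square) n))
    = benettin_volume \<Phi> h v (first_indices L) (Suc n) *\<^sub>R wedge (first_indices L) (benettin_V \<Phi> h v (Suc n))"
proof -
  let ?V = "benettin_V \<Phi> h v" and ?R = "benettin_R \<Phi> h v" and ?S = "first_indices L :: 'n set"
  have qr: "step_matrix \<Phi> h (Suc n) ** ?V n = ?V (Suc n) ** ?R (Suc n)" "\<And>i j. j < i \<Longrightarrow> ?R (Suc n) $ i $ j = 0"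
    using benettin_step_qr[OF assms(1-3), where n=n] unfolding is_qr_def by blast+
  have "wedge ?S (?V (Suc n) ** ?R (Suc n)) = (\<Prod>i\<in>?S. ?R (Suc n) $ i $ i) *\<^sub>R wedge ?S (?V (Suc n))"
    using first_indices_down[OF L] qr(2) by (intro wedge_mult_upper_triangular)
  then show ?thesis
    by (simp add: matrix_vector_mult_scaleR ext_pow_wedge qr(1) benettin_volume_def del: benettin_V.simps)
qed

text \<open>The perturbation is kept below half of the expansion \<open>\<kappa>\<close>, so the
  numerical wedge retains the size of the exact exterior power. The constants are chosen before the
  stepsizes and hold uniformly for all of them.\<close>

lemma benettin_volume_bounds:
  fixes A X :: "real \<Rightarrow> 'n::{finite,wellorder} square"
  assumes X: "fundamental_matrix A X" and K: "\<And>t. 0 \<le> t \<Longrightarrow> op_norm (A t) \<le> K" "0 \<le> K"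
    and L: "L \<le> CARD('n)" and sfi: "strongly_fast_invertible L X"
    and hmax: "0 < hmax" and \<Phi>: "one_step_map hmax \<Phi>" and p: "0 < p" and consist: "consistent_of_order hmax X p \<Phi>"
    and v: "invertible (transpose v)" and \<kappa>: "0 < \<kappa>"
    and expand: "\<And>t. 0 \<le> t \<Longrightarrow> \<kappa> * op_norm (ext_pow (first_indices L) (cauchy_matrix X t 0)) \<le>
      norm (ext_pow (first_indices L) (cauchy_matrix X t 0) *v wedge (first_indices L) (transpose v))"
  shows "\<exists>\<epsilon>>0. \<exists>a b. 0 < a \<and> 0 < b \<and> (\<forall>h :: nat \<Rightarrow> real. (\<forall>n\<ge>1. 0 < h n \<and> h n \<le> hmax) \<longrightarrow>
       summable (\<lambda>n. h (Suc n) powr (p + 1)) \<longrightarrow> (\<Sum>n. h (Suc n) powr (p + 1)) < \<epsilon> \<longrightarrow>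
       (\<forall>n\<ge>1. a * op_norm (ext_pow (first_indices L) (X (grid_time h n))) \<le> benettin_volume \<Phi> h v (first_indices L) n \<and>
              benettin_volume \<Phi> h v (first_indices L) n \<le> b * op_norm (ext_pow (first_indices L) (X (grid_time h n)))))"
proof -
  let ?S = "first_indices L :: 'n set"
  let ?N = "\<lambda>M :: 'n square. op_norm (ext_pow ?S M)"
  define w where "w = wedge ?S (transpose v)"
  have inv: "invertible (X t)" if "0 \<le> t" for t using X that by (simp add: fundamental_matrix_def)
  obtain C where C: "0 < C" "\<And>t s \<tau>. s \<le> t \<Longrightarrow> \<tau> \<le> s \<Longrightarrow> 0 \<le> \<tau> \<Longrightarrow>
      ?N (cauchy_matrix X t s) * ?N (cauchy_matrix X s \<tau>) \<le> C * ?N (cauchy_matrix X t \<tau>)"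
    using strongly_fast_invertible_ext_pow[OF inv sfi L] by blast
  obtain c where c: "0 < c" "\<And>t h. 0 \<le> t \<Longrightarrow> 0 \<le> h \<Longrightarrow> h \<le> hmax \<Longrightarrow>
      op_norm (\<Phi> t h - cauchy_matrix X (t + h) t) \<le> c * h powr (p + 1)"
    using consist unfolding consistent_of_order_def by auto
  define K1 where "K1 = exp (K * hmax)"
  \<comment> \<open>A common bound for exact and numerical steps, so that the Lipschitz estimate
    applies to both.\<close>
  define K2 where "K2 = K1 + c * hmax powr (p + 1)"
  have step: "op_norm (cauchy_matrix X t s) \<le> K1" if "0 \<le> s" "0 \<le> t" "\<bar>t - s\<bar> \<le> hmax" for t s
  proof -
    have "op_norm (cauchy_matrix X t s) \<le> exp (K * \<bar>t - s\<bar>)" using X K(1) that(1,2) by (rule op_norm_cauchy_matrix)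
    also have "\<dots> \<le> K1" using that(3) K(2) by (simp add: K1_def mult_left_mono)
    finally show ?thesis .
  qed
  obtain l where l: "0 < l" "\<And>M N :: 'n square. op_norm M \<le> K2 \<Longrightarrow> op_norm N \<le> K2 \<Longrightarrow>
      op_norm (ext_pow ?S M - ext_pow ?S N) \<le> l * op_norm (M - N)"
    using ext_pow_lipschitz[of K2 ?S] by blast
  \<comment> \<open>The cost of undoing one exact step in the exterior power.\<close>
  define b1 where "b1 = real CARD('n \<Rightarrow> 'n) * real CARD('n \<Rightarrow> 'n) * K1 ^ card ?S"
  have b1: "0 < b1" by (simp add: b1_def K1_def)
  \<comment> \<open>The factors are the Lipschitz constant, the consistency constant, the backward
    step and the strong fast invertibility constant.\<close>
  define D where "D = l * c * b1 * C"
  have D: "0 < D" using l c b1 C by (simp add: D_def)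
  \<comment> \<open>Solves exp(D \<epsilon>) - 1 = \<kappa> / (2 (||w|| + 1)), so the relative error
    times ||w|| stays below \<kappa>/2. The added 1 keeps the denominator positive.\<close>
  define \<epsilon> where "\<epsilon> = ln (1 + \<kappa> / (2 * (norm w + 1))) / D"
  have w1: "0 < norm w + 1" by (simp add: add_nonneg_pos)
  have "0 < \<kappa> / (2 * (norm w + 1))" using \<kappa> w1 by simp
  then have \<epsilon>: "0 < \<epsilon>" unfolding \<epsilon>_def using D by (intro divide_pos_pos ln_gt_zero) auto
  obtain \<alpha> \<beta> where ab: "0 < \<alpha>" "0 < \<beta>"
    "\<And>Q :: 'n square. orthogonal_matrix Q \<Longrightarrow> \<alpha> \<le> norm (wedge ?S Q)"
    "\<And>Q :: 'n square. orthogonal_matrix Q \<Longrightarrow> norm (wedge ?S Q) \<le> \<beta>"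
    using norm_wedge_orthogonal[of ?S] by blast
  \<comment> \<open>These constants pass between \<open>X t\<close> and the Cauchy matrix from time
    0; the added 1 ensures positivity.\<close>
  define n0 where "n0 = ?N (X 0) + 1"
  define n1 where "n1 = ?N (matrix_inv (X 0)) + 1"
  have n: "0 < n0" "0 < n1" by (simp_all add: n0_def n1_def add_nonneg_pos)
  have N_X: "?N (X t) \<le> n0 * ?N (cauchy_matrix X t 0)" "?N (cauchy_matrix X t 0) \<le> n1 * ?N (X t)" for t
  proof -
    have "X t = cauchy_matrix X t 0 ** X 0"
      by (simp add: cauchy_matrix_def matrix_mul_assoc[symmetric] matrix_inv_mul[OF inv])
    then have "?N (X t) \<le> ?N (cauchy_matrix X t 0) * ?N (X 0)" by (metis op_norm_ext_pow_mul)
    also have "\<dots> \<le> ?N (cauchy_matrix X t 0) * n0" by (intro mult_left_mono) (simp_all add: n0_def)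
    finally show "?N (X t) \<le> n0 * ?N (cauchy_matrix X t 0)" by (simp only: mult.commute)
    have "?N (cauchy_matrix X t 0) \<le> ?N (X t) * ?N (matrix_inv (X 0))"
      unfolding cauchy_matrix_def by (rule op_norm_ext_pow_mul)
    also have "\<dots> \<le> ?N (X t) * n1" by (intro mult_left_mono) (simp_all add: n1_def)
    finally show "?N (cauchy_matrix X t 0) \<le> n1 * ?N (X t)" by (simp only: mult.commute)
  qed
  show ?thesis
  proof (rule exI[of _ \<epsilon>], intro conjI \<epsilon>, rule exI[of _ "\<kappa> / 2 / n0 / \<beta>"], rule exI[of _ "(norm w + \<kappa> / 2) * n1 / \<alpha>"],
      intro conjI allI impI)
    show "0 < \<kappa> / 2 / n0 / \<beta>" using \<kappa> n ab by simp
    show "0 < (norm w + \<kappa> / 2) * n1 / \<alpha>" using \<kappa> n ab by (simp add: add_nonneg_pos)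
    fix h :: "nat \<Rightarrow> real" and n :: nat
    assume h: "\<forall>n\<ge>1. 0 < h n \<and> h n \<le> hmax" and summ: "summable (\<lambda>n. h (Suc n) powr (p + 1))"
      and small: "(\<Sum>n. h (Suc n) powr (p + 1)) < \<epsilon>" and n_ge: "1 \<le> n"
    have h': "0 < h n \<and> h n \<le> hmax" if "1 \<le> n" for n using h that by blast
    define t where "t = grid_time h"
    have t_Suc: "t (Suc k) = t k + h (Suc k)" for k by (simp add: t_def grid_time_Suc)
    have t_mono: "t j \<le> t k" if "j \<le> k" for j k unfolding t_def using h' that by (intro grid_time_mono) auto
    have t_0: "t 0 = 0" by (simp add: t_def grid_time_def)
    have t_nonneg: "0 \<le> t k" for k using t_mono[of 0 k] t_0 by simp
    define Z where "Z n m = ext_pow ?S (cauchy_matrix X (t n) (t m))" for n m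
    define E where "E k = ext_pow ?S (step_matrix \<Phi> h (Suc k)) - Z (Suc k) k" for k
    define u where "u k = benettin_volume \<Phi> h v ?S k *\<^sub>R wedge ?S (benettin_V \<Phi> h v k)" for k
    define a where "a k = D * h (Suc k) powr (p + 1)" for k
    have u_0: "u 0 = w" by (simp add: u_def benettin_volume_def w_def)
    have E: "op_norm (E k) \<le> l * c * h (Suc k) powr (p + 1)" for k
    proof -
      have hk: "0 \<le> h (Suc k)" "h (Suc k) \<le> hmax" using h'[of "Suc k"] by auto
      let ?\<Phi> = "step_matrix \<Phi> h (Suc k)" and ?X = "cauchy_matrix X (t (Suc k)) (t k)"
      have diff: "op_norm (?\<Phi> - ?X) \<le> c * h (Suc k) powr (p + 1)"
        using c(2)[OF t_nonneg hk] by (simp add: step_matrix_def t_Suc t_def[symmetric])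
      have X1: "op_norm ?X \<le> K1" using hk t_nonneg by (intro step) (auto simp: t_Suc intro: add_nonneg_nonneg)
      have "op_norm ?\<Phi> \<le> op_norm (?\<Phi> - ?X) + op_norm ?X" using op_norm_triangle[of "?\<Phi> - ?X" ?X] by simp
      also have "\<dots> \<le> c * hmax powr (p + 1) + K1"
        using diff X1 hk p c(1) by (intro add_mono order_trans[OF diff] mult_left_mono powr_mono2) auto
      finally have "op_norm ?\<Phi> \<le> K2" by (simp add: K2_def)
      moreover have "op_norm ?X \<le> K2" using X1 c(1) by (simp add: K2_def add_increasing2)
      ultimately have "op_norm (E k) \<le> l * op_norm (?\<Phi> - ?X)" unfolding E_def Z_def by (rule l(2))
      also have "\<dots> \<le> l * (c * h (Suc k) powr (p + 1))" using diff l(1) by (intro mult_left_mono) auto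
      finally show ?thesis by (simp add: mult.assoc)
    qed
    have cocycle: "cauchy_matrix X (t i) (t j) ** cauchy_matrix X (t j) (t k) = cauchy_matrix X (t i) (t k)" for i j k
      using t_nonneg by (intro cauchy_matrix_cocycle inv)
    have diag: "cauchy_matrix X (t k) (t k) = mat 1" for k
      using t_nonneg by (intro cauchy_matrix_self inv)
    have pert: "norm (u n - Z n 0 *v u 0) \<le> op_norm (Z n 0) * norm (u 0) * ((\<Prod>k<n. 1 + a k) - 1)"
    proof (rule perturbed_cocycle_bound)
      show "Z (Suc n) m = Z (Suc n) n ** Z n m" for n m
        by (simp add: Z_def ext_pow_mul[symmetric] cocycle)
      show "Z (Suc n) (Suc n) ** E n = E n" for n
      proof -
        \<comment> \<open>The sum is the exterior power of the numerical step, on which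
          multiplication by the projection acts trivially; the exact step has the same property,
          hence so does the difference.\<close>
        have "Z (Suc n) (Suc n) ** (E n + Z (Suc n) n) = E n + Z (Suc n) n"
          by (simp add: E_def) (simp add: Z_def ext_pow_mul[symmetric] diag)
        moreover have "Z (Suc n) (Suc n) ** Z (Suc n) n = Z (Suc n) n"
          by (simp add: Z_def ext_pow_mul[symmetric] diag)
        ultimately show ?thesis by (simp add: matrix_add_ldistrib)
      qed
      show "u (Suc n) = (Z (Suc n) n + E n) *v u n" for n
        unfolding u_def using ext_pow_benettin[OF \<Phi> h v L, of n] by (simp add: E_def)
      show "u 0 = Z 0 0 *v u 0"
        by (simp add: u_0 Z_def diag w_def ext_pow_wedge)
      show "0 \<le> a k" for k using D by (simp add: a_def)
      show "op_norm (Z n (Suc k)) * op_norm (E k) * op_norm (Z k 0) \<le> a k * op_norm (Z n 0)" if "k < n" for n k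
      proof -
        \<comment> \<open>The local error separates t_k from t_{k+1}, while strong fast
          invertibility joins intervals with a common endpoint; a backward step closes the
          gap.\<close>
        have "op_norm (Z k 0) \<le> op_norm (Z k (Suc k)) * op_norm (Z (Suc k) 0)"
          unfolding Z_def cocycle[symmetric, of k 0 "Suc k"] by (rule op_norm_ext_pow_mul)
        also have "op_norm (Z k (Suc k)) \<le> b1"
          unfolding Z_def b1_def using t_nonneg h'[of "Suc k"]
          by (intro op_norm_ext_pow_bound step) (auto simp: t_Suc intro: add_nonneg_nonneg)
        finally have Zk: "op_norm (Z k 0) \<le> b1 * op_norm (Z (Suc k) 0)" by (simp add: mult_right_mono)
        have "op_norm (Z n (Suc k)) * op_norm (E k) * op_norm (Z k 0) \<le>
            op_norm (Z n (Suc k)) * (l * c * h (Suc k) powr (p + 1)) * (b1 * op_norm (Z (Suc k) 0))"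
          using E[of k] Zk l c by (intro mult_mono) auto
        also have "\<dots> = l * c * b1 * h (Suc k) powr (p + 1) * (op_norm (Z n (Suc k)) * op_norm (Z (Suc k) 0))"
          by (simp only: mult_ac)
        also have "\<dots> \<le> l * c * b1 * h (Suc k) powr (p + 1) * (C * op_norm (Z n 0))"
          unfolding Z_def using l c b1 t_mono[of "Suc k" n] t_mono[of 0 "Suc k"] t_nonneg that
          by (intro mult_left_mono C(2)) auto
        also have "\<dots> = a k * op_norm (Z n 0)" by (simp only: a_def D_def mult_ac)
        finally show ?thesis .
      qed
    qed
    have "(\<Prod>k<n. 1 + a k) \<le> (\<Prod>k<n. exp (a k))"
      using D by (intro prod_mono) (auto simp: a_def exp_ge_add_one_self)
    also have "\<dots> = exp (D * (\<Sum>k<n. h (Suc k) powr (p + 1)))"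
      by (simp add: exp_sum a_def sum_distrib_left)
    also have "\<dots> \<le> exp (D * \<epsilon>)"
      using D small sum_le_suminf[OF summ, of "{..<n}"] by (simp add: mult_left_mono)
    also have "\<dots> = 1 + \<kappa> / (2 * (norm w + 1))"
      using D \<kappa> w1 by (simp add: \<epsilon>_def add_pos_nonneg)
    finally have prod_le: "(\<Prod>k<n. 1 + a k) - 1 \<le> \<kappa> / (2 * (norm w + 1))" by simp
    have "norm w * ((\<Prod>k<n. 1 + a k) - 1) \<le> (norm w + 1) * (\<kappa> / (2 * (norm w + 1)))"
      using prod_le \<kappa> by (intro mult_mono) (auto simp: a_def D less_imp_le intro!: prod_ge_1)
    also have "\<dots> = \<kappa> / 2" using w1 by (simp add: field_simps)
    finally have "op_norm (Z n 0) * (norm w * ((\<Prod>k<n. 1 + a k) - 1)) \<le> op_norm (Z n 0) * (\<kappa> / 2)"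
      by (intro mult_left_mono) auto
    then have pert': "norm (u n - Z n 0 *v w) \<le> op_norm (Z n 0) * (\<kappa> / 2)"
      by (rule order_trans[OF pert[unfolded u_0 mult.assoc]])
    have Z_exp: "\<kappa> * op_norm (Z n 0) \<le> norm (Z n 0 *v w)"
      using expand[OF t_nonneg] by (simp add: Z_def t_0 w_def)
    have u_lower: "\<kappa> / 2 * op_norm (Z n 0) \<le> norm (u n)"
      using pert' Z_exp norm_triangle_ineq2[of "Z n 0 *v w" "Z n 0 *v w - u n"]
      by (simp add: norm_minus_commute algebra_simps)
    have u_upper: "norm (u n) \<le> (norm w + \<kappa> / 2) * op_norm (Z n 0)"
      using pert' norm_matrix_vector_le[of "Z n 0" w] norm_triangle_ineq[of "u n - Z n 0 *v w" "Z n 0 *v w"]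
      by (simp add: algebra_simps)
    have vol: "0 < benettin_volume \<Phi> h v ?S n" using \<Phi> h v by (rule benettin_volume_pos)
    \<comment> \<open>At least one step is required, since the initial matrix need not be
      orthogonal.\<close>
    obtain m where m: "n = Suc m" using n_ge not0_implies_Suc[of n] by auto
    have Q: "orthogonal_matrix (benettin_V \<Phi> h v n)"
      unfolding m using benettin_step_qr[OF \<Phi> h v, where n=m] by (simp only: is_qr_def)
    have norm_u: "norm (u n) = benettin_volume \<Phi> h v ?S n * norm (wedge ?S (benettin_V \<Phi> h v n))"
      using vol by (simp add: u_def)
    have "\<kappa> / 2 * ?N (X (t n)) \<le> \<kappa> / 2 * (n0 * op_norm (Z n 0))"
      using N_X(1)[of "t n"] \<kappa> by (intro mult_left_mono) (auto simp: Z_def t_0)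
    also have "\<dots> \<le> n0 * norm (u n)" using u_lower n by (simp add: mult_ac)
    also have "\<dots> \<le> n0 * (benettin_volume \<Phi> h v ?S n * \<beta>)"
      unfolding norm_u using n ab Q vol by (intro mult_left_mono) auto
    finally show "\<kappa> / 2 / n0 / \<beta> * ?N (X (grid_time h n)) \<le> benettin_volume \<Phi> h v ?S n"
      using n ab by (simp add: t_def[symmetric] field_simps)
    have "benettin_volume \<Phi> h v ?S n * \<alpha> \<le> norm (u n)"
      unfolding norm_u using ab Q vol by (intro mult_left_mono) auto
    also have "\<dots> \<le> (norm w + \<kappa> / 2) * (n1 * ?N (X (t n)))"
      using u_upper N_X(2)[of "t n"] \<kappa> by (intro order_trans[OF u_upper] mult_left_mono) (auto simp: Z_def t_0 add_nonneg_nonneg)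
    finally show "benettin_volume \<Phi> h v ?S n \<le> (norm w + \<kappa> / 2) * n1 / \<alpha> * ?N (X (grid_time h n))"
      using ab by (simp add: t_def[symmetric] field_simps)
  qed
qed

section \<open>Passage to the exponential rate\<close>

lemma tendsto_exponential_rate:
  fixes \<rho> t :: "nat \<Rightarrow> real" and N :: "real \<Rightarrow> real"
  assumes t: "filterlim t at_top sequentially" and a: "0 < a" and b: "0 < b"
    and bounds: "\<And>n. 1 \<le> n \<Longrightarrow> a * N (t n) \<le> \<rho> n \<and> \<rho> n \<le> b * N (t n)"
    and growth: "\<And>\<epsilon>. 0 < \<epsilon> \<Longrightarrow> \<forall>\<^sub>F \<tau>::real in at_top. exp ((\<sigma> - \<epsilon>) * \<tau>) \<le> N \<tau> \<and> N \<tau> \<le> exp ((\<sigma> + \<epsilon>) * \<tau>)"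
  shows "(\<lambda>n. 1 / t n * ln (\<rho> n)) \<longlonglongrightarrow> \<sigma>"
proof (rule tendstoI)
  fix e :: real assume "0 < e"
  \<comment> \<open>One third is spent on the growth of \<open>N\<close>, one on the constants
    \<open>a\<close> and \<open>b\<close>; the last keeps the inequality strict.\<close>
  define \<epsilon> where "\<epsilon> = e / 3"
  have \<epsilon>: "0 < \<epsilon>" using \<open>0 < e\<close> by (simp add: \<epsilon>_def)
  have "\<forall>\<^sub>F \<tau>::real in at_top. (exp ((\<sigma> - \<epsilon>) * \<tau>) \<le> N \<tau> \<and> N \<tau> \<le> exp ((\<sigma> + \<epsilon>) * \<tau>)) \<and>
      1 / a \<le> exp (\<epsilon> * \<tau>) \<and> b \<le> exp (\<epsilon> * \<tau>) \<and> 0 < \<tau>"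
    using \<epsilon> by (intro eventually_conj growth eventually_const_le_exp eventually_gt_at_top)
  then have "\<forall>\<^sub>F n in sequentially. (exp ((\<sigma> - \<epsilon>) * t n) \<le> N (t n) \<and> N (t n) \<le> exp ((\<sigma> + \<epsilon>) * t n)) \<and>
      1 / a \<le> exp (\<epsilon> * t n) \<and> b \<le> exp (\<epsilon> * t n) \<and> 0 < t n"
    using t by (rule eventually_compose_filterlim)
  then show "\<forall>\<^sub>F n in sequentially. dist (1 / t n * ln (\<rho> n)) \<sigma> < e"
    using eventually_ge_at_top[of 1]
  proof eventually_elim
    case (elim n)
    have "exp ((\<sigma> - 2 * \<epsilon>) * t n) = exp (- (\<epsilon> * t n)) * exp ((\<sigma> - \<epsilon>) * t n)"
      by (simp add: exp_add[symmetric] algebra_simps)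
    also have "\<dots> \<le> a * N (t n)"
    proof (rule mult_mono)
      have "1 \<le> a * exp (\<epsilon> * t n)" using elim a by (simp add: field_simps)
      then show "exp (- (\<epsilon> * t n)) \<le> a" by (simp add: exp_minus field_simps)
    qed (use elim a in auto)
    also have "\<dots> \<le> \<rho> n" using bounds elim by blast
    finally have lower: "exp ((\<sigma> - 2 * \<epsilon>) * t n) \<le> \<rho> n" .
    then have pos: "0 < \<rho> n" using exp_gt_zero less_le_trans by blast
    have "\<rho> n \<le> b * N (t n)" using bounds elim by blast
    also have "\<dots> \<le> exp (\<epsilon> * t n) * exp ((\<sigma> + \<epsilon>) * t n)"
      using elim b by (intro mult_mono) (auto intro: order_trans[OF exp_ge_zero])
    also have "\<dots> = exp ((\<sigma> + 2 * \<epsilon>) * t n)" by (simp add: exp_add[symmetric] algebra_simps)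
    finally have "ln (\<rho> n) \<le> (\<sigma> + 2 * \<epsilon>) * t n" using pos ln_le_cancel_iff[of "\<rho> n" "exp ((\<sigma> + 2 * \<epsilon>) * t n)"] by simp
    moreover have "(\<sigma> - 2 * \<epsilon>) * t n \<le> ln (\<rho> n)" using lower pos by (simp add: ln_ge_iff)
    ultimately have "1 / t n * ln (\<rho> n) \<le> \<sigma> + 2 * \<epsilon>" "\<sigma> - 2 * \<epsilon> \<le> 1 / t n * ln (\<rho> n)"
      using elim by (simp_all add: field_simps)
    then show "dist (1 / t n * ln (\<rho> n)) \<sigma> < e"
      using \<epsilon> by (simp add: dist_real_def \<epsilon>_def abs_less_iff)
  qed
qed

theorem theorem4p11:
  fixes A X :: "real \<Rightarrow> 'n::{finite,wellorder} square"
    and \<Phi> :: "real \<Rightarrow> real \<Rightarrow> 'n square"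
    and L :: nat and p hmax :: real
  assumes "continuous_on {0..} A"
    and "bounded (A ` {0..})"
    and "1 \<le> L" and "L \<le> CARD('n)"
    and "fundamental_matrix A X"
    and "regular_system A X"
    and "strongly_fast_invertible L X"
    and "0 < hmax"
    and "one_step_map hmax \<Phi>"
    and "0 < p"
    and "consistent_of_order hmax X p \<Phi>"
  shows "AE v :: 'n square in lebesgue. \<exists>\<epsilon>>0. \<forall>h :: nat \<Rightarrow> real.
           (\<forall>n\<ge>1. 0 < h n \<and> h n \<le> hmax) \<longrightarrow>
           filterlim (grid_time h) at_top sequentially \<longrightarrow>
           summable (\<lambda>n. h (Suc n) powr (p + 1)) \<longrightarrow>
           (\<Sum>n. h (Suc n) powr (p + 1)) < \<epsilon> \<longrightarrow>
           ((\<lambda>n. ereal (\<Sum>i=1..L. benettin_output \<Phi> h v i n)) \<longlongrightarrow> (\<Sum>i=1..L. Lyap A i))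
             sequentially"
proof -
  let ?S = "first_indices L :: 'n set"
  obtain K where "0 < K" "\<forall>t\<in>{0..}. op_norm (A t) \<le> K" using bounded_op_norm[OF assms(2)] by blast
  then have K: "\<And>t. 0 \<le> t \<Longrightarrow> op_norm (A t) \<le> K" "0 \<le> K" by auto
  have inv: "invertible (X t)" if "0 \<le> t" for t
    using assms(5) that by (simp add: fundamental_matrix_def)
  obtain \<sigma> where \<sigma>: "(\<Sum>i=1..L. Lyap A i) = ereal \<sigma>"
    and growth: "\<And>\<epsilon>. 0 < \<epsilon> \<Longrightarrow> \<forall>\<^sub>F t in at_top. exp ((\<sigma> - \<epsilon>) * t) \<le> op_norm (ext_pow ?S (X t)) \<and>
       op_norm (ext_pow ?S (X t)) \<le> exp ((\<sigma> + \<epsilon>) * t)"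
    using ext_pow_growth[OF assms(5) K(1) assms(6) assms(4)] by blast
  have "AE v :: 'n square in lborel. invertible (transpose v)" by (rule AE_invertible_transpose)
  moreover have "AE v :: 'n square in lborel. \<exists>\<kappa>>0. \<forall>t\<ge>0. \<kappa> * op_norm (ext_pow ?S (cauchy_matrix X t 0)) \<le>
     norm (ext_pow ?S (cauchy_matrix X t 0) *v wedge ?S (transpose v))"
    using inv assms(7,4) by (rule AE_wedge_expanding)
  ultimately have "AE v :: 'n square in lborel. \<exists>\<epsilon>>0. \<forall>h :: nat \<Rightarrow> real.
           (\<forall>n\<ge>1. 0 < h n \<and> h n \<le> hmax) \<longrightarrow>
           filterlim (grid_time h) at_top sequentially \<longrightarrow>
           summable (\<lambda>n. h (Suc n) powr (p + 1)) \<longrightarrow>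
           (\<Sum>n. h (Suc n) powr (p + 1)) < \<epsilon> \<longrightarrow>
           ((\<lambda>n. ereal (\<Sum>i=1..L. benettin_output \<Phi> h v i n)) \<longlongrightarrow> (\<Sum>i=1..L. Lyap A i))
             sequentially"
  proof eventually_elim
    case (elim v)
    then obtain \<kappa> where \<kappa>: "0 < \<kappa>" "\<And>t. 0 \<le> t \<Longrightarrow> \<kappa> * op_norm (ext_pow ?S (cauchy_matrix X t 0)) \<le>
      norm (ext_pow ?S (cauchy_matrix X t 0) *v wedge ?S (transpose v))" by blast
    have "\<exists>\<epsilon>>0. \<exists>a b. 0 < a \<and> 0 < b \<and> (\<forall>h :: nat \<Rightarrow> real. (\<forall>n\<ge>1. 0 < h n \<and> h n \<le> hmax) \<longrightarrow>
       summable (\<lambda>n. h (Suc n) powr (p + 1)) \<longrightarrow> (\<Sum>n. h (Suc n) powr (p + 1)) < \<epsilon> \<longrightarrow>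
       (\<forall>n\<ge>1. a * op_norm (ext_pow ?S (X (grid_time h n))) \<le> benettin_volume \<Phi> h v ?S n \<and>
              benettin_volume \<Phi> h v ?S n \<le> b * op_norm (ext_pow ?S (X (grid_time h n)))))"
      using assms(5) K assms(4,7-11) elim(1) \<kappa> by (rule benettin_volume_bounds)
    then obtain \<epsilon> a b where \<epsilon>: "0 < \<epsilon>" and ab: "0 < a" "0 < b"
      and bounds: "\<forall>h :: nat \<Rightarrow> real. (\<forall>n\<ge>1. 0 < h n \<and> h n \<le> hmax) \<longrightarrow>
       summable (\<lambda>n. h (Suc n) powr (p + 1)) \<longrightarrow> (\<Sum>n. h (Suc n) powr (p + 1)) < \<epsilon> \<longrightarrow>
       (\<forall>n\<ge>1. a * op_norm (ext_pow ?S (X (grid_time h n))) \<le> benettin_volume \<Phi> h v ?S n \<and>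
              benettin_volume \<Phi> h v ?S n \<le> b * op_norm (ext_pow ?S (X (grid_time h n))))"
      by (elim exE conjE) (rule that)
    show ?case
    proof (intro exI[of _ \<epsilon>] conjI allI impI \<epsilon>)
      fix h :: "nat \<Rightarrow> real"
      assume h: "\<forall>n\<ge>1. 0 < h n \<and> h n \<le> hmax" and t: "filterlim (grid_time h) at_top sequentially"
        and summ: "summable (\<lambda>n. h (Suc n) powr (p + 1))" and small: "(\<Sum>n. h (Suc n) powr (p + 1)) < \<epsilon>"
      have "(\<lambda>n. 1 / grid_time h n * ln (benettin_volume \<Phi> h v ?S n)) \<longlonglongrightarrow> \<sigma>"
        using t ab bounds[rule_format, OF h[rule_format] summ small] growth by (rule tendsto_exponential_rate)
      then have "(\<lambda>n. \<Sum>i=1..L. benettin_output \<Phi> h v i n) \<longlonglongrightarrow> \<sigma>"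
        using sum_benettin_output[OF assms(9) h elim(1) assms(4)] by simp
      then show "(\<lambda>n. ereal (\<Sum>i=1..L. benettin_output \<Phi> h v i n)) \<longlonglongrightarrow> (\<Sum>i=1..L. Lyap A i)"
        unfolding \<sigma> by simp
    qed
  qed
  \<comment> \<open>Lebesgue measure is the completion of Borel-Lebesgue measure, so the exceptional
    null set stays null.\<close>
  then show ?thesis by (rule AE_completion)
qed

end
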